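(* For each $n\in\mathbb N$ let $\sigma_n$ be a finite positive Borel measure on the unit circle $\mathbb T$, $g_n$ a continuous real-valued function on $\mathbb T$, and $W_n$ a monic polynomial of degree $n$ with all its zeros $b_{n,1},\dots,b_{n,n}$ in the open unit disk $\mathbb D$. Write $d\sigma_n=\upsilon_n\,dm+d\sigma_n^s$ with $\sigma_n^s$ singular to the normalized Lebesgue measure $m$ on $\mathbb T$. Let $\phi_n(z)=\alpha_nz^n+\cdots$, $\alpha_n>0$, be the $n$-th orthonormal polynomial with respect to the measure $e^{g_n}|W_n|^{-2}d\sigma_n$, i.e., $\int\phi_n(\xi)\overline{\xi^m}\frac{e^{g_n(\xi)}d\sigma_n(\xi)}{|W_n(\xi)|^2}=0$ for $m\in\{0,\dots,n-1\}$ and $\int|\phi_n(\xi)|^2\frac{e^{g_n(\xi)}d\sigma_n(\xi)}{|W_n(\xi)|^2}=1$. Assume that $(A_{\mathbb T})$ there exists a finite measure $d\sigma=\upsilon\,dm+d\sigma^s$, with $\sigma^s$ singular to $m$, such that $\limsup_{n\to\infty}\int f\,d\sigma_n\le\int f\,d\sigma$ for every non-negative continuous function $f$ on $\mathbb T$; $(B_{\mathbb T})$ $\log\upsilon_n,\log\upsilon\in L^1(m)$ and $\|\log\upsilon_n-\log\upsilon\|_{L^1(\mathbb T)}\to0$ as $n\to\infty$; $(C_{\mathbb T})$ the functions $g_n$ belong to $\mathcal E$, a fixed compact subset of $C(\mathbb T)$; $(D_{\mathbb T})$ $\sum_{j=1}^n(1-|b_{n,j}|)\to\infty$ as $n\to\infty$.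 Then $$\frac{\phi_n^*(z)}{W_n^*(z)}D_n(z)=1+o_{\mathcal E}(1)\quad\text{and}\quad\frac{\phi_n(z)}{\phi_n^*(z)}=o_{\mathcal E}(1)$$ locally uniformly in $\mathbb D$ as $n\to\infty$, where $D_n(z)=D(e^{g_n}\sigma_n,z)$. In particular, $\alpha_nD_n(0)=1+o_{\mathcal E}(1)$ as $n\to\infty$.
   Context: $dm(\xi)=|d\xi|/(2\pi)$ on $\mathbb T$. For a polynomial $p$ regarded as having degree at most $n$, $p^*(z)=z^n\overline{p(1/\bar z)}$; in particular $W_n^*(z)=\prod_{j=1}^n(1-\overline{b_{n,j}}z)$. For a finite measure $d\sigma=\upsilon\,dm+d\sigma^s$ on $\mathbb T$ with $\log\upsilon\in L^1(m)$, its Szegő function is $D(\sigma,z)=\exp\left(\frac12\int\frac{\xi+z}{\xi-z}\log\upsilon(\xi)\,dm(\xi)\right)$. The symbol $o_{\mathcal E}(1)$ denotes a quantity tending to $0$ as $n\to\infty$ at a rate that depends on $\mathcal E$ but not on the particular choice of $\{g_n\}\subset\mathcal E$. *)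

theory Defs
  imports "HOL-Probability.Probability" "HOL-Computational_Algebra.Polynomial"
begin

definition circle_borel :: "complex measure" where
  "circle_borel = restrict_space borel (sphere 0 1)"

text \<open>The measure \<open>|d\<xi>| / (2 \<pi>)\<close>, i.e. the image of the uniform distribution on \<open>[0, 2 \<pi>]\<close>
  under \<open>t \<mapsto> exp (\<i> t)\<close>.\<close>

definition circle_m :: "complex measure" where
  "circle_m = distr (uniform_measure lborel {0..2 * pi}) circle_borel cis"

definition circle_measure :: "complex measure \<Rightarrow> bool" where
  "circle_measure \<mu> \<longleftrightarrow> finite_measure \<mu> \<and> sets \<mu> = sets circle_borel"

definition mutually_singular :: "'a measure \<Rightarrow> 'a measure \<Rightarrow> bool" where
  "mutually_singular M N \<longleftrightarrow>
     (\<exists>S. S \<in> sets M \<and> S \<in> sets N \<and> emeasure M S = 0 \<and> emeasure N (space N - S) = 0)"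

text \<open>\<open>d\<mu> = w dm + d\<mu>\<^sub>s\<close> with \<open>w \<ge> 0\<close> and \<open>\<mu>\<^sub>s\<close> singular to \<open>m\<close>.\<close>

definition lebesgue_decomp ::
    "complex measure \<Rightarrow> (complex \<Rightarrow> real) \<Rightarrow> complex measure \<Rightarrow> bool" where
  "lebesgue_decomp \<mu> w \<mu>s \<longleftrightarrow>
     w \<in> borel_measurable circle_m \<and> (AE \<xi> in circle_m. 0 \<le> w \<xi>) \<and>
     circle_measure \<mu>s \<and> mutually_singular \<mu>s circle_m \<and>
     (\<forall>A\<in>sets circle_borel.
        emeasure \<mu> A = (\<integral>\<^sup>+\<xi>\<in>A. ennreal (w \<xi>) \<partial>circle_m) + emeasure \<mu>s A)"

text \<open>The density of the absolutely continuous part; it is determined up to \<open>m\<close>-null sets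
  (see \<open>lebesgue_decomp_unique\<close> below).\<close>

definition ac_density :: "complex measure \<Rightarrow> complex \<Rightarrow> real" where
  "ac_density \<mu> = (SOME w. \<exists>\<mu>s. lebesgue_decomp \<mu> w \<mu>s)"

text \<open>\<open>log w \<in> L\<^sup>1(m)\<close>. Positivity has to be required separately, since \<^term>\<open>ln (0::real) = 0\<close>
  in the library, so that integrability of \<^term>\<open>\<lambda>\<xi>. ln (w \<xi>)\<close> alone would not exclude that
  \<open>w\<close> vanishes on a set of positive measure.\<close>

definition log_integrable :: "(complex \<Rightarrow> real) \<Rightarrow> bool" where
  "log_integrable w \<longleftrightarrow>
     (AE \<xi> in circle_m. 0 < w \<xi>) \<and> integrable circle_m (\<lambda>\<xi>. ln (w \<xi>))"

definition szego :: "complex measure \<Rightarrow> complex \<Rightarrow> complex" where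
  "szego \<mu> z =
     exp (1/2 * (\<integral>\<xi>. (\<xi> + z) / (\<xi> - z) * complex_of_real (ln (ac_density \<mu> \<xi>)) \<partial>circle_m))"

text \<open>The reversed polynomial \<open>p\<^sup>*(z) = z\<^sup>n cnj (p (1 / cnj z))\<close> of a polynomial of degree at
  most \<open>n\<close>, given by its coefficients so that it also has the right value at \<open>z = 0\<close>.\<close>

definition star_poly :: "nat \<Rightarrow> complex poly \<Rightarrow> complex poly" where
  "star_poly n p = (\<Sum>k\<le>n. monom (cnj (coeff p (n - k))) k)"

definition orthonormal_poly :: "complex measure \<Rightarrow> nat \<Rightarrow> complex poly \<Rightarrow> bool" where
  "orthonormal_poly \<mu> n p \<longleftrightarrow>
     degree p \<le> n \<and> coeff p n \<in> \<real> \<and> 0 < Re (coeff p n) \<and>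
     (\<forall>m<n. (\<integral>\<xi>. poly p \<xi> * cnj (\<xi> ^ m) \<partial>\<mu>) = 0) \<and>
     (\<integral>\<xi>. (cmod (poly p \<xi>))\<^sup>2 \<partial>\<mu>) = 1"

text \<open>\<open>e\<^sup>g |W|\<^sup>-\<^sup>2 d\<mu>\<close>\<close>

definition weighted_measure ::
    "(complex \<Rightarrow> real) \<Rightarrow> complex poly \<Rightarrow> complex measure \<Rightarrow> complex measure" where
  "weighted_measure g W \<mu> =
     density \<mu> (\<lambda>\<xi>. ennreal (exp (g \<xi>) / (cmod (poly W \<xi>))\<^sup>2))"

definition exp_measure :: "(complex \<Rightarrow> real) \<Rightarrow> complex measure \<Rightarrow> complex measure" where
  "exp_measure g \<mu> = density \<mu> (\<lambda>\<xi>. ennreal (exp (g \<xi>)))"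

text \<open>\<open>C(T)\<close> with the supremum metric. As everywhere with \<^const>\<open>cfunspace\<close>, its elements are
  functions with the value \<^const>\<open>undefined\<close> off the unit circle.\<close>

definition circle_C :: "(complex \<Rightarrow> real) metric" where
  "circle_C = cfunspace (top_of_set (sphere 0 1)) euclidean_metric"

text \<open>All sequences \<open>g\<^sub>n\<close> in \<open>E\<close>, together with the corresponding orthonormal polynomials
  \<open>\<phi>\<^sub>n\<close>. A quantity is \<open>o\<^sub>E(1)\<close> if it tends to \<open>0\<close> uniformly over this set.\<close>

definition admissible ::
    "(complex \<Rightarrow> real) set \<Rightarrow> (nat \<Rightarrow> complex measure) \<Rightarrow> (nat \<Rightarrow> complex poly)
     \<Rightarrow> ((nat \<Rightarrow> complex \<Rightarrow> real) \<times> (nat \<Rightarrow> complex poly)) set" where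
  "admissible E \<sigma> W =
     {(g, \<phi>). \<forall>n. g n \<in> E \<and> orthonormal_poly (weighted_measure (g n) (W n) (\<sigma> n)) n (\<phi> n)}"


lemma poly_star_poly:
  assumes "degree p \<le> n" and "z \<noteq> 0"
  shows "poly (star_poly n p) z = z ^ n * cnj (poly p (1 / cnj z))"
proof -
  have "poly p (1 / cnj z) = (\<Sum>i\<le>n. coeff p i * (1 / cnj z) ^ i)"
    unfolding poly_altdef using assms(1)
    by (intro sum.mono_neutral_left) (auto simp: coeff_eq_0)
  then have "z ^ n * cnj (poly p (1 / cnj z)) = (\<Sum>i\<le>n. z ^ n * (cnj (coeff p i) * (1 / z) ^ i))"
    by (simp add: sum_distrib_left)
  also have "\<dots> = (\<Sum>i\<le>n. cnj (coeff p i) * z ^ (n - i))"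
    using assms(2) by (intro sum.cong) (auto simp: power_diff power_divide)
  also have "\<dots> = (\<Sum>k\<le>n. cnj (coeff p (n - k)) * z ^ k)"
    by (rule sum.reindex_bij_witness[of _ "\<lambda>k. n - k" "\<lambda>k. n - k"]) auto
  finally show ?thesis
    by (simp add: star_poly_def poly_sum poly_monom)
qed

lemma sets_circle_m [simp, measurable_cong]: "sets circle_m = sets circle_borel"
  by (simp add: circle_m_def)

lemma prob_space_circle_m: "prob_space circle_m"
  unfolding circle_m_def
proof (rule prob_space.prob_space_distr)
  show "prob_space (uniform_measure lborel {0..2 * pi})"
    by (rule prob_space_uniform_measure) (auto simp: emeasure_lborel_Icc_eq)
  have "cis \<in> borel_measurable (borel :: real measure)"
    by (intro borel_measurable_continuous_onI continuous_intros)
  then show "cis \<in> uniform_measure lborel {0..2 * pi} \<rightarrow>\<^sub>M circle_borel"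
    by (auto simp: circle_borel_def intro!: measurable_restrict_space2)
qed

lemma lebesgue_decomp_unique:
  assumes "lebesgue_decomp \<mu> w \<mu>s" and "lebesgue_decomp \<mu> w' \<mu>s'"
  shows "AE \<xi> in circle_m. w \<xi> = w' \<xi>"
proof -
  interpret m: prob_space circle_m by (rule prob_space_circle_m)
  have [measurable]: "w \<in> borel_measurable circle_m" "w' \<in> borel_measurable circle_m"
    using assms by (auto simp: lebesgue_decomp_def)
  have null: "\<exists>S\<in>sets circle_m. emeasure \<nu> S = 0 \<and> (AE \<xi> in circle_m. \<xi> \<in> S)"
    if \<nu>: "lebesgue_decomp \<mu> v \<nu>" for v \<nu>
  proof -
    from \<nu> obtain S where S: "S \<in> sets circle_m" "emeasure \<nu> S = 0"
      "emeasure circle_m (space circle_m - S) = 0"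
      by (auto simp: lebesgue_decomp_def mutually_singular_def)
    then have "AE \<xi> in circle_m. \<xi> \<in> S"
      by (intro AE_I[of _ _ "space circle_m - S"] sets.compl_sets) auto
    with S show ?thesis by auto
  qed
  obtain S where S [measurable]: "S \<in> sets circle_m" and S0: "emeasure \<mu>s S = 0"
    and SAE: "AE \<xi> in circle_m. \<xi> \<in> S"
    using null[OF assms(1)] by auto
  obtain S' where S' [measurable]: "S' \<in> sets circle_m" and S0': "emeasure \<mu>s' S' = 0"
    and SAE': "AE \<xi> in circle_m. \<xi> \<in> S'"
    using null[OF assms(2)] by auto
  have "AE \<xi> in circle_m. ennreal (w \<xi>) = ennreal (w' \<xi>)"
  proof (rule m.density_unique2)
    fix A assume A [measurable]: "A \<in> sets circle_m"
    let ?B = "A \<inter> S \<inter> S'"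
    have B: "?B \<in> sets circle_borel"
      using A S S' by (metis sets.Int sets_circle_m)
    have restr: "(\<integral>\<^sup>+\<xi>\<in>A. ennreal (v \<xi>) \<partial>circle_m) = (\<integral>\<^sup>+\<xi>\<in>?B. ennreal (v \<xi>) \<partial>circle_m)" for v
      using SAE SAE' by (intro nn_integral_cong_AE) (auto simp: indicator_def)
    have "sets \<mu>s = sets circle_m" "sets \<mu>s' = sets circle_m"
      using assms by (auto simp: lebesgue_decomp_def circle_measure_def)
    with S S' have "emeasure \<mu>s ?B \<le> emeasure \<mu>s S" "emeasure \<mu>s' ?B \<le> emeasure \<mu>s' S'"
      by (auto intro!: emeasure_mono)
    then have "emeasure \<mu>s ?B = 0" "emeasure \<mu>s' ?B = 0"
      by (simp_all add: S0 S0')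
    then have "(\<integral>\<^sup>+\<xi>\<in>?B. ennreal (w \<xi>) \<partial>circle_m) = emeasure \<mu> ?B"
      and "(\<integral>\<^sup>+\<xi>\<in>?B. ennreal (w' \<xi>) \<partial>circle_m) = emeasure \<mu> ?B"
      using assms B by (auto simp: lebesgue_decomp_def)
    then show "(\<integral>\<^sup>+\<xi>\<in>A. ennreal (w \<xi>) \<partial>circle_m) = (\<integral>\<^sup>+\<xi>\<in>A. ennreal (w' \<xi>) \<partial>circle_m)"
      by (simp add: restr)
  qed auto
  moreover have "AE \<xi> in circle_m. 0 \<le> w \<xi>" "AE \<xi> in circle_m. 0 \<le> w' \<xi>"
    using assms by (auto simp: lebesgue_decomp_def)
  ultimately show ?thesis
    by eventually_elim simp
qed

lemma szego_eq:
  assumes "lebesgue_decomp \<mu> w \<mu>s"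
  shows "szego \<mu> z = exp (1/2 * (\<integral>\<xi>. (\<xi> + z) / (\<xi> - z) * complex_of_real (ln (w \<xi>)) \<partial>circle_m))"
proof -
  have "\<exists>\<mu>s. lebesgue_decomp \<mu> (ac_density \<mu>) \<mu>s"
    unfolding ac_density_def using assms by (rule someI[where P = "\<lambda>w. \<exists>\<mu>s. lebesgue_decomp \<mu> w \<mu>s", OF exI])
  then obtain \<nu> where \<nu>: "lebesgue_decomp \<mu> (ac_density \<mu>) \<nu>" ..
  then have [measurable]: "ac_density \<mu> \<in> borel_measurable circle_m" "w \<in> borel_measurable circle_m"
    using assms by (auto simp: lebesgue_decomp_def)
  have [measurable]: "(\<lambda>\<xi>. \<xi>) \<in> borel_measurable circle_m"
    unfolding measurable_cong_sets[OF sets_circle_m refl] circle_borel_def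
    by (intro measurable_restrict_space1) simp
  have "(\<integral>\<xi>. (\<xi> + z) / (\<xi> - z) * complex_of_real (ln (ac_density \<mu> \<xi>)) \<partial>circle_m) =
        (\<integral>\<xi>. (\<xi> + z) / (\<xi> - z) * complex_of_real (ln (w \<xi>)) \<partial>circle_m)"
  proof (rule integral_cong_AE)
    show "AE \<xi> in circle_m. (\<xi> + z) / (\<xi> - z) * complex_of_real (ln (ac_density \<mu> \<xi>)) =
        (\<xi> + z) / (\<xi> - z) * complex_of_real (ln (w \<xi>))"
      using lebesgue_decomp_unique[OF \<nu> assms] by eventually_elim simp
  qed measurable
  then show ?thesis by (simp add: szego_def)
qed

end

theory Submission
  imports Defs "HOL-Complex_Analysis.Complex_Analysis"
begin

text \<open>
  Write \<open>D\<^sub>n\<close> for the Szego function of \<open>e\<^sup>g \<sigma>\<^sub>n\<close> and \<open>\<ell>\<^sub>k(P)\<close> for the \<open>k\<close>-th Taylor coefficient of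
  \<open>P D\<^sub>n / W\<^sub>n\<^sup>*\<close>. Since \<open>|D\<^sub>n|\<^sup>2\<close> is the density of the absolutely continuous part, Bessel's inequality
  gives \<open>\<Sum>\<^sub>k |\<ell>\<^sub>k(P)|\<^sup>2 \<le> \<parallel>P\<parallel>\<^sup>2\<close> in \<open>L\<^sup>2(e\<^sup>g |W\<^sub>n|\<^sup>-\<^sup>2 d\<sigma>\<^sub>n)\<close>; it is obtained by approximating the logarithm of the
  density by \<open>2 Re p\<close> with \<open>p\<close> a polynomial, for which \<open>D = exp p\<close>, so that no boundary values are
  needed. Suppose that for every \<open>k < M\<close> some \<open>P\<close> of degree less than \<open>n\<close> nearly attains
  \<open>|\<ell>\<^sub>k(P)| \<le> \<parallel>P\<parallel>\<close>. As \<open>\<phi>\<^sub>n\<close> is a unit vector orthogonal to \<open>P\<close>, each \<open>\<ell>\<^sub>k(\<phi>\<^sub>n)\<close> with \<open>k < M\<close> is small, and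
  by the extremal property of the leading coefficient \<open>\<ell>\<^sub>0(\<phi>\<^sub>n\<^sup>*) = \<alpha>\<^sub>n D\<^sub>n(0)\<close> is nearly 1, so that the
  other coefficients \<open>\<ell>\<^sub>k(\<phi>\<^sub>n\<^sup>*)\<close> are small. Power series then give both limits.

  To find \<open>P\<close>, take a polynomial \<open>Q\<close> that is nearly extremal in Szego's theorem for the limit
  measure, and approximate \<open>z\<^sup>k Q\<close> uniformly on the circle by \<open>P / W\<^sub>n\<^sup>*\<close>; this is possible because
  the Blaschke products \<open>W\<^sub>n / W\<^sub>n\<^sup>*\<close> tend to 0 on compact subsets of the disk. Everything is stable
  under small perturbations of \<open>g\<close>, and compactness of \<open>E\<close> makes it uniform.
\<close>

section \<open>Integrals over the unit circle\<close>

text \<open>Hypothesis \<open>A_T\<close> bounds integrals against \<open>\<sigma> n\<close> only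
  from above, so each norm estimate goes through one fixed continuous majorant. The matching lower
  bounds come from the value at 0 of the Szego function, which sees the density only through its
  mean logarithm and is therefore controlled by \<open>B_T\<close>. Smallness of ell_k(phi) is a
  fact about a plane: a functional of norm at most 1 satisfies |ell(P)|^2 / |P|^2 + |ell(phi)|^2 <=
  1 for an orthogonal pair P, phi with |phi| = 1. The two limits need different amounts of
  information. For the reversed polynomial the index k = 0 suffices: its squared coefficients sum to
  at most 1, and the constant one uses up almost all of it. For phi itself the first M coefficients
  are made small one at a time, and the others, bounded by 1, contribute at most r^M / (1 - r) on
  |z| <= r; hence M is fixed before n. In Szego's theorem the obstacle is the singular part: the
  extremal polynomial must be small on an m-null set of which its mean logarithm takes no
  notice.\<close>

lemma space_circle_borel [simp]: "space circle_borel = sphere 0 1"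
  by (simp add: circle_borel_def space_restrict_space)

lemma space_circle_measure: "sets M = sets circle_borel \<Longrightarrow> space M = sphere 0 1"
  using sets_eq_imp_space_eq[of M circle_borel] by simp

lemma space_circle_m [simp]: "space circle_m = sphere 0 1"
  by (rule space_circle_measure) simp

lemma borel_measurable_circle_continuous:
  assumes "sets M = sets circle_borel" "continuous_on (sphere 0 1) f"
  shows "f \<in> borel_measurable M"
proof -
  have "f \<in> borel_measurable circle_borel"
    unfolding circle_borel_def using assms(2) by (rule borel_measurable_continuous_on_restrict)
  then show ?thesis using assms(1) measurable_cong_sets by blast
qed

lemma integrable_circle_continuous:
  fixes f :: "complex \<Rightarrow> 'b::{second_countable_topology,banach}"
  assumes "circle_measure M" "continuous_on (sphere 0 1) f"
  shows "integrable M f"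
proof -
  interpret finite_measure M using assms(1) by (simp add: circle_measure_def)
  have "compact (f ` sphere 0 1)"
    using assms(2) by (intro compact_continuous_image) auto
  then obtain B where B: "\<And>x. x \<in> sphere 0 1 \<Longrightarrow> norm (f x) \<le> B"
    by (meson bounded_iff compact_imp_bounded image_eqI)
  show ?thesis
  proof (rule integrable_const_bound[of _ B])
    show "AE x in M. norm (f x) \<le> B"
      using B assms(1) by (intro AE_I2) (auto simp: circle_measure_def space_circle_measure)
    show "f \<in> borel_measurable M"
      using assms by (intro borel_measurable_circle_continuous) (auto simp: circle_measure_def)
  qed
qed

lemma circle_measure_circle_m: "circle_measure circle_m"
  using prob_space_circle_m by (auto simp: circle_measure_def prob_space_def)

text \<open>Bridge from the pushforward measure to the gauge integral over an interval, in which
  contour integrals are expressed.\<close>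

lemma integral_circle_m:
  fixes f :: "complex \<Rightarrow> complex"
  assumes "continuous_on (sphere 0 1) f"
  shows "(\<integral>\<xi>. f \<xi> \<partial>circle_m) = integral {0..2*pi} (\<lambda>t. f (cis t)) / (2 * pi)"
proof -
  have [measurable]: "cis \<in> borel_measurable (borel :: real measure)"
    by (intro borel_measurable_continuous_onI continuous_intros)
  have [measurable]: "cis \<in> uniform_measure lborel {0..2 * pi} \<rightarrow>\<^sub>M circle_borel"
    by (auto simp: circle_borel_def intro!: measurable_restrict_space2)
  have [measurable]: "f \<in> borel_measurable circle_borel"
    using assms by (intro borel_measurable_circle_continuous) auto
  have fc: "continuous_on UNIV (\<lambda>t. f (cis t))"
    by (rule continuous_on_compose2[OF assms]) (auto intro!: continuous_intros)
  then have [measurable]: "(\<lambda>t. f (cis t)) \<in> borel_measurable borel"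
    by (rule borel_measurable_continuous_onI)
  have "(\<integral>\<xi>. f \<xi> \<partial>circle_m) = (\<integral>t. f (cis t) \<partial>uniform_measure lborel {0..2 * pi})"
    unfolding circle_m_def by (rule integral_distr) measurable
  also have "\<dots> = (LINT t:{0..2*pi}|lborel. f (cis t)) / (2 * pi)"
  proof -
    have "(\<integral>t. f (cis t) \<partial>uniform_measure lborel {0..2 * pi}) =
       (\<integral>t. (indicator {0..2*pi} t / (2*pi)) *\<^sub>R f (cis t) \<partial>lborel)"
    proof -
      have *: "uniform_measure lborel {0..2 * pi} = density lborel (\<lambda>t. ennreal (indicator {0..2*pi} t / (2*pi)))"
        unfolding uniform_measure_def
        by (intro density_cong) (auto simp: indicator_def divide_ennreal[symmetric] ennreal_1[symmetric] simp del: ennreal_1)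
      show ?thesis unfolding * by (rule integral_density) (auto)
    qed
    also have "\<dots> = (\<integral>t. (1/(2*pi)) *\<^sub>R (indicator {0..2*pi} t *\<^sub>R f (cis t)) \<partial>lborel)"
      by (intro Bochner_Integration.integral_cong) auto
    also have "\<dots> = (1/(2*pi)) *\<^sub>R (LINT t:{0..2*pi}|lborel. f (cis t))"
      unfolding set_lebesgue_integral_def by (rule integral_scaleR_right)
    finally show ?thesis by (simp add: scaleR_conv_of_real)
  qed
  also have "(LINT t:{0..2*pi}|lborel. f (cis t)) = integral {0..2*pi} (\<lambda>t. f (cis t))"
    using fc by (intro set_borel_integral_eq_integral borel_integrable_atLeastAtMost')
      (auto intro: continuous_on_subset)
  finally show ?thesis .
qed

text \<open>On the circle d xi = i xi dt, which accounts for the factor \<open>\<i>\<close> and for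
  the extra \<open>\<xi>\<close> under the integral.\<close>

lemma contour_integral_unit_circle:
  assumes "continuous_on (sphere 0 1) f"
  shows "contour_integral (circlepath 0 1) f = 2 * pi * \<i> * (\<integral>\<xi>. \<xi> * f \<xi> \<partial>circle_m)"
proof -
  have "contour_integral (circlepath 0 1) f = integral {0..2*pi} (\<lambda>t. f (cis t) * \<i> * cis t)"
    unfolding circlepath_def
    by (subst contour_integral_part_circlepath_eq) (auto simp: cis_conv_exp)
  also have "\<dots> = \<i> * integral {0..2*pi} (\<lambda>t. cis t * f (cis t))"
    by (simp flip: integral_mult_right add: mult_ac)
  also have "integral {0..2*pi} (\<lambda>t. cis t * f (cis t)) = 2 * pi * (\<integral>\<xi>. \<xi> * f \<xi> \<partial>circle_m)"
    using assms by (subst integral_circle_m) (auto intro!: continuous_intros)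
  finally show ?thesis by simp
qed

section \<open>Taylor coefficients as Fourier coefficients, and Bessel's inequality\<close>

definition tcoeff :: "(complex \<Rightarrow> complex) \<Rightarrow> nat \<Rightarrow> complex" where
  "tcoeff f k = (deriv ^^ k) f 0 / fact k"

text \<open>On the circle \<open>cnj \<xi>\<close> is 1 / xi, so the k-th Fourier coefficient is
  Cauchy's integral for the k-th derivative. Holomorphy across the circle is required here, which is
  why outer functions are later reached only as limits.\<close>

lemma integral_circle_Cauchy:
  assumes "open U" "cball 0 1 \<subseteq> U" "h holomorphic_on U"
  shows "(\<integral>\<xi>. h \<xi> * cnj \<xi> ^ k \<partial>circle_m) = tcoeff h k"
proof -
  have cont: "continuous_on (cball 0 1) h"
    using assms(2,3) holomorphic_on_imp_continuous_on continuous_on_subset by blast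
  have c': "continuous_on (sphere 0 1) (\<lambda>u. h u / u ^ Suc k)"
    using cont by (intro continuous_intros) (auto intro: continuous_on_subset)
  have "contour_integral (circlepath 0 1) (\<lambda>u. h u / (u - 0) ^ Suc k) = (2 * pi * \<i>) / fact k * (deriv ^^ k) h 0"
    using assms(2,3) cont by (subst Cauchy_contour_integral_circlepath)
       (auto intro: holomorphic_on_subset[OF _ order_trans[OF ball_subset_cball]])
  then have "2 * pi * \<i> * (\<integral>\<xi>. \<xi> * (h \<xi> / \<xi> ^ Suc k) \<partial>circle_m) = 2 * pi * \<i> * tcoeff h k"
    using contour_integral_unit_circle[OF c'] by (simp add: tcoeff_def)
  moreover have "(\<integral>\<xi>. \<xi> * (h \<xi> / \<xi> ^ Suc k) \<partial>circle_m) = (\<integral>\<xi>. h \<xi> * cnj \<xi> ^ k \<partial>circle_m)"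
  proof (rule Bochner_Integration.integral_cong)
    fix \<xi> :: complex assume "\<xi> \<in> space circle_m"
    then have n: "norm \<xi> = 1" by simp
    then have "\<xi> \<noteq> 0" by auto
    moreover have "\<xi> * cnj \<xi> = 1" using n by (simp add: complex_norm_square[symmetric])
    then have "\<xi> ^ k * cnj \<xi> ^ k = 1" by (simp flip: power_mult_distrib)
    ultimately show "\<xi> * (h \<xi> / \<xi> ^ Suc k) = h \<xi> * cnj \<xi> ^ k"
      by (simp add: field_simps)
  qed simp
  ultimately show ?thesis by simp
qed

lemma integral_circle_mean_value:
  assumes "open U" "cball 0 1 \<subseteq> U" "h holomorphic_on U"
  shows "(\<integral>\<xi>. h \<xi> \<partial>circle_m) = h 0"
  using integral_circle_Cauchy[OF assms, of 0] by (simp add: tcoeff_def)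

text \<open>With T the orthogonal projection of \<open>h\<close> onto the powers indexed by
  \<open>A\<close>, both <h, T> and <T, T> equal the sum on the left, and the inequality is 0 <= |h
  - T|^2. Arbitrary finite \<open>A\<close> is kept because the sets {k} and {0, k} are
  wanted.\<close>

lemma Bessel_circle:
  assumes "open U" "cball 0 1 \<subseteq> U" "h holomorphic_on U" "finite A"
  shows "(\<Sum>k\<in>A. (cmod (tcoeff h k))\<^sup>2) \<le> (\<integral>\<xi>. (cmod (h \<xi>))\<^sup>2 \<partial>circle_m)"
proof -
  note int = integrable_circle_continuous[OF circle_measure_circle_m]
  have hc: "continuous_on (sphere 0 1) h"
    using assms by (meson continuous_on_subset holomorphic_on_imp_continuous_on sphere_cball subset_trans)
  define T where "T = (\<lambda>\<xi>. \<Sum>k\<in>A. tcoeff h k * \<xi> ^ k)"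
  have Tc: "continuous_on (sphere 0 1) T" unfolding T_def by (intro continuous_intros)
  let ?s = "\<Sum>k\<in>A. (cmod (tcoeff h k))\<^sup>2"
  have hT: "(\<integral>\<xi>. h \<xi> * cnj (T \<xi>) \<partial>circle_m) = of_real ?s"
  proof -
    have "(\<integral>\<xi>. h \<xi> * cnj (T \<xi>) \<partial>circle_m) = (\<integral>\<xi>. (\<Sum>k\<in>A. cnj (tcoeff h k) * (h \<xi> * cnj \<xi> ^ k)) \<partial>circle_m)"
      by (simp add: T_def sum_distrib_left mult_ac)
    also have "\<dots> = (\<Sum>k\<in>A. cnj (tcoeff h k) * (\<integral>\<xi>. h \<xi> * cnj \<xi> ^ k \<partial>circle_m))"
      by (subst Bochner_Integration.integral_sum) (auto intro!: int continuous_intros hc)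
    also have "\<dots> = (\<Sum>k\<in>A. tcoeff h k * cnj (tcoeff h k))"
      using integral_circle_Cauchy[OF assms(1-3)] by (simp add: mult_ac)
    also have "\<dots> = of_real ?s"
      unfolding of_real_sum complex_norm_square ..
    finally show ?thesis .
  qed
  have orth: "(\<integral>\<xi>. \<xi> ^ j * cnj \<xi> ^ k \<partial>circle_m) = (if j = k then 1 else 0)" for j k :: nat
  proof -
    have "(\<integral>\<xi>. \<xi> ^ j * cnj \<xi> ^ k \<partial>circle_m) = tcoeff (\<lambda>\<xi>. \<xi> ^ j) k"
      by (rule integral_circle_Cauchy[of UNIV]) (auto intro!: holomorphic_intros)
    also have "\<dots> = (if j = k then 1 else 0)"
    proof -
      have "(deriv ^^ k) (\<lambda>\<xi>. (\<xi> - 0) ^ j) 0 = pochhammer (of_nat (Suc j - k)) k * (0 - 0 :: complex) ^ (j - k)"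
        by (rule higher_deriv_power)
      then show ?thesis
        by (auto simp: tcoeff_def pochhammer_fact[symmetric] power_0_left pochhammer_0_left
             Suc_diff_le split: if_splits)
    qed
    finally show ?thesis .
  qed
  have TT: "(\<integral>\<xi>. T \<xi> * cnj (T \<xi>) \<partial>circle_m) = of_real ?s"
  proof -
    have "(\<integral>\<xi>. T \<xi> * cnj (T \<xi>) \<partial>circle_m) =
       (\<integral>\<xi>. (\<Sum>j\<in>A. \<Sum>k\<in>A. tcoeff h j * cnj (tcoeff h k) * (\<xi> ^ j * cnj \<xi> ^ k)) \<partial>circle_m)"
      by (simp add: T_def sum_product mult_ac)
    also have "\<dots> = (\<Sum>j\<in>A. \<Sum>k\<in>A. tcoeff h j * cnj (tcoeff h k) * (\<integral>\<xi>. \<xi> ^ j * cnj \<xi> ^ k \<partial>circle_m))"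
      by (subst Bochner_Integration.integral_sum | auto intro!: int continuous_intros sum.cong)+
    also have "\<dots> = (\<Sum>j\<in>A. \<Sum>k\<in>A. if j = k then tcoeff h j * cnj (tcoeff h k) else 0)"
      by (simp only: orth) (auto intro!: sum.cong)
    also have "\<dots> = (\<Sum>j\<in>A. tcoeff h j * cnj (tcoeff h j))"
      using assms(4) by (simp add: sum.delta')
    also have "\<dots> = of_real ?s"
      unfolding of_real_sum complex_norm_square ..
    finally show ?thesis .
  qed
  have Re1: "(\<integral>\<xi>. Re (h \<xi> * cnj (T \<xi>)) \<partial>circle_m) = ?s"
    by (subst integral_Re) (auto intro!: int continuous_intros hc Tc simp: hT)
  have Re2: "(\<integral>\<xi>. Re (T \<xi> * cnj (T \<xi>)) \<partial>circle_m) = ?s"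
    by (subst integral_Re) (auto intro!: int continuous_intros hc Tc simp: TT)
  have "0 \<le> (\<integral>\<xi>. (cmod (h \<xi> - T \<xi>))\<^sup>2 \<partial>circle_m)" by simp
  also have "\<dots> = (\<integral>\<xi>. (cmod (h \<xi>))\<^sup>2 - 2 * Re (h \<xi> * cnj (T \<xi>)) + Re (T \<xi> * cnj (T \<xi>)) \<partial>circle_m)"
    by (intro Bochner_Integration.integral_cong refl)
       (simp only: cmod_power2, simp add: power2_eq_square algebra_simps)
  also have "\<dots> = (\<integral>\<xi>. (cmod (h \<xi>))\<^sup>2 \<partial>circle_m) - 2 * ?s + ?s"
    by (subst Bochner_Integration.integral_add Bochner_Integration.integral_diff
         | auto intro!: int continuous_intros hc Tc simp del: times_complex.simps simp: Re1 Re2)+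
  finally show ?thesis by simp
qed

section \<open>Approximation by real parts of polynomials\<close>

text \<open>Induction on both polynomials at once: in the product of the tails xi *
  \<open>cnj \<xi>\<close> = 1 removes one factor from each, and a cross term that contains a
  conjugate has the same real part as its conjugate, which is a polynomial.\<close>

lemma Re_mult_cnj_poly:
  fixes p q :: "complex poly"
  shows "\<exists>s. \<forall>\<xi>\<in>sphere 0 1. Re (poly p \<xi> * cnj (poly q \<xi>)) = Re (poly s \<xi>)"
proof (induction p q rule: poly_induct2)
  case 0
  then show ?case by (intro exI[of _ 0]) simp
next
  case (pCons a p b q)
  then obtain s where s: "\<And>\<xi>. norm \<xi> = 1 \<Longrightarrow> Re (poly p \<xi> * cnj (poly q \<xi>)) = Re (poly s \<xi>)"
    by auto
  show ?case
  proof (intro exI ballI)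
    fix \<xi> :: complex assume "\<xi> \<in> sphere 0 1"
    then have n: "norm \<xi> = 1" by simp
    then have 1: "\<xi> * cnj \<xi> = 1" by (simp add: complex_norm_square[symmetric])
    have "poly (pCons a p) \<xi> * cnj (poly (pCons b q) \<xi>) =
       a * cnj b + a * cnj (\<xi> * poly q \<xi>) + cnj b * (\<xi> * poly p \<xi>) + (\<xi> * cnj \<xi>) * (poly p \<xi> * cnj (poly q \<xi>))"
      by (simp add: algebra_simps)
    also have "Re \<dots> = Re (a * cnj b) + Re (a * cnj (\<xi> * poly q \<xi>)) + Re (cnj b * (\<xi> * poly p \<xi>)) + Re (poly s \<xi>)"
      using s[OF n] by (simp only: 1 mult_1 plus_complex.simps)
    also have "Re (a * cnj (\<xi> * poly q \<xi>)) = Re (cnj a * (\<xi> * poly q \<xi>))"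
      by (simp add: algebra_simps)
    also have "Re (a * cnj b) + Re (cnj a * (\<xi> * poly q \<xi>)) + Re (cnj b * (\<xi> * poly p \<xi>)) + Re (poly s \<xi>) =
        Re (poly ([:a * cnj b:] + smult (cnj a) (pCons 0 q) + smult (cnj b) (pCons 0 p) + s) \<xi>)"
      by (simp add: algebra_simps)
    finally show "Re (poly (pCons a p) \<xi> * cnj (poly (pCons b q) \<xi>)) =
        Re (poly ([:a * cnj b:] + smult (cnj a) (pCons 0 q) + smult (cnj b) (pCons 0 p) + s) \<xi>)" .
  qed
qed

text \<open>2 Re(a) Re(b) = Re(a b) + Re(a cnj b). This makes the real parts of polynomials an
  algebra, as Stone-Weierstrass requires.\<close>

lemma Re_mult_Re_poly:
  fixes p q :: "complex poly"
  shows "\<exists>s. \<forall>\<xi>\<in>sphere 0 1. Re (poly p \<xi>) * Re (poly q \<xi>) = Re (poly s \<xi>)"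
proof -
  obtain s where s: "\<forall>\<xi>\<in>sphere 0 1. Re (poly p \<xi> * cnj (poly q \<xi>)) = Re (poly s \<xi>)"
    using Re_mult_cnj_poly by blast
  have "Re (poly p \<xi>) * Re (poly q \<xi>) = Re (poly (smult (1/2) (p * q + s)) \<xi>)" if "\<xi> \<in> sphere 0 1" for \<xi>
  proof -
    have "Re (poly (smult (1/2) (p * q + s)) \<xi>) = (Re (poly p \<xi> * poly q \<xi>) + Re (poly s \<xi>)) / 2"
      by (simp add: field_simps)
    also have "\<dots> = Re (poly p \<xi>) * Re (poly q \<xi>)"
      using s that by (simp add: field_simps)
    finally show ?thesis ..
  qed
  then show ?thesis by blast
qed

text \<open>Real parts of polynomials are the real trigonometric polynomials on the circle. They
  separate points because Re(xi) and Im(xi) = Re(-i xi) are among them.\<close>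

lemma Re_poly_dense:
  assumes "continuous_on (sphere 0 1) f" "0 < e"
  shows "\<exists>p. \<forall>\<xi>\<in>sphere 0 1. \<bar>f \<xi> - Re (poly p \<xi>)\<bar> < e"
proof -
  define R where "R = {f. \<exists>p. \<forall>\<xi>\<in>sphere 0 1. f \<xi> = Re (poly p \<xi>)}"
  have "function_ring_on R (sphere 0 1)"
  proof
    fix f assume "f \<in> R"
    then obtain p where p: "\<And>\<xi>. \<xi> \<in> sphere 0 1 \<Longrightarrow> f \<xi> = Re (poly p \<xi>)" by (auto simp: R_def)
    have "continuous_on (sphere 0 1) (\<lambda>\<xi>. Re (poly p \<xi>))" by (intro continuous_intros)
    then show "continuous_on (sphere 0 1) f" by (rule continuous_on_eq) (simp add: p)
  next
    fix f g assume "f \<in> R" "g \<in> R"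
    then obtain p q where p: "\<And>\<xi>. \<xi> \<in> sphere 0 1 \<Longrightarrow> f \<xi> = Re (poly p \<xi>)"
      and q: "\<And>\<xi>. \<xi> \<in> sphere 0 1 \<Longrightarrow> g \<xi> = Re (poly q \<xi>)"
      unfolding R_def by blast
    show "(\<lambda>x. f x + g x) \<in> R"
      unfolding R_def using p q by (auto intro!: exI[of _ "p + q"])
    show "(\<lambda>x. f x * g x) \<in> R"
      unfolding R_def using p q Re_mult_Re_poly[of p q] by simp
  next
    show "(\<lambda>_. c) \<in> R" for c
      by (auto simp: R_def intro!: exI[of _ "[:complex_of_real c:]"])
  next
    fix x y :: complex assume "x \<noteq> y"
    then consider "Re x \<noteq> Re y" | "Im x \<noteq> Im y" by (auto simp: complex_eq_iff)
    then show "\<exists>f\<in>R. f x \<noteq> f y"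
    proof cases
      case 1
      then show ?thesis
        by (intro bexI[of _ Re]) (auto simp: R_def intro!: exI[of _ "[:0, 1:]"])
    next
      case 2
      then show ?thesis
        by (intro bexI[of _ Im]) (auto simp: R_def intro!: exI[of _ "[:0, -\<i>:]"])
    qed
  qed auto
  from function_ring_on.Stone_Weierstrass_basic[OF this assms]
  obtain g where g: "g \<in> R" "\<And>x. x \<in> sphere 0 1 \<Longrightarrow> \<bar>f x - g x\<bar> < e" by auto
  then obtain p where "\<And>\<xi>. \<xi> \<in> sphere 0 1 \<Longrightarrow> g \<xi> = Re (poly p \<xi>)" unfolding R_def by blast
  then show ?thesis using g(2) by (intro exI[of _ p]) metis
qed

text \<open>Induction over integrable functions. For an indicator, regularity gives a compact set
  inside and an open set outside of nearly equal measure, and Urysohn's lemma interpolates between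
  them.\<close>

lemma integrable_continuous_approx:
  fixes h :: "'a::euclidean_space \<Rightarrow> real"
  assumes sets: "sets M = sets borel" and fin: "finite_measure M" and h: "integrable M h" and e: "0 < e"
  shows "\<exists>u. continuous_on UNIV u \<and> integrable M u \<and> (\<integral>x. \<bar>h x - u x\<bar> \<partial>M) < e"
  using h e
proof (induction arbitrary: e rule: integrable_induct)
  case (base A c)
  interpret finite_measure M by fact
  have A: "A \<in> sets borel" using base sets by simp
  \<comment> \<open>The compact and the open set each miss \<open>A\<close> by at most
    \<open>d\<close> in measure, so the error is at most 2 d |c|; the summand 1 covers c =
    0.\<close>
  define d where "d = e / (2 * (\<bar>c\<bar> + 1))"
  have d: "0 < d" "\<bar>c\<bar> * (2 * d) < e" using base by (auto simp: d_def field_simps)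
  have "emeasure M A < (emeasure M A) + ennreal d"
    using d by (auto simp: emeasure_eq_measure ennreal_plus[symmetric] simp del: ennreal_plus intro!: ennreal_lessI add_nonneg_pos)
  then obtain U where U: "A \<subseteq> U" "open U" "emeasure M U < emeasure M A + ennreal d"
    using outer_regular[OF sets _ A] by (auto simp: INF_less_iff)
  \<comment> \<open>For a null set, truncated subtraction in \<open>ennreal\<close> gives no value
    strictly below the measure of \<open>A\<close>, so that case is settled by the empty
    set.\<close>
  have "\<exists>K. K \<subseteq> A \<and> compact K \<and> emeasure M A \<le> emeasure M K + ennreal d"
  proof (cases "emeasure M A = 0")
    case True
    then show ?thesis by (intro exI[of _ "{}"]) auto
  next
    case False
    then have "emeasure M A - ennreal d < emeasure M A"
      using d by (intro ennreal_between) (auto simp: zero_less_iff_neq_zero less_top[symmetric])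
    then obtain K where "K \<subseteq> A" "compact K" "emeasure M A - ennreal d < emeasure M K"
      using inner_regular[OF sets _ A] by (auto simp: less_SUP_iff)
    moreover then have "\<not> measure M K \<le> measure M A - d"
      using d by (auto simp: emeasure_eq_measure ennreal_minus not_le[symmetric] intro!: ennreal_leI)
    ultimately show ?thesis using d
      by (intro exI[of _ K]) (auto simp: emeasure_eq_measure ennreal_plus[symmetric] simp del: ennreal_plus)
  qed
  then obtain K where K: "K \<subseteq> A" "compact K" "emeasure M A \<le> emeasure M K + ennreal d" by blast
  have msets: "U \<in> sets M" "K \<in> sets M" "A \<in> sets M"
    using U K base sets by (auto simp: compact_imp_closed)
  have mU: "measure M U \<le> measure M K + 2 * d"
    using U(3) K(3) d
    by (auto simp: emeasure_eq_measure ennreal_plus[symmetric] ennreal_less_iff simp del: ennreal_plus)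
  obtain u :: "'a \<Rightarrow> real" where u: "continuous_on UNIV u" "\<And>x. u x \<in> closed_segment 1 0"
    "\<And>x. x \<in> K \<Longrightarrow> u x = 1" "\<And>x. x \<in> - U \<Longrightarrow> u x = 0"
    using Urysohn[of K "- U" "1::real" 0] K U by (auto simp: compact_imp_closed)
  have u01: "0 \<le> u x" "u x \<le> 1" for x using u(2)[of x] by (auto simp: closed_segment_eq_real_ivl)
  have um: "u \<in> borel_measurable M" using u(1) sets by (metis borel_measurable_continuous_onI measurable_cong_sets)
  have int: "integrable M (\<lambda>x. c * u x)"
    by (intro integrable_mult_right integrable_const_bound[of _ 1] um) (use u01 in auto)
  have "(\<integral>x. \<bar>indicator A x *\<^sub>R c - c * u x\<bar> \<partial>M) \<le> (\<integral>x. \<bar>c\<bar> * indicator (U - K) x \<partial>M)"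
  proof (rule integral_mono)
    show "integrable M (\<lambda>x. \<bar>indicator A x *\<^sub>R c - c * u x\<bar>)"
      using int msets by (intro integrable_abs Bochner_Integration.integrable_diff) (auto simp: emeasure_eq_measure)
    show "integrable M (\<lambda>x. \<bar>c\<bar> * indicator (U - K) x)"
      using msets by (auto simp: emeasure_eq_measure)
    fix x
    have "\<bar>indicator A x *\<^sub>R c - c * u x\<bar> = \<bar>c\<bar> * \<bar>indicator A x - u x\<bar>"
      by (simp add: abs_mult[symmetric] algebra_simps)
    also have "\<dots> \<le> \<bar>c\<bar> * indicator (U - K) x"
      using K(1) U(1) u01[of x] u(3,4)[of x] by (intro mult_left_mono) (auto simp: indicator_def)
    finally show "\<bar>indicator A x *\<^sub>R c - c * u x\<bar> \<le> \<bar>c\<bar> * indicator (U - K) x" .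
  qed
  also have "\<dots> = \<bar>c\<bar> * measure M (U - K)" using msets by simp
  also have "\<dots> \<le> \<bar>c\<bar> * (2 * d)"
    using mU K U msets by (intro mult_left_mono) (auto simp: finite_measure_Diff)
  also have "\<dots> < e" by fact
  finally show ?case using int u(1) by (intro exI[of _ "\<lambda>x. c * u x"]) (auto intro!: continuous_intros)
next
  case (add f g)
  obtain u where u: "continuous_on UNIV u" "integrable M u" "(\<integral>x. \<bar>f x - u x\<bar> \<partial>M) < e / 2"
    using add(3)[of "e/2"] add.prems by auto
  obtain v where v: "continuous_on UNIV v" "integrable M v" "(\<integral>x. \<bar>g x - v x\<bar> \<partial>M) < e / 2"
    using add(4)[of "e/2"] add.prems by auto
  have "(\<integral>x. \<bar>(f x + g x) - (u x + v x)\<bar> \<partial>M) \<le> (\<integral>x. \<bar>f x - u x\<bar> + \<bar>g x - v x\<bar> \<partial>M)"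
    using add u v by (intro integral_mono) auto
  also have "\<dots> = (\<integral>x. \<bar>f x - u x\<bar> \<partial>M) + (\<integral>x. \<bar>g x - v x\<bar> \<partial>M)"
    using add u v by (intro Bochner_Integration.integral_add) auto
  also have "\<dots> < e" using u v by simp
  finally show ?case using u v
    by (intro exI[of _ "\<lambda>x. u x + v x"]) (auto intro!: continuous_intros)
next
  case (lim f s)
  have "(\<lambda>i. \<integral>x. \<bar>f x - s i x\<bar> \<partial>M) \<longlonglongrightarrow> (\<integral>x. 0 \<partial>M)"
  \<comment> \<open>The approximating functions satisfy |s_i| <= 2 |f|, hence |f - s_i| <= 3
    |f|.\<close>
  proof (rule integral_dominated_convergence[where w = "\<lambda>x. 3 * norm (f x)"])
    show "AE x in M. (\<lambda>i. \<bar>f x - s i x\<bar>) \<longlonglongrightarrow> 0"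
    proof (intro AE_I2)
      fix x assume "x \<in> space M"
      then have "(\<lambda>i. \<bar>f x - s i x\<bar>) \<longlonglongrightarrow> \<bar>f x - f x\<bar>" by (intro tendsto_intros lim)
      then show "(\<lambda>i. \<bar>f x - s i x\<bar>) \<longlonglongrightarrow> 0" by simp
    qed
    show "AE x in M. norm \<bar>f x - s i x\<bar> \<le> 3 * norm (f x)" for i
      using lim(3)[of _ i] by (intro AE_I2) (smt (verit) real_norm_def)
    show "(\<lambda>x. \<bar>f x - s i x\<bar>) \<in> borel_measurable M" for i
      using lim(1,4) by (intro borel_measurable_abs borel_measurable_diff) auto
  qed (use lim in auto)
  then have "eventually (\<lambda>i. (\<integral>x. \<bar>f x - s i x\<bar> \<partial>M) < e / 2) sequentially"
    using lim.prems by (intro order_tendstoD) auto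
  then obtain i where i: "(\<integral>x. \<bar>f x - s i x\<bar> \<partial>M) < e / 2"
    by (auto simp: eventually_sequentially)
  obtain u where u: "continuous_on UNIV u" "integrable M u" "(\<integral>x. \<bar>s i x - u x\<bar> \<partial>M) < e / 2"
    using lim.IH[of "e/2" i] lim.prems by auto
  have "(\<integral>x. \<bar>f x - u x\<bar> \<partial>M) \<le> (\<integral>x. \<bar>f x - s i x\<bar> + \<bar>s i x - u x\<bar> \<partial>M)"
    using lim u by (intro integral_mono) auto
  also have "\<dots> = (\<integral>x. \<bar>f x - s i x\<bar> \<partial>M) + (\<integral>x. \<bar>s i x - u x\<bar> \<partial>M)"
    using lim u by (intro Bochner_Integration.integral_add) auto
  also have "\<dots> < e" using u i by simp
  finally show ?case using u by blast
qed

text \<open>The normalization \<open>Im p(0) = 0\<close> makes \<open>p\<close> the Herglotz integral of its real part.\<close>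

lemma circle_Re_poly_approx:
  assumes M: "circle_measure M" and h: "h \<in> borel_measurable M"
    and B: "\<And>\<xi>. \<xi> \<in> sphere 0 1 \<Longrightarrow> \<bar>h \<xi>\<bar> \<le> B" and e: "0 < e"
  shows "\<exists>p. Im (poly p 0) = 0 \<and> (\<forall>\<xi>\<in>sphere 0 1. \<bar>Re (poly p \<xi>)\<bar> \<le> B + 1) \<and> (\<integral>\<xi>. \<bar>h \<xi> - Re (poly p \<xi>)\<bar> \<partial>M) < e"
proof -
  interpret finite_measure M using M by (simp add: circle_measure_def)
  have setsM: "sets M = sets circle_borel" and [simp]: "space M = sphere 0 1"
    using M by (auto simp: circle_measure_def space_circle_measure)
  \<comment> \<open>The approximation by continuous functions is available for Borel measures on the
    whole plane, so \<open>M\<close> is pushed forward and \<open>h\<close> is extended by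
    0.\<close>
  let ?N = "distr M borel (\<lambda>x. x)"
  have id: "(\<lambda>x. x) \<in> M \<rightarrow>\<^sub>M borel"
    using setsM by (intro borel_measurable_circle_continuous) auto
  let ?h = "\<lambda>\<xi>. indicator (sphere 0 1) \<xi> * h \<xi>"
  have hm: "?h \<in> borel_measurable borel"
  proof -
    have "h \<in> borel_measurable (restrict_space borel (sphere 0 1))"
      using h setsM measurable_cong_sets unfolding circle_borel_def by blast
    then show ?thesis by (subst (asm) borel_measurable_restrict_space_iff) (auto simp: mult.commute)
  qed
  have hN: "integrable ?N ?h"
    by (subst integrable_distr_eq) (use id hm B in \<open>auto intro!: integrable_const_bound[of _ B] measurable_compose[OF id hm]\<close>)
  have "finite_measure ?N" using id by (rule finite_measure_distr)
  then obtain u where u: "continuous_on UNIV u" "integrable ?N u" "(\<integral>x. \<bar>?h x - u x\<bar> \<partial>?N) < e / 2"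
    using integrable_continuous_approx[OF _ _ hN, of "e/2"] e by auto
  have um: "u \<in> borel_measurable borel" using u(1) by (rule borel_measurable_continuous_onI)
  \<comment> \<open>Since |h| <= B, clamping \<open>u\<close> to [-B, B] does not increase the
    distance to \<open>h\<close>, and it supplies the uniform bound.\<close>
  define v where "v = (\<lambda>x. max (-B) (min B (u x)))"
  have vc: "continuous_on UNIV v" unfolding v_def using u(1) by (intro continuous_intros)
  have vb: "\<bar>v x\<bar> \<le> B" if "x \<in> sphere 0 1" for x using B[OF that] by (auto simp: v_def)
  note int = integrable_circle_continuous[OF M]
  have hi: "integrable M h"
    using B by (intro integrable_const_bound[of _ B] h) auto
  have ic: "integrable M f \<Longrightarrow> integrable M (\<lambda>\<xi>. \<bar>h \<xi> - f \<xi>\<bar>)" for f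
    by (intro integrable_abs Bochner_Integration.integrable_diff hi)
  have cs: "continuous_on UNIV f \<Longrightarrow> continuous_on (sphere 0 1) f" for f :: "complex \<Rightarrow> real"
    by (rule continuous_on_subset) auto
  have 1: "(\<integral>x. \<bar>h x - v x\<bar> \<partial>M) < e / 2"
  proof -
    have "(\<integral>x. \<bar>h x - v x\<bar> \<partial>M) \<le> (\<integral>x. \<bar>h x - u x\<bar> \<partial>M)"
    proof (intro integral_mono ic int cs u(1) vc)
      fix x assume "x \<in> space M"
      then have "\<bar>h x\<bar> \<le> B" using B by simp
      then show "\<bar>h x - v x\<bar> \<le> \<bar>h x - u x\<bar>" by (auto simp: v_def max_def min_def)
    qed
    also have "\<dots> = (\<integral>x. \<bar>?h x - u x\<bar> \<partial>M)"
      by (intro Bochner_Integration.integral_cong) auto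
    also have "\<dots> = (\<integral>x. \<bar>?h x - u x\<bar> \<partial>?N)"
      using id hm um by (subst integral_distr) auto
    finally show ?thesis using u by simp
  qed
  \<comment> \<open>The first alternative yields the bound B + 1, the second makes the uniform error
    cost at most e / 2 after integration.\<close>
  define d where "d = min 1 (e / (2 * (measure M (space M) + 1)))"
  have d: "0 < d" using e by (auto simp: d_def intro!: divide_pos_pos add_nonneg_pos)
  obtain q where q: "\<And>\<xi>. \<xi> \<in> sphere 0 1 \<Longrightarrow> \<bar>v \<xi> - Re (poly q \<xi>)\<bar> < d"
    using Re_poly_dense[OF cs[OF vc] d] by blast
  define p where "p = q - [:\<i> * complex_of_real (Im (poly q 0)):]"
  have p0: "Im (poly p 0) = 0" by (simp add: p_def)
  have p: "\<bar>v \<xi> - Re (poly p \<xi>)\<bar> < d" if "\<xi> \<in> sphere 0 1" for \<xi>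
    using q[OF that] by (simp add: p_def)
  have pb: "\<bar>Re (poly p \<xi>)\<bar> \<le> B + 1" if "\<xi> \<in> sphere 0 1" for \<xi>
    using p[OF that] vb[OF that] by (auto simp: d_def)
  have "(\<integral>\<xi>. \<bar>h \<xi> - Re (poly p \<xi>)\<bar> \<partial>M) \<le> (\<integral>\<xi>. \<bar>h \<xi> - v \<xi>\<bar> + d \<partial>M)"
  proof (rule integral_mono)
    show "integrable M (\<lambda>\<xi>. \<bar>h \<xi> - Re (poly p \<xi>)\<bar>)" by (intro ic int continuous_intros)
    show "integrable M (\<lambda>\<xi>. \<bar>h \<xi> - v \<xi>\<bar> + d)"
      using cs[OF vc] by (intro Bochner_Integration.integrable_add ic int) auto
    fix x assume "x \<in> space M"
    then show "\<bar>h x - Re (poly p x)\<bar> \<le> \<bar>h x - v x\<bar> + d" using p[of x] by simp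
  qed
  also have "\<dots> = (\<integral>\<xi>. \<bar>h \<xi> - v \<xi>\<bar> \<partial>M) + measure M (space M) * d"
    by (subst Bochner_Integration.integral_add[OF ic[OF int[OF cs[OF vc]]]]) auto
  also have "measure M (space M) * d \<le> measure M (space M) * (e / (2 * (measure M (space M) + 1)))"
    by (intro mult_left_mono) (auto simp: d_def)
  also have "\<dots> \<le> e / 2"
  proof -
    have "0 < 2 + 2 * measure M (space M)" using measure_nonneg[of M "space M"] by linarith
    then show ?thesis using e by (simp add: field_simps)
  qed
  finally show ?thesis using 1 pb p0 by (intro exI[of _ p]) auto
qed

section \<open>Herglotz integrals and outer functions\<close>

lemma exp_Lipschitz:
  fixes x y :: real
  assumes "x \<le> C" "y \<le> C"
  shows "\<bar>exp x - exp y\<bar> \<le> exp C * \<bar>x - y\<bar>"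
proof -
  have *: "exp a - exp b \<le> exp C * (a - b)" if "b \<le> a" "a \<le> C" for a b :: real
  proof -
    have "exp a - exp b = exp a * (1 - exp (b - a))" by (simp add: algebra_simps flip: exp_add)
    also have "\<dots> \<le> exp a * (a - b)"
      using exp_ge_add_one_self[of "b - a"] by (intro mult_left_mono) (linarith, simp)
    also have "\<dots> \<le> exp C * (a - b)" using that by (intro mult_right_mono) auto
    finally show ?thesis .
  qed
  show ?thesis using *[of x y] *[of y x] assms by (cases "x \<le> y") auto
qed

lemma truncation_L1:
  fixes f :: "'a \<Rightarrow> real"
  assumes f: "integrable M f"
  shows "(\<lambda>n. \<integral>x. \<bar>f x - max (- real n) (min (real n) (f x))\<bar> \<partial>M) \<longlonglongrightarrow> 0"
proof -
  have [measurable]: "f \<in> borel_measurable M" using f by auto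
  have "(\<lambda>n. \<integral>x. \<bar>f x - max (- real n) (min (real n) (f x))\<bar> \<partial>M) \<longlonglongrightarrow> (\<integral>x. 0 \<partial>M)"
  proof (rule integral_dominated_convergence[where w = "\<lambda>x. \<bar>f x\<bar>"])
    show "AE x in M. (\<lambda>n. \<bar>f x - max (- real n) (min (real n) (f x))\<bar>) \<longlonglongrightarrow> 0"
    proof (intro AE_I2 tendsto_eventually)
      fix x
      obtain N :: nat where "\<bar>f x\<bar> \<le> real N" using real_arch_simple by blast
      then show "\<forall>\<^sub>F n in sequentially. \<bar>f x - max (- real n) (min (real n) (f x))\<bar> = 0"
        unfolding eventually_sequentially by (intro exI[of _ N]) auto
    qed
    show "AE x in M. norm \<bar>f x - max (- real n) (min (real n) (f x))\<bar> \<le> \<bar>f x\<bar>" for n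
      by (intro AE_I2) (auto simp: max_def min_def)
  qed (use f in auto)
  then show ?thesis by simp
qed

definition herglotz :: "(complex \<Rightarrow> real) \<Rightarrow> complex \<Rightarrow> complex" where
  "herglotz f z = (\<integral>\<xi>. (\<xi> + z) / (\<xi> - z) * complex_of_real (f \<xi>) \<partial>circle_m)"

lemma norm_herglotz_kernel:
  fixes \<xi> z :: complex
  assumes "norm \<xi> = 1" "norm z < 1"
  shows "norm ((\<xi> + z) / (\<xi> - z)) \<le> 2 / (1 - norm z)"
proof -
  have "norm (\<xi> + z) \<le> 2" using norm_triangle_ineq[of \<xi> z] assms by simp
  moreover have "1 - norm z \<le> norm (\<xi> - z)" using norm_triangle_ineq2[of \<xi> z] assms by simp
  ultimately show ?thesis using assms unfolding norm_divide by (intro frac_le) simp_all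
qed

lemma integrable_herglotz:
  assumes f: "integrable circle_m f" and z: "norm z < 1"
  shows "integrable circle_m (\<lambda>\<xi>. (\<xi> + z) / (\<xi> - z) * complex_of_real (f \<xi>))"
proof (rule Bochner_Integration.integrable_bound)
  show "integrable circle_m (\<lambda>\<xi>. 2 / (1 - norm z) * f \<xi>)" using f by simp
  have "(\<lambda>\<xi>. (\<xi> + z) / (\<xi> - z)) \<in> borel_measurable circle_m"
    using z by (intro borel_measurable_circle_continuous continuous_intros) auto
  then show "(\<lambda>\<xi>. (\<xi> + z) / (\<xi> - z) * complex_of_real (f \<xi>)) \<in> borel_measurable circle_m"
    using f by (intro borel_measurable_times borel_measurable_of_real) auto
  show "AE \<xi> in circle_m. norm ((\<xi> + z) / (\<xi> - z) * complex_of_real (f \<xi>)) \<le> norm (2 / (1 - norm z) * f \<xi>)"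
  proof (intro AE_I2)
    fix \<xi> assume "\<xi> \<in> space circle_m"
    then show "norm ((\<xi> + z) / (\<xi> - z) * complex_of_real (f \<xi>)) \<le> norm (2 / (1 - norm z) * f \<xi>)"
      using norm_herglotz_kernel[of \<xi> z] z unfolding norm_mult by (intro mult_mono) auto
  qed
qed

text \<open>Convergence of boundary functions in the norm of L^1 thereby becomes uniform convergence
  on each smaller disk.\<close>

lemma norm_herglotz_le:
  assumes f: "integrable circle_m f" and z: "norm z < 1"
  shows "norm (herglotz f z) \<le> 2 / (1 - norm z) * (\<integral>\<xi>. \<bar>f \<xi>\<bar> \<partial>circle_m)"
proof -
  have "norm (herglotz f z) \<le> (\<integral>\<xi>. norm ((\<xi> + z) / (\<xi> - z) * complex_of_real (f \<xi>)) \<partial>circle_m)"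
    unfolding herglotz_def by (rule integral_norm_bound)
  also have "\<dots> \<le> (\<integral>\<xi>. 2 / (1 - norm z) * \<bar>f \<xi>\<bar> \<partial>circle_m)"
  proof (rule integral_mono)
    show "integrable circle_m (\<lambda>\<xi>. norm ((\<xi> + z) / (\<xi> - z) * complex_of_real (f \<xi>)))"
      by (intro integrable_norm integrable_herglotz f z)
    show "integrable circle_m (\<lambda>\<xi>. 2 / (1 - norm z) * \<bar>f \<xi>\<bar>)" using f by simp
    fix \<xi> assume "\<xi> \<in> space circle_m"
    then show "norm ((\<xi> + z) / (\<xi> - z) * complex_of_real (f \<xi>)) \<le> 2 / (1 - norm z) * \<bar>f \<xi>\<bar>"
      using norm_herglotz_kernel[of \<xi> z] z unfolding norm_mult by (intro mult_mono) auto
  qed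
  finally show ?thesis by simp
qed

lemma herglotz_diff:
  assumes "integrable circle_m f" "integrable circle_m g" "norm z < 1"
  shows "herglotz (\<lambda>\<xi>. f \<xi> - g \<xi>) z = herglotz f z - herglotz g z"
  using integrable_herglotz[OF assms(1,3)] integrable_herglotz[OF assms(2,3)]
  unfolding herglotz_def by (simp only: of_real_diff right_diff_distrib Bochner_Integration.integral_diff)

text \<open>Split Re p = (p + cnj p) / 2. The half with p is a Cauchy integral and gives p(z) - p(0)
  / 2. In the other half the kernel on the circle is the conjugate of (1 + cnj z xi) / (1 - cnj z
  xi), which is holomorphic across the circle, so the mean value property gives cnj(p(0)) / 2. The
  two values at 0 cancel because p(0) is real.\<close>

lemma herglotz_Re_poly:
  fixes p :: "complex poly"
  assumes p: "Im (poly p 0) = 0" and z: "norm z < 1"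
  shows "herglotz (\<lambda>\<xi>. Re (poly p \<xi>)) z = poly p z"
proof -
  note int = integrable_circle_continuous[OF circle_measure_circle_m]
  have nz: "\<xi> - z \<noteq> 0" "1 - cnj z * \<xi> \<noteq> 0" if "norm \<xi> = 1" for \<xi>
  proof -
    show "\<xi> - z \<noteq> 0" using that z by auto
    show "1 - cnj z * \<xi> \<noteq> 0"
    proof
      assume "1 - cnj z * \<xi> = 0"
      then have "norm (cnj z * \<xi>) = 1" by (metis eq_iff_diff_eq_0 norm_one)
      then show False using that z by (simp add: norm_mult)
    qed
  qed
  have 1: "(\<integral>\<xi>. \<xi> * (poly p \<xi> / (\<xi> - z)) \<partial>circle_m) = poly p z"
  proof -
    have c: "continuous_on (sphere 0 1) (\<lambda>\<xi>. poly p \<xi> / (\<xi> - z))"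
      using nz by (intro continuous_intros) auto
    have "((\<lambda>u. poly p u / (u - z)) has_contour_integral (2 * of_real pi * \<i> * poly p z)) (circlepath 0 1)"
      using z by (intro Cauchy_integral_circlepath_simple holomorphic_intros) auto
    then have "contour_integral (circlepath 0 1) (\<lambda>u. poly p u / (u - z)) = 2 * of_real pi * \<i> * poly p z"
      by (rule contour_integral_unique)
    then show ?thesis using contour_integral_unit_circle[OF c] by simp
  qed
  \<comment> \<open>\<open>V\<close> below has its pole at 1 / \<open>cnj z\<close>, of modulus 1 /
    |z| > 1; for z = 0 there is none and 2 stands for any radius above 1.\<close>
  define r where "r = (if z = 0 then 2 else 1 / norm z)"
  have r: "1 < r" using z by (auto simp: r_def field_simps)
  define V where "V = (\<lambda>\<xi>. (1 + cnj z * \<xi>) / (1 - cnj z * \<xi>) * poly p \<xi>)"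
  have 2: "(\<integral>\<xi>. V \<xi> \<partial>circle_m) = poly p 0"
  proof -
    have nz': "1 - cnj z * \<xi> \<noteq> 0" if "norm \<xi> < r" for \<xi>
    proof
      assume "1 - cnj z * \<xi> = 0"
      then have "norm (cnj z * \<xi>) = 1" by (metis eq_iff_diff_eq_0 norm_one)
      then show False using that z by (auto simp: norm_mult r_def field_simps split: if_splits)
    qed
    have "(\<integral>\<xi>. V \<xi> \<partial>circle_m) = V 0"
      unfolding V_def using r nz'
      by (intro integral_circle_mean_value[of "ball 0 r"] holomorphic_intros) auto
    then show ?thesis by (simp add: V_def)
  qed
  have cV: "continuous_on (sphere 0 1) V"
    unfolding V_def using nz by (intro continuous_intros) auto
  have "herglotz (\<lambda>\<xi>. Re (poly p \<xi>)) z =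
     (\<integral>\<xi>. \<xi> * (poly p \<xi> / (\<xi> - z)) - poly p \<xi> / 2 + cnj (V \<xi>) / 2 \<partial>circle_m)"
    unfolding herglotz_def
  proof (rule Bochner_Integration.integral_cong)
    fix \<xi> assume "\<xi> \<in> space circle_m"
    then have n: "norm \<xi> = 1" by simp
    then have x1: "\<xi> * cnj \<xi> = 1" by (simp add: complex_norm_square[symmetric])
    have "cnj ((1 + cnj z * \<xi>) / (1 - cnj z * \<xi>)) = (1 + z * cnj \<xi>) / (1 - z * cnj \<xi>)"
      by simp
    also have "\<dots> = (\<xi> * (1 + z * cnj \<xi>)) / (\<xi> * (1 - z * cnj \<xi>))"
      using n by (subst mult_divide_mult_cancel_left) auto
    also have "\<dots> = (\<xi> + z * (\<xi> * cnj \<xi>)) / (\<xi> - z * (\<xi> * cnj \<xi>))"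
      by (simp add: algebra_simps)
    also have "\<dots> = (\<xi> + z) / (\<xi> - z)" by (simp add: x1)
    finally have V: "cnj (V \<xi>) = (\<xi> + z) / (\<xi> - z) * cnj (poly p \<xi>)"
      by (simp only: V_def complex_cnj_mult)
    have "complex_of_real (Re (poly p \<xi>)) = (poly p \<xi> + cnj (poly p \<xi>)) / 2"
      by (simp add: complex_add_cnj)
    then have "(\<xi> + z) / (\<xi> - z) * complex_of_real (Re (poly p \<xi>)) =
        (\<xi> + z) / (\<xi> - z) * poly p \<xi> / 2 + cnj (V \<xi>) / 2"
      by (simp add: V algebra_simps add_divide_distrib)
    also have "(\<xi> + z) / (\<xi> - z) * poly p \<xi> / 2 = \<xi> * (poly p \<xi> / (\<xi> - z)) - poly p \<xi> / 2"
      using nz(1)[OF n] by (simp add: field_simps)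
    finally show "(\<xi> + z) / (\<xi> - z) * complex_of_real (Re (poly p \<xi>)) =
        \<xi> * (poly p \<xi> / (\<xi> - z)) - poly p \<xi> / 2 + cnj (V \<xi>) / 2" .
  qed simp
  also have "\<dots> = (\<integral>\<xi>. \<xi> * (poly p \<xi> / (\<xi> - z)) \<partial>circle_m) - (\<integral>\<xi>. poly p \<xi> / 2 \<partial>circle_m)
       + (\<integral>\<xi>. cnj (V \<xi>) / 2 \<partial>circle_m)"
    using nz cV by (subst Bochner_Integration.integral_add Bochner_Integration.integral_diff
        | auto intro!: int continuous_intros)+
  also have "(\<integral>\<xi>. cnj (V \<xi>) / 2 \<partial>circle_m) = cnj (poly p 0) / 2"
    using int[OF cV] by (simp add: 2)
  also have "(\<integral>\<xi>. poly p \<xi> / 2 \<partial>circle_m) = poly p 0 / 2"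
    using integral_circle_mean_value[of UNIV "poly p"] by (simp add: holomorphic_intros)
  also have "cnj (poly p 0) = poly p 0" using p by (simp add: complex_eq_iff)
  finally show ?thesis using 1 by simp
qed

text \<open>The Szego function as a function of the density.\<close>

definition outer_fun :: "(complex \<Rightarrow> real) \<Rightarrow> complex \<Rightarrow> complex" where
  "outer_fun w z = exp (1/2 * herglotz (\<lambda>\<xi>. ln (w \<xi>)) z)"

text \<open>Closeness of logarithms in L^1 says nothing about exponentials, so the last bound needs
  its own argument. Truncating ln w at -n and n raises w by at most exp(-n). The polynomial then
  approximates a bounded function and obeys nearly the same bound, so exp is Lipschitz on the
  relevant range, and the accuracy is chosen after n.\<close>

lemma L1_Re_poly_approx:
  assumes w: "integrable circle_m w" and w0: "AE \<xi> in circle_m. 0 < w \<xi>"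
    and lw: "integrable circle_m (\<lambda>\<xi>. ln (w \<xi>))"
    and u: "continuous_on (sphere 0 1) u" "\<And>\<xi>. \<xi> \<in> sphere 0 1 \<Longrightarrow> 0 \<le> u \<xi>" and e: "0 < e"
  shows "\<exists>p. Im (poly p 0) = 0 \<and> (\<integral>\<xi>. \<bar>ln (w \<xi>) - 2 * Re (poly p \<xi>)\<bar> \<partial>circle_m) < e \<and>
     (\<integral>\<xi>. u \<xi> * exp (2 * Re (poly p \<xi>)) \<partial>circle_m) \<le> (\<integral>\<xi>. u \<xi> * w \<xi> \<partial>circle_m) + e"
proof -
  interpret m: prob_space circle_m by (rule prob_space_circle_m)
  note int = integrable_circle_continuous[OF circle_measure_circle_m]
  have "compact (u ` sphere 0 1)" using u(1) by (intro compact_continuous_image) auto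
  then obtain K where "0 < K" and K: "\<And>\<xi>. \<xi> \<in> sphere 0 1 \<Longrightarrow> \<bar>u \<xi>\<bar> \<le> K"
    by (metis bounded_pos compact_imp_bounded image_eqI real_norm_def)
  have um[measurable]: "u \<in> borel_measurable circle_m"
    using u(1) by (intro borel_measurable_circle_continuous) auto
  have [measurable]: "w \<in> borel_measurable circle_m" using w by auto
  have "\<forall>\<^sub>F n in sequentially. (\<integral>x. \<bar>ln (w x) - max (- real n) (min (real n) (ln (w x)))\<bar> \<partial>circle_m) < e / 2"
    using truncation_L1[OF lw] e by (intro order_tendstoD) auto
  moreover have "\<forall>\<^sub>F n in sequentially. K * exp (- real n) < e / 2"
  proof -
    have "(\<lambda>n. K * exp (- real n)) \<longlonglongrightarrow> K * 0"
      by (intro tendsto_intros filterlim_compose[OF exp_at_bot] filterlim_compose[OF filterlim_uminus_at_bot_at_top] filterlim_real_sequentially)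
    then show ?thesis using e by (intro order_tendstoD) auto
  qed
  ultimately have "\<forall>\<^sub>F n in sequentially. (\<integral>x. \<bar>ln (w x) - max (- real n) (min (real n) (ln (w x)))\<bar> \<partial>circle_m) < e / 2
       \<and> K * exp (- real n) < e / 2" by (rule eventually_conj)
  then obtain n where n: "(\<integral>x. \<bar>ln (w x) - max (- real n) (min (real n) (ln (w x)))\<bar> \<partial>circle_m) < e / 2"
       "K * exp (- real n) < e / 2"
    by (auto simp: eventually_sequentially)
  define h where "h = (\<lambda>\<xi>. max (- real n) (min (real n) (ln (w \<xi>))))"
  have [measurable]: "h \<in> borel_measurable circle_m" unfolding h_def by measurable
  have hb: "\<bar>h \<xi>\<bar> \<le> real n" for \<xi> by (auto simp: h_def)
  \<comment> \<open>The error in 2 Re p is below 2 d: the first alternative completes the bound on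
    the logarithms, the second makes the Lipschitz term with constant K exp(n + 2) at most e /
    2.\<close>
  define d where "d = min (e / 4) (e / (4 * K * exp (real n + 2)))"
  have d: "0 < d" using e \<open>0 < K\<close> by (auto simp: d_def)
  obtain p where p: "Im (poly p 0) = 0" "\<And>\<xi>. \<xi> \<in> sphere 0 1 \<Longrightarrow> \<bar>Re (poly p \<xi>)\<bar> \<le> real n / 2 + 1"
    "(\<integral>\<xi>. \<bar>h \<xi> / 2 - Re (poly p \<xi>)\<bar> \<partial>circle_m) < d"
    using circle_Re_poly_approx[OF circle_measure_circle_m, of "\<lambda>\<xi>. h \<xi> / 2" "real n / 2" d] hb d
    by auto
  have hi: "integrable circle_m h"
    by (rule m.integrable_const_bound[of _ "real n"]) (use hb in auto)
  have pi: "integrable circle_m (\<lambda>\<xi>. Re (poly p \<xi>))" by (intro int continuous_intros)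
  have hp: "(\<integral>\<xi>. \<bar>h \<xi> - 2 * Re (poly p \<xi>)\<bar> \<partial>circle_m) < 2 * d"
  proof -
    have "(\<integral>\<xi>. \<bar>h \<xi> - 2 * Re (poly p \<xi>)\<bar> \<partial>circle_m) = (\<integral>\<xi>. 2 * \<bar>h \<xi> / 2 - Re (poly p \<xi>)\<bar> \<partial>circle_m)"
      by (intro Bochner_Integration.integral_cong refl) (simp add: abs_if field_simps)
    then show ?thesis using p(3) by simp
  qed
  have "(\<integral>\<xi>. \<bar>ln (w \<xi>) - 2 * Re (poly p \<xi>)\<bar> \<partial>circle_m) \<le> (\<integral>\<xi>. \<bar>ln (w \<xi>) - h \<xi>\<bar> + \<bar>h \<xi> - 2 * Re (poly p \<xi>)\<bar> \<partial>circle_m)"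
    using lw hi pi by (intro integral_mono) auto
  also have "\<dots> = (\<integral>\<xi>. \<bar>ln (w \<xi>) - h \<xi>\<bar> \<partial>circle_m) + (\<integral>\<xi>. \<bar>h \<xi> - 2 * Re (poly p \<xi>)\<bar> \<partial>circle_m)"
    using lw hi pi by (intro Bochner_Integration.integral_add) auto
  also have "\<dots> < e" using n(1) hp by (auto simp: h_def d_def)
  finally have 1: "(\<integral>\<xi>. \<bar>ln (w \<xi>) - 2 * Re (poly p \<xi>)\<bar> \<partial>circle_m) < e" .
  have uw: "integrable circle_m (\<lambda>\<xi>. u \<xi> * w \<xi>)"
    by (rule Bochner_Integration.integrable_bound[of _ "\<lambda>\<xi>. K * w \<xi>"])
       (use w K \<open>0 < K\<close> in \<open>auto simp: abs_mult intro!: mult_mono\<close>)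
  have "(\<integral>\<xi>. u \<xi> * exp (2 * Re (poly p \<xi>)) \<partial>circle_m) \<le>
     (\<integral>\<xi>. u \<xi> * w \<xi> + K * exp (- real n) + K * exp (real n + 2) * \<bar>h \<xi> - 2 * Re (poly p \<xi>)\<bar> \<partial>circle_m)"
  proof (rule integral_mono_AE)
    show "integrable circle_m (\<lambda>\<xi>. u \<xi> * exp (2 * Re (poly p \<xi>)))"
      using u by (intro int continuous_intros) auto
    show "integrable circle_m (\<lambda>\<xi>. u \<xi> * w \<xi> + K * exp (- real n) + K * exp (real n + 2) * \<bar>h \<xi> - 2 * Re (poly p \<xi>)\<bar>)"
      using uw hi pi by auto
    show "AE \<xi> in circle_m. u \<xi> * exp (2 * Re (poly p \<xi>)) \<le>
       u \<xi> * w \<xi> + K * exp (- real n) + K * exp (real n + 2) * \<bar>h \<xi> - 2 * Re (poly p \<xi>)\<bar>"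
      using w0 AE_space
    proof eventually_elim
      case (elim \<xi>)
      have s: "\<xi> \<in> sphere 0 1" using elim by simp
      have "exp (h \<xi>) \<le> w \<xi> + exp (- real n)"
      proof -
        have "exp (h \<xi>) \<le> exp (max (- real n) (ln (w \<xi>)))" by (auto simp: h_def)
        also have "\<dots> = max (exp (- real n)) (w \<xi>)" using elim by (auto simp: max_def ln_ge_iff)
        also have "\<dots> \<le> w \<xi> + exp (- real n)" using elim by auto
        finally show ?thesis .
      qed
      moreover have "exp (2 * Re (poly p \<xi>)) \<le> exp (h \<xi>) + exp (real n + 2) * \<bar>h \<xi> - 2 * Re (poly p \<xi>)\<bar>"
      proof -
        have "h \<xi> \<le> real n + 2" "2 * Re (poly p \<xi>) \<le> real n + 2"
          using hb[of \<xi>] p(2)[OF s] by (auto simp: abs_le_iff)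
        from exp_Lipschitz[OF this] show ?thesis by linarith
      qed
      ultimately have "exp (2 * Re (poly p \<xi>)) \<le> w \<xi> + (exp (- real n) + exp (real n + 2) * \<bar>h \<xi> - 2 * Re (poly p \<xi>)\<bar>)" by simp
      then have "u \<xi> * exp (2 * Re (poly p \<xi>)) \<le> u \<xi> * (w \<xi> + (exp (- real n) + exp (real n + 2) * \<bar>h \<xi> - 2 * Re (poly p \<xi>)\<bar>))"
        using u(2)[OF s] by (rule mult_left_mono)
      also have "\<dots> = u \<xi> * w \<xi> + u \<xi> * (exp (- real n) + exp (real n + 2) * \<bar>h \<xi> - 2 * Re (poly p \<xi>)\<bar>)"
        by (simp add: algebra_simps)
      also have "\<dots> \<le> u \<xi> * w \<xi> + K * (exp (- real n) + exp (real n + 2) * \<bar>h \<xi> - 2 * Re (poly p \<xi>)\<bar>)"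
        using K[OF s] by (intro add_left_mono mult_right_mono) auto
      finally show ?case by (simp add: algebra_simps)
    qed
  qed
  also have "\<dots> = (\<integral>\<xi>. u \<xi> * w \<xi> \<partial>circle_m) + K * exp (- real n) + K * exp (real n + 2) * (\<integral>\<xi>. \<bar>h \<xi> - 2 * Re (poly p \<xi>)\<bar> \<partial>circle_m)"
    using uw hi pi by (subst Bochner_Integration.integral_add | auto simp: m.prob_space[unfolded space_circle_m])+
  also have "K * exp (real n + 2) * (\<integral>\<xi>. \<bar>h \<xi> - 2 * Re (poly p \<xi>)\<bar> \<partial>circle_m) \<le> K * exp (real n + 2) * (2 * (e / (4 * K * exp (real n + 2))))"
    using hp \<open>0 < K\<close> by (intro mult_left_mono) (auto simp: d_def)
  also have "\<dots> = e / 2" using \<open>0 < K\<close> by (simp add: field_simps)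
  finally have "(\<integral>\<xi>. u \<xi> * exp (2 * Re (poly p \<xi>)) \<partial>circle_m) \<le> (\<integral>\<xi>. u \<xi> * w \<xi> \<partial>circle_m) + e"
    using n(2) by simp
  with 1 p(1) show ?thesis by blast
qed

section \<open>Taylor coefficients of outer functions\<close>

lemma has_fps_expansion_tcoeff:
  assumes "f has_fps_expansion F"
  shows "tcoeff f k = fps_nth F k"
  using fps_nth_fps_expansion[OF assms] by (simp add: tcoeff_def)

lemma tcoeff_0: "tcoeff f 0 = f 0"
  by (simp add: tcoeff_def)

text \<open>This is what turns an extremal polynomial for the functional with index 0 into one for
  index k: multiply it by z^k.\<close>

lemma tcoeff_power_mult:
  assumes "open U" "0 \<in> U" "f holomorphic_on U"
  shows "tcoeff (\<lambda>z. z ^ k * f z) k = f 0"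
proof -
  have f: "f has_fps_expansion fps_expansion f 0" using assms by (rule has_fps_expansion_fps_expansion)
  have "(\<lambda>z. z ^ k * f z) has_fps_expansion fps_X ^ k * fps_expansion f 0"
    by (intro fps_expansion_intros f)
  from has_fps_expansion_tcoeff[OF this, of k] show ?thesis
    by (simp add: fps_X_power_mult_nth fps_expansion_def)
qed

lemma tcoeff_add:
  assumes "open U" "0 \<in> U" "f holomorphic_on U" "g holomorphic_on U"
  shows "tcoeff (\<lambda>z. f z + g z) k = tcoeff f k + tcoeff g k"
  using assms by (simp add: tcoeff_def higher_deriv_add[of f U g 0] add_divide_distrib)

lemma tcoeff_cmult:
  assumes "open U" "0 \<in> U" "f holomorphic_on U"
  shows "tcoeff (\<lambda>z. c * f z) k = c * tcoeff f k"
  using assms by (simp add: tcoeff_def higher_deriv_cmult[of f U 0])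

lemma uniform_limit_herglotz:
  assumes f: "integrable circle_m f" and p: "\<And>j. Im (poly (p j) 0) = 0"
    and lim: "(\<lambda>j. \<integral>\<xi>. \<bar>f \<xi> - 2 * Re (poly (p j) \<xi>)\<bar> \<partial>circle_m) \<longlonglongrightarrow> 0" and r: "r < 1"
  shows "uniform_limit (cball 0 r) (\<lambda>j z. poly (p j) z) (\<lambda>z. 1/2 * herglotz f z) sequentially"
proof (rule uniform_limitI)
  fix e :: real assume e: "0 < e"
  \<comment> \<open>The factor 1 - r cancels the kernel bound 2 / (1 - r); the remaining 2 cancels
    because \<open>poly (p j)\<close> is compared with half of the Herglotz integral.\<close>
  have "\<forall>\<^sub>F j in sequentially. (\<integral>\<xi>. \<bar>f \<xi> - 2 * Re (poly (p j) \<xi>)\<bar> \<partial>circle_m) < e * (1 - r)"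
    using lim e r by (intro order_tendstoD) auto
  then show "\<forall>\<^sub>F j in sequentially. \<forall>z\<in>cball 0 r. dist (poly (p j) z) (1/2 * herglotz f z) < e"
  proof eventually_elim
    case (elim j)
    show ?case
    proof
      fix z :: complex assume z: "z \<in> cball 0 r"
      then have z1: "norm z < 1" using r by simp
      have pi: "integrable circle_m (\<lambda>\<xi>. Re (poly (smult 2 (p j)) \<xi>))"
        by (intro integrable_circle_continuous[OF circle_measure_circle_m] continuous_intros)
      have "herglotz f z - 2 * poly (p j) z = herglotz (\<lambda>\<xi>. f \<xi> - Re (poly (smult 2 (p j)) \<xi>)) z"
        using herglotz_Re_poly[of "smult 2 (p j)" z] p[of j] z1 by (subst herglotz_diff[OF f pi z1]) simp
      then have "norm (herglotz f z - 2 * poly (p j) z) \<le> 2 / (1 - norm z) * (\<integral>\<xi>. \<bar>f \<xi> - 2 * Re (poly (p j) \<xi>)\<bar> \<partial>circle_m)"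
        using norm_herglotz_le[of "\<lambda>\<xi>. f \<xi> - Re (poly (smult 2 (p j)) \<xi>)" z] f pi z1 by simp
      also have "\<dots> \<le> 2 / (1 - r) * (\<integral>\<xi>. \<bar>f \<xi> - 2 * Re (poly (p j) \<xi>)\<bar> \<partial>circle_m)"
        using z r by (intro mult_right_mono frac_le) auto
      also have "\<dots> < 2 / (1 - r) * (e * (1 - r))"
        using elim r by (intro mult_strict_left_mono) auto
      also have "\<dots> = 2 * e" using r by simp
      finally have "norm (herglotz f z - 2 * poly (p j) z) < 2 * e" .
      moreover have "norm (herglotz f z - 2 * poly (p j) z) = 2 * norm (poly (p j) z - 1/2 * herglotz f z)"
      proof -
        have "herglotz f z - 2 * poly (p j) z = - 2 * (poly (p j) z - 1/2 * herglotz f z)" by simp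
        then show ?thesis by (simp only: norm_mult) simp
      qed
      ultimately show "dist (poly (p j) z) (1/2 * herglotz f z) < e" by (simp add: dist_norm)
    qed
  qed
qed

lemma uniform_limit_exp_herglotz:
  assumes f: "integrable circle_m f" and r: "0 < r" "r < 1"
    and lim: "uniform_limit (cball 0 r) (\<lambda>j z. poly (p j) z) (\<lambda>z. 1/2 * herglotz f z) sequentially"
  shows "uniform_limit (cball 0 r) (\<lambda>j z. exp (poly (p j) z)) (\<lambda>z. exp (1/2 * herglotz f z)) sequentially"
proof -
  \<comment> \<open>This bounds the limit function on the disk of radius r. The approximants are
    eventually within distance 1 of it, so all values lie in a compact disk on which exp is
    uniformly continuous.\<close>
  let ?C = "(\<integral>\<xi>. \<bar>f \<xi>\<bar> \<partial>circle_m) / (1 - r)"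
  have b: "norm (1/2 * herglotz f z) \<le> ?C" if "z \<in> cball 0 r" for z
  proof -
    have "norm (herglotz f z) \<le> 2 / (1 - norm z) * (\<integral>\<xi>. \<bar>f \<xi>\<bar> \<partial>circle_m)"
      using that r by (intro norm_herglotz_le f) auto
    also have "\<dots> \<le> 2 / (1 - r) * (\<integral>\<xi>. \<bar>f \<xi>\<bar> \<partial>circle_m)"
      using that r by (intro mult_right_mono frac_le) auto
    finally show ?thesis by (simp add: norm_mult mult.commute)
  qed
  show ?thesis
  proof (rule uniform_limit_compose_uniformly_continuous_on[OF lim])
    show "uniformly_continuous_on (cball 0 (?C + 1)) (exp :: complex \<Rightarrow> complex)"
      by (intro compact_uniformly_continuous continuous_intros) auto
    have "\<forall>\<^sub>F j in sequentially. \<forall>z\<in>cball 0 r. dist (poly (p j) z) (1/2 * herglotz f z) < 1"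
      using lim by (rule uniform_limitD) simp
    then show "\<forall>\<^sub>F j in sequentially. \<forall>z\<in>cball 0 r. poly (p j) z \<in> cball 0 (?C + 1)"
    proof eventually_elim
      case (elim j)
      show ?case
      proof
        fix z :: complex assume z: "z \<in> cball 0 r"
        have "norm (poly (p j) z) \<le> norm (1/2 * herglotz f z) + norm (poly (p j) z - 1/2 * herglotz f z)"
          by (rule norm_triangle_sub)
        also have "\<dots> \<le> ?C + 1"
          using b[OF z] bspec[OF elim z] unfolding dist_norm by linarith
        finally show "poly (p j) z \<in> cball 0 (?C + 1)" by simp
      qed
    qed
  qed auto
qed

context
  fixes w :: "complex \<Rightarrow> real"
  assumes w: "integrable circle_m w" and lw: "log_integrable w"
begin

text \<open>A single sequence serves both purposes: convergence inside the disk, and a bound on the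
  circle for |exp(p_j)|^2 = exp(2 Re p_j). The latter is one-sided, which is all that Bessel's
  inequality needs in the limit.\<close>

lemma outer_fun_approx:
  assumes u: "continuous_on (sphere 0 1) u" "\<And>\<xi>. \<xi> \<in> sphere 0 1 \<Longrightarrow> 0 \<le> u \<xi>"
  obtains p where "\<And>r. 0 < r \<Longrightarrow> r < 1 \<Longrightarrow>
      uniform_limit (cball 0 r) (\<lambda>j z. exp (poly (p j) z)) (outer_fun w) sequentially"
    "\<And>j::nat. (\<integral>\<xi>. u \<xi> * exp (2 * Re (poly (p j) \<xi>)) \<partial>circle_m) \<le> (\<integral>\<xi>. u \<xi> * w \<xi> \<partial>circle_m) + 1 / real (Suc j)"
proof -
  have lw': "AE \<xi> in circle_m. 0 < w \<xi>" "integrable circle_m (\<lambda>\<xi>. ln (w \<xi>))"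
    using lw by (auto simp: log_integrable_def)
  have "\<forall>j. \<exists>p. Im (poly p 0) = 0 \<and> (\<integral>\<xi>. \<bar>ln (w \<xi>) - 2 * Re (poly p \<xi>)\<bar> \<partial>circle_m) < 1 / real (Suc j) \<and>
     (\<integral>\<xi>. u \<xi> * exp (2 * Re (poly p \<xi>)) \<partial>circle_m) \<le> (\<integral>\<xi>. u \<xi> * w \<xi> \<partial>circle_m) + 1 / real (Suc j)"
    by (intro allI L1_Re_poly_approx[OF w lw' u]) auto
  from choice[OF this] obtain p where p: "\<And>j. Im (poly (p j) 0) = 0"
    "\<And>j. (\<integral>\<xi>. \<bar>ln (w \<xi>) - 2 * Re (poly (p j) \<xi>)\<bar> \<partial>circle_m) < 1 / real (Suc j)"
    "\<And>j. (\<integral>\<xi>. u \<xi> * exp (2 * Re (poly (p j) \<xi>)) \<partial>circle_m) \<le> (\<integral>\<xi>. u \<xi> * w \<xi> \<partial>circle_m) + 1 / real (Suc j)"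
    by blast
  have lim: "(\<lambda>j. \<integral>\<xi>. \<bar>ln (w \<xi>) - 2 * Re (poly (p j) \<xi>)\<bar> \<partial>circle_m) \<longlonglongrightarrow> 0"
    by (rule tendsto_sandwich[OF _ _ tendsto_const lim_1_over_n[THEN LIMSEQ_Suc]])
       (use p(2) in \<open>auto intro!: eventuallyI less_imp_le\<close>)
  show thesis
  proof
    fix r :: real assume r: "0 < r" "r < 1"
    show "uniform_limit (cball 0 r) (\<lambda>j z. exp (poly (p j) z)) (outer_fun w) sequentially"
      unfolding outer_fun_def
      by (intro uniform_limit_exp_herglotz uniform_limit_herglotz lw' p lim r)
  qed (rule p(3))
qed

lemma outer_fun_holomorphic: "outer_fun w holomorphic_on ball 0 1"
proof -
  obtain p where p: "\<And>r. 0 < r \<Longrightarrow> r < 1 \<Longrightarrow>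
      uniform_limit (cball 0 r) (\<lambda>j z. exp (poly (p j) z)) (outer_fun w) sequentially"
    using outer_fun_approx[of "\<lambda>_. 0"] by auto
  show ?thesis
  proof (rule holomorphic_uniform_sequence)
    show "(\<lambda>z. exp (poly (p j) z)) holomorphic_on ball 0 1" for j
      by (intro holomorphic_intros)
    fix x :: complex assume x: "x \<in> ball 0 1"
    define d where "d = (1 - norm x) / 2"
    have d: "0 < d" "norm x + d < 1" using x by (auto simp: d_def field_simps)
    have sub: "cball x d \<subseteq> cball 0 (norm x + d)"
    proof
      fix y assume "y \<in> cball x d"
      then show "y \<in> cball 0 (norm x + d)"
        using norm_triangle_sub[of y x] by (auto simp: dist_norm norm_minus_commute)
    qed
    have "uniform_limit (cball x d) (\<lambda>j z. exp (poly (p j) z)) (outer_fun w) sequentially"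
      by (intro uniform_limit_on_subset[OF p sub] add_nonneg_pos d norm_ge_zero)
    moreover have "cball x d \<subseteq> ball 0 1" using sub d by (force simp: subset_eq)
    ultimately show "\<exists>d>0. cball x d \<subseteq> ball 0 1 \<and> uniform_limit (cball x d) (\<lambda>j z. exp (poly (p j) z)) (outer_fun w) sequentially"
      using d by blast
  qed auto
qed

text \<open>Bessel's inequality holds for R exp(p_j), which is holomorphic across the circle. On its
  left side the coefficients converge by uniform convergence near 0; its right side exceeds the
  integral against \<open>w\<close> by at most 1 / (j + 1).\<close>

lemma tcoeff_outer_fun_le:
  assumes U: "open U" "cball 0 1 \<subseteq> U" "R holomorphic_on U" and A: "finite A"
  shows "(\<Sum>k\<in>A. (cmod (tcoeff (\<lambda>z. R z * outer_fun w z) k))\<^sup>2) \<le> (\<integral>\<xi>. (cmod (R \<xi>))\<^sup>2 * w \<xi> \<partial>circle_m)"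
proof -
  have Rc: "continuous_on (sphere 0 1) R"
    using U by (meson continuous_on_subset holomorphic_on_imp_continuous_on sphere_cball subset_trans)
  obtain p where p: "\<And>r. 0 < r \<Longrightarrow> r < 1 \<Longrightarrow>
      uniform_limit (cball 0 r) (\<lambda>j z. exp (poly (p j) z)) (outer_fun w) sequentially"
    "\<And>j::nat. (\<integral>\<xi>. (cmod (R \<xi>))\<^sup>2 * exp (2 * Re (poly (p j) \<xi>)) \<partial>circle_m) \<le> (\<integral>\<xi>. (cmod (R \<xi>))\<^sup>2 * w \<xi> \<partial>circle_m) + 1 / real (Suc j)"
    by (rule outer_fun_approx[of "\<lambda>\<xi>. (cmod (R \<xi>))\<^sup>2"]) (auto intro!: continuous_intros Rc)
  \<comment> \<open>Coefficients at 0 depend only on a neighbourhood of 0, so any radius below 1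
    will do.\<close>
  have half: "cball 0 (1/2) \<subseteq> cball (0::complex) 1" "cball 0 (1/2) \<subseteq> ball (0::complex) 1" by auto
  have bd: "bounded (f ` cball 0 (1/2))" if "f holomorphic_on V" "cball 0 (1/2) \<subseteq> V"
    for f :: "complex \<Rightarrow> complex" and V
    by (intro compact_imp_bounded compact_continuous_image holomorphic_on_imp_continuous_on
      holomorphic_on_subset[OF that] compact_cball)
  have bR: "bounded (R ` cball 0 (1/2))"
    by (rule bd[OF U(3) order_trans[OF half(1) U(2)]])
  have bD: "bounded (outer_fun w ` cball 0 (1/2))"
    by (rule bd[OF outer_fun_holomorphic half(2)])
  have lim: "uniform_limit (cball 0 (1/2)) (\<lambda>j z. R z * exp (poly (p j) z)) (\<lambda>z. R z * outer_fun w z) sequentially"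
    by (intro uniform_lim_mult p bR bD uniform_limit_const) auto
  have conv: "(\<lambda>j. tcoeff (\<lambda>z. R z * exp (poly (p j) z)) k) \<longlonglongrightarrow> tcoeff (\<lambda>z. R z * outer_fun w z) k" for k
    unfolding tcoeff_def
  proof (intro tendsto_divide tendsto_const higher_deriv_complex_uniform_limit)
    show "uniform_limit (ball 0 (1/2)) (\<lambda>j z. R z * exp (poly (p j) z)) (\<lambda>z. R z * outer_fun w z) sequentially"
      by (rule uniform_limit_on_subset[OF lim ball_subset_cball])
    have "R holomorphic_on ball 0 (1/2)"
      by (rule holomorphic_on_subset[OF U(3)])
         (use half(1) U(2) ball_subset_cball[of 0 "1/2::real"] in blast)
    then show "\<forall>\<^sub>F j in sequentially. (\<lambda>z. R z * exp (poly (p j) z)) holomorphic_on ball 0 (1 / 2)"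
      by (intro always_eventually allI holomorphic_intros)
  qed auto
  have le: "(\<Sum>k\<in>A. (cmod (tcoeff (\<lambda>z. R z * exp (poly (p j) z)) k))\<^sup>2) \<le> (\<integral>\<xi>. (cmod (R \<xi>))\<^sup>2 * w \<xi> \<partial>circle_m) + 1 / real (Suc j)" for j
  proof -
    have "(\<Sum>k\<in>A. (cmod (tcoeff (\<lambda>z. R z * exp (poly (p j) z)) k))\<^sup>2) \<le> (\<integral>\<xi>. (cmod (R \<xi> * exp (poly (p j) \<xi>)))\<^sup>2 \<partial>circle_m)"
      using U A by (intro Bessel_circle[of U] holomorphic_intros) auto
    also have "\<dots> = (\<integral>\<xi>. (cmod (R \<xi>))\<^sup>2 * exp (2 * Re (poly (p j) \<xi>)) \<partial>circle_m)"
      by (intro Bochner_Integration.integral_cong refl)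
         (simp add: norm_mult power_mult_distrib exp_double)
    finally show ?thesis using p(2)[of j] by simp
  qed
  have l1: "(\<lambda>j. \<Sum>k\<in>A. (cmod (tcoeff (\<lambda>z. R z * exp (poly (p j) z)) k))\<^sup>2) \<longlonglongrightarrow> (\<Sum>k\<in>A. (cmod (tcoeff (\<lambda>z. R z * outer_fun w z) k))\<^sup>2)"
    by (intro tendsto_intros conv)
  have l2: "(\<lambda>j. (\<integral>\<xi>. (cmod (R \<xi>))\<^sup>2 * w \<xi> \<partial>circle_m) + 1 / real (Suc j)) \<longlonglongrightarrow> (\<integral>\<xi>. (cmod (R \<xi>))\<^sup>2 * w \<xi> \<partial>circle_m) + 0"
    by (intro tendsto_add tendsto_const lim_1_over_n[THEN LIMSEQ_Suc])
  have "(\<Sum>k\<in>A. (cmod (tcoeff (\<lambda>z. R z * outer_fun w z) k))\<^sup>2) \<le> (\<integral>\<xi>. (cmod (R \<xi>))\<^sup>2 * w \<xi> \<partial>circle_m) + 0"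
    by (rule LIMSEQ_le[OF l1 l2]) (use le in blast)
  then show ?thesis by simp
qed

end

section \<open>Szego's theorem\<close>

lemma circle_measure_exp_measure:
  assumes \<mu>: "circle_measure \<mu>" and g: "continuous_on (sphere 0 1) g"
  shows "circle_measure (exp_measure g \<mu>)"
proof -
  have sets: "sets \<mu> = sets circle_borel" using \<mu> by (simp add: circle_measure_def)
  note sets[measurable_cong]
  have [measurable]: "g \<in> borel_measurable circle_borel"
    using g by (intro borel_measurable_circle_continuous) auto
  have i: "integrable \<mu> (\<lambda>\<xi>. exp (g \<xi>))"
    using g \<mu> by (intro integrable_circle_continuous continuous_intros) auto
  have "emeasure (exp_measure g \<mu>) (space (exp_measure g \<mu>)) = (\<integral>\<^sup>+\<xi>. ennreal (exp (g \<xi>)) * indicator (space \<mu>) \<xi> \<partial>\<mu>)"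
    unfolding exp_measure_def by (subst emeasure_density) auto
  also have "\<dots> = (\<integral>\<^sup>+\<xi>. ennreal (exp (g \<xi>)) \<partial>\<mu>)"
    by (intro nn_integral_cong) auto
  also have "\<dots> \<noteq> \<infinity>" using i by (simp add: nn_integral_eq_integral)
  finally show ?thesis
    using sets unfolding circle_measure_def exp_measure_def by (auto intro!: finite_measureI)
qed

context
  fixes \<mu> \<mu>s :: "complex measure" and w :: "complex \<Rightarrow> real"
  assumes \<mu>: "circle_measure \<mu>" and dec: "lebesgue_decomp \<mu> w \<mu>s"
begin

lemma lebesgue_decomp_sets: "sets \<mu> = sets circle_borel" "sets \<mu>s = sets circle_borel"
  "circle_measure \<mu>s" "w \<in> borel_measurable circle_m" "AE \<xi> in circle_m. 0 \<le> w \<xi>"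
  using \<mu> dec by (auto simp: lebesgue_decomp_def circle_measure_def)

text \<open>The decomposition is given for sets; it passes to simple functions and then to monotone
  limits.\<close>

lemma lebesgue_decomp_nn_integral:
  assumes "f \<in> borel_measurable circle_borel"
  shows "(\<integral>\<^sup>+\<xi>. f \<xi> \<partial>\<mu>) = (\<integral>\<^sup>+\<xi>. ennreal (w \<xi>) * f \<xi> \<partial>circle_m) + (\<integral>\<^sup>+\<xi>. f \<xi> \<partial>\<mu>s)"
proof -
  note lebesgue_decomp_sets(1,2)[measurable_cong] lebesgue_decomp_sets(4)[measurable]
  have sp: "space \<mu> = space circle_borel" "space \<mu>s = space circle_borel" "space circle_m = space circle_borel"
    using lebesgue_decomp_sets by (simp_all add: space_circle_measure)
  show ?thesis
    using assms
  proof (induction rule: borel_measurable_induct)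
    case (cong f g)
    have "nn_integral M f = nn_integral M g" if "space M = space circle_borel" for M
      using cong(3) that by (intro nn_integral_cong) auto
    moreover have "(\<integral>\<^sup>+\<xi>. ennreal (w \<xi>) * f \<xi> \<partial>circle_m) = (\<integral>\<^sup>+\<xi>. ennreal (w \<xi>) * g \<xi> \<partial>circle_m)"
      using cong(3) sp by (intro nn_integral_cong) auto
    ultimately show ?case using cong(4) sp by simp
  next
    case (set A)
    then show ?case
      using dec lebesgue_decomp_sets(1,2) by (simp add: lebesgue_decomp_def)
  next
    case (mult u c)
    note mult(2)[measurable]
    have "(\<integral>\<^sup>+\<xi>. ennreal (w \<xi>) * (c * u \<xi>) \<partial>circle_m) = c * (\<integral>\<^sup>+\<xi>. ennreal (w \<xi>) * u \<xi> \<partial>circle_m)"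
      by (subst nn_integral_cmult[symmetric]) (auto simp: mult_ac)
    then show ?case
      using mult by (simp add: nn_integral_cmult distrib_left)
  next
    case (add u v)
    note add(1,4)[measurable]
    show ?case
      using add by (simp add: nn_integral_add distrib_left add_ac)
  next
    case (seq U)
    note seq(1)[measurable]
    have inc: "incseq (\<lambda>i x. ennreal (w x) * U i x)"
      using seq(3) by (auto simp: incseq_def le_fun_def intro!: mult_left_mono)
    have sup: "(SUP i. U i) = (\<lambda>x. SUP i. U i x)" by (simp add: image_comp fun_eq_iff)
    have 1: "(\<integral>\<^sup>+\<xi>. (SUP i. U i) \<xi> \<partial>\<mu>) = (SUP i. \<integral>\<^sup>+\<xi>. U i \<xi> \<partial>\<mu>)"
      unfolding sup using seq(3) by (intro nn_integral_monotone_convergence_SUP) auto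
    have 2: "(\<integral>\<^sup>+\<xi>. (SUP i. U i) \<xi> \<partial>\<mu>s) = (SUP i. \<integral>\<^sup>+\<xi>. U i \<xi> \<partial>\<mu>s)"
      unfolding sup using seq(3) by (intro nn_integral_monotone_convergence_SUP) auto
    have 3: "(\<integral>\<^sup>+\<xi>. ennreal (w \<xi>) * (SUP i. U i) \<xi> \<partial>circle_m) = (SUP i. \<integral>\<^sup>+\<xi>. ennreal (w \<xi>) * U i \<xi> \<partial>circle_m)"
      unfolding sup SUP_mult_left_ennreal using inc by (intro nn_integral_monotone_convergence_SUP) auto
    show ?case
      unfolding 1 2 3 seq.IH
      by (rule ennreal_SUP_add) (use seq(3) inc in \<open>auto simp: incseq_def le_fun_def intro!: nn_integral_mono\<close>)
  qed
qed

lemma lebesgue_decomp_integrable: "integrable circle_m w"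
proof (rule integrableI_nonneg)
  interpret finite_measure \<mu> using \<mu> by (simp add: circle_measure_def)
  have "(\<integral>\<^sup>+\<xi>. ennreal (w \<xi>) \<partial>circle_m) \<le> (\<integral>\<^sup>+\<xi>. 1 \<partial>\<mu>)"
    by (subst lebesgue_decomp_nn_integral) auto
  also have "\<dots> < \<infinity>" by (simp add: emeasure_eq_measure)
  finally show "(\<integral>\<^sup>+\<xi>. ennreal (w \<xi>) \<partial>circle_m) < \<infinity>" .
qed (use lebesgue_decomp_sets in auto)

lemma lebesgue_decomp_integral:
  assumes f: "f \<in> borel_measurable circle_borel"
    and B: "\<And>\<xi>. \<xi> \<in> sphere 0 1 \<Longrightarrow> 0 \<le> f \<xi>" "\<And>\<xi>. \<xi> \<in> sphere 0 1 \<Longrightarrow> f \<xi> \<le> B"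
  shows "integrable \<mu> f" "integrable \<mu>s f" "integrable circle_m (\<lambda>\<xi>. f \<xi> * w \<xi>)"
    "(\<integral>\<xi>. f \<xi> \<partial>\<mu>) = (\<integral>\<xi>. f \<xi> * w \<xi> \<partial>circle_m) + (\<integral>\<xi>. f \<xi> \<partial>\<mu>s)"
proof -
  note lebesgue_decomp_sets(1,2)[measurable_cong] lebesgue_decomp_sets(4)[measurable] f[measurable]
  have fin: "finite_measure \<mu>" "finite_measure \<mu>s"
    using \<mu> lebesgue_decomp_sets(3) by (auto simp: circle_measure_def)
  have sp: "space \<mu> = sphere 0 1" "space \<mu>s = sphere 0 1"
    using lebesgue_decomp_sets by (simp_all add: space_circle_measure)
  show i: "integrable \<mu> f" "integrable \<mu>s f"
    using B sp by (auto intro!: finite_measure.integrable_const_bound[OF fin(1), of _ B]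
       finite_measure.integrable_const_bound[OF fin(2), of _ B])
  show i3: "integrable circle_m (\<lambda>\<xi>. f \<xi> * w \<xi>)"
  proof (rule Bochner_Integration.integrable_bound[of _ "\<lambda>\<xi>. B * w \<xi>"])
    show "integrable circle_m (\<lambda>\<xi>. B * w \<xi>)" using lebesgue_decomp_integrable by simp
    show "AE \<xi> in circle_m. norm (f \<xi> * w \<xi>) \<le> norm (B * w \<xi>)"
    proof (intro AE_I2)
      fix \<xi> assume "\<xi> \<in> space circle_m"
      then have "0 \<le> f \<xi>" "f \<xi> \<le> B" using B by auto
      then show "norm (f \<xi> * w \<xi>) \<le> norm (B * w \<xi>)"
        unfolding norm_mult by (intro mult_right_mono) auto
    qed
  qed measurable
  have nn: "(\<integral>\<^sup>+\<xi>. ennreal (f \<xi> * w \<xi>) \<partial>circle_m) = (\<integral>\<^sup>+\<xi>. ennreal (w \<xi>) * ennreal (f \<xi>) \<partial>circle_m)"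
    using lebesgue_decomp_sets(5) AE_space
    by (intro nn_integral_cong_AE, eventually_elim) (use B in \<open>auto simp: ennreal_mult mult.commute\<close>)
  have nonneg: "AE \<xi> in circle_m. 0 \<le> f \<xi> * w \<xi>"
    using lebesgue_decomp_sets(5) AE_space by eventually_elim (use B in auto)
  have "ennreal (\<integral>\<xi>. f \<xi> \<partial>\<mu>) = (\<integral>\<^sup>+\<xi>. ennreal (f \<xi>) \<partial>\<mu>)"
    using B sp i by (intro nn_integral_eq_integral[symmetric]) auto
  also have "\<dots> = (\<integral>\<^sup>+\<xi>. ennreal (f \<xi> * w \<xi>) \<partial>circle_m) + (\<integral>\<^sup>+\<xi>. ennreal (f \<xi>) \<partial>\<mu>s)"
    unfolding nn by (rule lebesgue_decomp_nn_integral) measurable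
  also have "\<dots> = ennreal (\<integral>\<xi>. f \<xi> * w \<xi> \<partial>circle_m) + ennreal (\<integral>\<xi>. f \<xi> \<partial>\<mu>s)"
  proof -
    have "AE \<xi> in \<mu>s. 0 \<le> f \<xi>" using B(1) sp by (intro AE_I2) auto
    then show ?thesis by (simp add: nn_integral_eq_integral[OF i3 nonneg] nn_integral_eq_integral[OF i(2)])
  qed
  also have "\<dots> = ennreal ((\<integral>\<xi>. f \<xi> * w \<xi> \<partial>circle_m) + (\<integral>\<xi>. f \<xi> \<partial>\<mu>s))"
    using B sp nonneg by (intro ennreal_plus[symmetric] integral_nonneg_AE) auto
  finally show "(\<integral>\<xi>. f \<xi> \<partial>\<mu>) = (\<integral>\<xi>. f \<xi> * w \<xi> \<partial>circle_m) + (\<integral>\<xi>. f \<xi> \<partial>\<mu>s)"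
    using B sp nonneg by (subst (asm) ennreal_inj) (auto intro!: integral_nonneg_AE add_nonneg_nonneg)
qed

text \<open>The weight multiplies both parts, and the null set that separates them stays the same.
  Together with \<open>szego_eq\<close> this identifies the Szego function of the weighted measure
  with an \<open>outer_fun\<close>.\<close>

lemma lebesgue_decomp_exp_measure:
  assumes g: "continuous_on (sphere 0 1) g"
  shows "lebesgue_decomp (exp_measure g \<mu>) (\<lambda>\<xi>. exp (g \<xi>) * w \<xi>) (exp_measure g \<mu>s)"
proof -
  note lebesgue_decomp_sets(1,2)[measurable_cong] lebesgue_decomp_sets(4)[measurable]
  have gm[measurable]: "g \<in> borel_measurable circle_borel"
    using g by (intro borel_measurable_circle_continuous) auto
  obtain S where S: "S \<in> sets \<mu>s" "S \<in> sets circle_m" "emeasure \<mu>s S = 0" "emeasure circle_m (space circle_m - S) = 0"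
    using dec by (auto simp: lebesgue_decomp_def mutually_singular_def)
  have "emeasure (exp_measure g \<mu>s) S = (\<integral>\<^sup>+\<xi>. ennreal (exp (g \<xi>)) * indicator S \<xi> \<partial>\<mu>s)"
    unfolding exp_measure_def using S by (subst emeasure_density) auto
  also have "\<dots> = 0"
    using S by (intro nn_integral_null_set) auto
  finally have sing: "mutually_singular (exp_measure g \<mu>s) circle_m"
    unfolding mutually_singular_def using S by (intro exI[of _ S]) (auto simp: exp_measure_def)
  have em: "emeasure (exp_measure g \<mu>) A =
     (\<integral>\<^sup>+\<xi>\<in>A. ennreal (exp (g \<xi>) * w \<xi>) \<partial>circle_m) + emeasure (exp_measure g \<mu>s) A"
    if A: "A \<in> sets circle_borel" for A
  proof -
    note A[measurable]
    have "emeasure (exp_measure g \<mu>) A = (\<integral>\<^sup>+\<xi>. ennreal (exp (g \<xi>)) * indicator A \<xi> \<partial>\<mu>)"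
      unfolding exp_measure_def by (subst emeasure_density) auto
    also have "\<dots> = (\<integral>\<^sup>+\<xi>. ennreal (w \<xi>) * (ennreal (exp (g \<xi>)) * indicator A \<xi>) \<partial>circle_m) + (\<integral>\<^sup>+\<xi>. ennreal (exp (g \<xi>)) * indicator A \<xi> \<partial>\<mu>s)"
      by (rule lebesgue_decomp_nn_integral) measurable
    also have "(\<integral>\<^sup>+\<xi>. ennreal (w \<xi>) * (ennreal (exp (g \<xi>)) * indicator A \<xi>) \<partial>circle_m) = (\<integral>\<^sup>+\<xi>\<in>A. ennreal (exp (g \<xi>) * w \<xi>) \<partial>circle_m)"
      using lebesgue_decomp_sets(5)
      by (intro nn_integral_cong_AE, eventually_elim) (auto simp: ennreal_mult mult_ac)
    also have "(\<integral>\<^sup>+\<xi>. ennreal (exp (g \<xi>)) * indicator A \<xi> \<partial>\<mu>s) = emeasure (exp_measure g \<mu>s) A"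
      unfolding exp_measure_def by (subst emeasure_density) auto
    finally show ?thesis .
  qed
  have "AE \<xi> in circle_m. 0 \<le> exp (g \<xi>) * w \<xi>"
    using lebesgue_decomp_sets(5) by eventually_elim auto
  then show ?thesis
    unfolding lebesgue_decomp_def
    using circle_measure_exp_measure[OF lebesgue_decomp_sets(3) g] sing em by auto
qed

end

lemma log_integrable_exp_mult:
  assumes g: "continuous_on (sphere 0 1) g" and w: "log_integrable w"
    and wm: "w \<in> borel_measurable circle_m"
  shows "log_integrable (\<lambda>\<xi>. exp (g \<xi>) * w \<xi>)"
    and "(\<integral>\<xi>. ln (exp (g \<xi>) * w \<xi>) \<partial>circle_m) = (\<integral>\<xi>. g \<xi> \<partial>circle_m) + (\<integral>\<xi>. ln (w \<xi>) \<partial>circle_m)"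
proof -
  have gi: "integrable circle_m g" using g by (rule integrable_circle_continuous[OF circle_measure_circle_m])
  have w0: "AE \<xi> in circle_m. 0 < w \<xi>" and lw: "integrable circle_m (\<lambda>\<xi>. ln (w \<xi>))"
    using w by (auto simp: log_integrable_def)
  have eq: "AE \<xi> in circle_m. g \<xi> + ln (w \<xi>) = ln (exp (g \<xi>) * w \<xi>)"
    using w0 by eventually_elim (simp add: ln_mult)
  have i: "integrable circle_m (\<lambda>\<xi>. g \<xi> + ln (w \<xi>))" using gi lw by simp
  have m: "(\<lambda>\<xi>. ln (exp (g \<xi>) * w \<xi>)) \<in> borel_measurable circle_m"
    using gi wm by auto
  show "log_integrable (\<lambda>\<xi>. exp (g \<xi>) * w \<xi>)"
    unfolding log_integrable_def using w0 integrable_cong_AE[OF _ m eq] i by auto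
  show "(\<integral>\<xi>. ln (exp (g \<xi>) * w \<xi>) \<partial>circle_m) = (\<integral>\<xi>. g \<xi> \<partial>circle_m) + (\<integral>\<xi>. ln (w \<xi>) \<partial>circle_m)"
    using integral_cong_AE[OF _ m eq] gi lw by simp
qed

section \<open>Near-extremal polynomials for the minimum problem\<close>

lemma exp_poly_approx:
  fixes p :: "complex poly"
  assumes "0 < e"
  shows "\<exists>Q. \<forall>z\<in>cball 0 1. cmod (exp (poly p z) - poly Q z) < e"
proof -
  have "compact (poly p ` cball 0 1)" by (intro compact_continuous_image continuous_intros) auto
  then obtain C where C: "0 < C" "\<And>z. z \<in> cball 0 1 \<Longrightarrow> cmod (poly p z) \<le> C"
    by (metis bounded_pos compact_imp_bounded image_eqI)
  \<comment> \<open>This is the Taylor remainder of exp on the disk of radius C that contains the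
    values of \<open>p\<close>.\<close>
  have "(\<lambda>n. (exp C * C) * (C ^ n / fact n)) \<longlonglongrightarrow> (exp C * C) * 0"
  proof (intro tendsto_intros)
    show "(\<lambda>n. C ^ n / fact n) \<longlonglongrightarrow> 0"
      using summable_exp[of C] by (intro summable_LIMSEQ_zero) (simp add: field_simps)
  qed
  then have "\<forall>\<^sub>F n in sequentially. (exp C * C) * (C ^ n / fact n) < e"
    using assms by (intro order_tendstoD) auto
  then obtain n where n: "(exp C * C) * (C ^ n / fact n) < e"
    by (auto simp: eventually_sequentially)
  define Q where "Q = (\<Sum>k\<le>n. smult (1 / fact k) (p ^ k))"
  have "cmod (exp (poly p z) - poly Q z) < e" if z: "z \<in> cball 0 1" for z
  proof -
    have "poly Q z = (\<Sum>k\<le>n. poly p z ^ k / fact k)"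
      by (simp add: Q_def poly_sum)
    then have "cmod (exp (poly p z) - poly Q z) \<le> exp \<bar>Re (poly p z)\<bar> * cmod (poly p z) ^ Suc n / fact n"
      using Taylor_exp[of "poly p z" n] by simp
    also have "\<dots> \<le> exp C * C ^ Suc n / fact n"
      using C(2)[OF z] abs_Re_le_cmod[of "poly p z"]
      by (intro divide_right_mono mult_mono power_mono) auto
    also have "\<dots> < e" using n by (simp add: mult_ac)
    finally show ?thesis .
  qed
  then show ?thesis by blast
qed

text \<open>One approximation in L^1 of the larger measure is an approximation for both measures at
  once. The supremum is finite since it is at most the sum.\<close>

lemma circle_measure_upper_bound:
  assumes "circle_measure M" "circle_measure N"
  obtains L where "circle_measure L" "M \<le> L" "N \<le> L"
proof
  let ?L = "sup_measure' M N"
  have s: "sets N = sets M" "sets M = sets circle_borel"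
    using assms by (auto simp: circle_measure_def)
  have sp: "space ?L = space M" using s by (intro sets_eq_imp_space_eq) auto
  have "emeasure ?L (space M) \<le> emeasure M (space M) + emeasure N (space M)"
    using s(1) emeasure_space[of N] emeasure_space[of M] sets_eq_imp_space_eq[OF s(1)]
    by (subst emeasure_sup_measure') (auto intro!: SUP_least add_mono)
  also have "\<dots> < \<infinity>"
    using assms sets_eq_imp_space_eq[OF s(1)] by (auto simp: circle_measure_def finite_measure.emeasure_eq_measure)
  finally show "circle_measure ?L"
    using s sp by (auto simp: circle_measure_def intro!: finite_measureI)
  show "M \<le> ?L" "N \<le> ?L"
    using s by (auto simp: le_measure intro: le_emeasure_sup_measure'1 le_emeasure_sup_measure'2)
qed

lemma integral_mono_measure:
  fixes f :: "'a \<Rightarrow> real"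
  assumes MN: "sets M = sets N" "M \<le> N" and f: "integrable N f" "\<And>x. 0 \<le> f x"
  shows "integrable M f" "(\<integral>x. f x \<partial>M) \<le> (\<integral>x. f x \<partial>N)"
proof -
  have [measurable]: "f \<in> borel_measurable M" using f MN measurable_cong_sets by blast
  have le: "(\<integral>\<^sup>+x. ennreal (f x) \<partial>M) \<le> (\<integral>\<^sup>+x. ennreal (f x) \<partial>N)"
    using MN by (rule nn_integral_mono_measure)
  also have "\<dots> = ennreal (\<integral>x. f x \<partial>N)" using f by (simp add: nn_integral_eq_integral)
  finally have le': "(\<integral>\<^sup>+x. ennreal (f x) \<partial>M) \<le> ennreal (\<integral>x. f x \<partial>N)" .
  then show i: "integrable M f"
    using f(2) by (intro integrableI_nonneg) (auto simp: le_less_trans)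
  show "(\<integral>x. f x \<partial>M) \<le> (\<integral>x. f x \<partial>N)"
    using le' f i by (simp add: nn_integral_eq_integral integral_nonneg_AE)
qed

text \<open>The integrand tends to 1 pointwise. Where ln w <= n it is at most 1; elsewhere the
  truncated value n is nonnegative and the integrand is at most w. Hence 1 + w dominates.\<close>

lemma exp_neg_truncation:
  fixes w :: "'a \<Rightarrow> real"
  assumes M: "finite_measure M" and w: "integrable M w" and w0: "AE x in M. 0 < w x"
  shows "(\<lambda>n. \<integral>x. exp (- max (- real n) (min (real n) (ln (w x)))) * w x \<partial>M) \<longlonglongrightarrow> measure M (space M)"
proof -
  interpret finite_measure M by fact
  have [measurable]: "w \<in> borel_measurable M" using w by auto
  have "(\<lambda>n. \<integral>x. exp (- max (- real n) (min (real n) (ln (w x)))) * w x \<partial>M) \<longlonglongrightarrow> (\<integral>x. 1 \<partial>M)"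
  proof (rule integral_dominated_convergence[where w = "\<lambda>x. 1 + w x"])
    show "AE x in M. (\<lambda>n. exp (- max (- real n) (min (real n) (ln (w x)))) * w x) \<longlonglongrightarrow> 1"
      using w0
    proof eventually_elim
      case (elim x)
      obtain N :: nat where "\<bar>ln (w x)\<bar> \<le> real N" using real_arch_simple by blast
      then have "\<forall>\<^sub>F n in sequentially. exp (- max (- real n) (min (real n) (ln (w x)))) * w x = 1"
        unfolding eventually_sequentially
      proof (intro exI[of _ N] allI impI)
        fix n assume "\<bar>ln (w x)\<bar> \<le> real N" "N \<le> n"
        then have "max (- real n) (min (real n) (ln (w x))) = ln (w x)" by auto
        then show "exp (- max (- real n) (min (real n) (ln (w x)))) * w x = 1"
          using elim by (simp add: exp_minus)
      qed
      then show ?case by (rule tendsto_eventually)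
    qed
    show "AE x in M. norm (exp (- max (- real n) (min (real n) (ln (w x)))) * w x) \<le> 1 + w x" for n
      using w0
    proof eventually_elim
      case (elim x)
      let ?t = "max (- real n) (min (real n) (ln (w x)))"
      have "exp (- ?t) * w x = exp (ln (w x) - ?t)" using elim by (simp add: exp_diff exp_minus field_simps)
      also have "\<dots> \<le> 1 + w x"
      proof (cases "ln (w x) \<le> real n")
        case True
        then have "ln (w x) - ?t \<le> 0" by simp
        then have "exp (ln (w x) - ?t) \<le> 1" by (rule exp_le_one_iff[THEN iffD2])
        then show ?thesis using elim by linarith
      next
        case False
        then have "ln (w x) - ?t \<le> ln (w x)" by simp
        then have "exp (ln (w x) - ?t) \<le> exp (ln (w x))" by (rule exp_le_cancel_iff[THEN iffD2])
        then show ?thesis using elim by simp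
      qed
      finally show ?case using elim by simp
    qed
  qed (use w in auto)
  then show ?thesis by simp
qed

text \<open>Without a singular part the ideal choice is 1 / D, with |1 / D|^2 w = 1 and value exp(-I
  / 2) at 0, where I is the integral of ln w. It is imitated by exp(p) with 2 Re p close to a
  function \<open>h\<close> in L^1 of both m and \<open>\<mu>\<close>: closeness in m controls Re
  p(0) by the mean value property, closeness in \<open>\<mu>\<close> controls the norm. A Taylor
  polynomial of exp then replaces exp(p).\<close>

lemma szego_minimum:
  assumes \<mu>: "circle_measure \<mu>" and dec: "lebesgue_decomp \<mu> w \<mu>s" and lw: "log_integrable w" and e: "0 < e" "e < 1"
  shows "\<exists>Q. (\<integral>\<xi>. (cmod (poly Q \<xi>))\<^sup>2 \<partial>\<mu>) \<le> 1 + e \<and>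
     1 - e \<le> cmod (poly Q 0) * exp (1/2 * (\<integral>\<xi>. ln (w \<xi>) \<partial>circle_m))"
proof -
  interpret m: prob_space circle_m by (rule prob_space_circle_m)
  note D = lebesgue_decomp_sets[OF \<mu> dec]
  have [simp]: "space \<mu> = sphere 0 1" "space \<mu>s = sphere 0 1"
    using D by (simp_all add: space_circle_measure)
  note D(1,2)[measurable_cong] D(4)[measurable]
  have w0: "AE \<xi> in circle_m. 0 < w \<xi>" and lwi: "integrable circle_m (\<lambda>\<xi>. ln (w \<xi>))"
    using lw by (auto simp: log_integrable_def)
  have wi: "integrable circle_m w" by (rule lebesgue_decomp_integrable[OF \<mu> dec])
  obtain S where S: "S \<in> sets \<mu>s" "S \<in> sets circle_m" "emeasure \<mu>s S = 0" "emeasure circle_m (space circle_m - S) = 0"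
    using dec by (auto simp: lebesgue_decomp_def mutually_singular_def)
  have Sm[measurable]: "S \<in> sets circle_borel" using S by simp
  have S1: "AE \<xi> in circle_m. \<xi> \<in> S"
    using S(4) sets.compl_sets[OF S(2)] by (intro AE_I[of _ _ "space circle_m - S"]) auto
  have S2: "AE \<xi> in \<mu>s. \<xi> \<notin> S"
    using S by (intro AE_I[of _ _ S]) auto
  define t where "t n \<xi> = max (- real n) (min (real n) (ln (w \<xi>)))" for n :: nat and \<xi>
  \<comment> \<open>\<open>h\<close> approximates \<open>- ln w\<close>, but is very negative on the null set that carries the singular part.\<close>
  define h where "h n \<xi> = (if \<xi> \<in> S then - t n \<xi> else - real n)" for n :: nat and \<xi>
  have tm[measurable]: "t n \<in> borel_measurable circle_borel" for n
    unfolding t_def by measurable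
  have hm[measurable]: "h n \<in> borel_measurable circle_borel" for n
    unfolding h_def by measurable
  have hb: "\<bar>h n \<xi>\<bar> \<le> real n" for n \<xi> by (auto simp: h_def t_def)
  have int_exp_h: "(\<integral>\<xi>. exp (h n \<xi>) \<partial>\<mu>) = (\<integral>\<xi>. exp (- t n \<xi>) * w \<xi> \<partial>circle_m) + exp (- real n) * measure \<mu>s (space \<mu>s)" for n
  proof -
    have "(\<integral>\<xi>. exp (h n \<xi>) \<partial>\<mu>) = (\<integral>\<xi>. exp (h n \<xi>) * w \<xi> \<partial>circle_m) + (\<integral>\<xi>. exp (h n \<xi>) \<partial>\<mu>s)"
      using hb[of n] by (intro lebesgue_decomp_integral(4)[OF \<mu> dec, of _ "exp (real n)"]) (auto simp: abs_le_iff)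
    also have "(\<integral>\<xi>. exp (h n \<xi>) * w \<xi> \<partial>circle_m) = (\<integral>\<xi>. exp (- t n \<xi>) * w \<xi> \<partial>circle_m)"
      by (rule integral_cong_AE) (use S1 in \<open>auto simp: h_def\<close>)
    also have "(\<integral>\<xi>. exp (h n \<xi>) \<partial>\<mu>s) = (\<integral>\<xi>. exp (- real n) \<partial>\<mu>s)"
      by (rule integral_cong_AE) (use S2 in \<open>auto simp: h_def\<close>)
    finally show ?thesis by (simp add: mult.commute)
  qed
  have lim1: "(\<lambda>n. \<integral>\<xi>. exp (h n \<xi>) \<partial>\<mu>) \<longlonglongrightarrow> 1 + 0 * measure \<mu>s (space \<mu>s)"
    unfolding int_exp_h
    using exp_neg_truncation[OF m.finite_measure_axioms wi w0]
    by (intro tendsto_intros filterlim_compose[OF exp_at_bot] filterlim_compose[OF filterlim_uminus_at_bot_at_top]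
       filterlim_real_sequentially) (simp add: t_def[abs_def] m.prob_space[unfolded space_circle_m])
  \<comment> \<open>The errors add up to 3 d in the norm and to 2 d in the value at 0.\<close>
  define d where "d = e / 8"
  have d: "0 < d" using e by (simp add: d_def)
  have "\<forall>\<^sub>F n in sequentially. (\<integral>\<xi>. exp (h n \<xi>) \<partial>\<mu>) < 1 + d"
    using lim1 d by (intro order_tendstoD) auto
  moreover have "\<forall>\<^sub>F n in sequentially. (\<integral>\<xi>. \<bar>ln (w \<xi>) - t n \<xi>\<bar> \<partial>circle_m) < d"
    unfolding t_def using truncation_L1[OF lwi] d by (intro order_tendstoD) auto
  ultimately have "\<forall>\<^sub>F n in sequentially. (\<integral>\<xi>. exp (h n \<xi>) \<partial>\<mu>) < 1 + d \<and> (\<integral>\<xi>. \<bar>ln (w \<xi>) - t n \<xi>\<bar> \<partial>circle_m) < d"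
    by (rule eventually_conj)
  then obtain n where n: "(\<integral>\<xi>. exp (h n \<xi>) \<partial>\<mu>) < 1 + d" "(\<integral>\<xi>. \<bar>ln (w \<xi>) - t n \<xi>\<bar> \<partial>circle_m) < d"
    by (auto simp: eventually_sequentially)
  obtain L where L: "circle_measure L" "circle_m \<le> L" "\<mu> \<le> L"
    using circle_measure_upper_bound[OF circle_measure_circle_m \<mu>] .
  have sL: "sets circle_m = sets L" "sets \<mu> = sets L" using L(1) D by (auto simp: circle_measure_def)
  \<comment> \<open>Both \<open>h n\<close> and 2 Re p stay below n + 2, where exp has Lipschitz
    constant exp(n + 2); an L^1 error of 2 d' therefore costs d after exponentiation.\<close>
  define d' where "d' = d / (2 * exp (real n + 2))"
  have d': "0 < d'" "exp (real n + 2) * (2 * d') = d" "2 * d' \<le> d" using d by (auto simp: d'_def field_simps)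
  obtain p where p: "Im (poly p 0) = 0" "\<And>\<xi>. \<xi> \<in> sphere 0 1 \<Longrightarrow> \<bar>Re (poly p \<xi>)\<bar> \<le> real n / 2 + 1"
    "(\<integral>\<xi>. \<bar>h n \<xi> / 2 - Re (poly p \<xi>)\<bar> \<partial>L) < d'"
  proof -
    have "(\<lambda>\<xi>. h n \<xi> / 2) \<in> borel_measurable L"
      using hm[of n] sL measurable_cong_sets[of L circle_borel] by simp
    then show thesis
      using circle_Re_poly_approx[OF L(1), of "\<lambda>\<xi>. h n \<xi> / 2" "real n / 2" d'] hb d'(1) that by auto
  qed
  have pi: "integrable M (\<lambda>\<xi>. Re (poly p \<xi>))" if "circle_measure M" for M
    by (intro integrable_circle_continuous that continuous_intros)
  have hi: "integrable M (h n)" if "circle_measure M" for M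
  proof -
    interpret finite_measure M using that by (simp add: circle_measure_def)
    have "sets M = sets circle_borel" using that by (simp add: circle_measure_def)
    note this[measurable_cong]
    show ?thesis by (rule integrable_const_bound[of _ "real n"]) (use hb in auto)
  qed
  have close: "(\<integral>\<xi>. \<bar>h n \<xi> - 2 * Re (poly p \<xi>)\<bar> \<partial>M) < 2 * d'" if "sets M = sets L" "M \<le> L" for M
  proof -
    have "(\<integral>\<xi>. \<bar>h n \<xi> - 2 * Re (poly p \<xi>)\<bar> \<partial>M) \<le> (\<integral>\<xi>. \<bar>h n \<xi> - 2 * Re (poly p \<xi>)\<bar> \<partial>L)"
      using hi[OF L(1)] pi[OF L(1)] by (intro integral_mono_measure(2)[OF that]) auto
    also have "\<dots> = (\<integral>\<xi>. 2 * \<bar>h n \<xi> / 2 - Re (poly p \<xi>)\<bar> \<partial>L)"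
      by (intro Bochner_Integration.integral_cong refl) (simp add: abs_if field_simps)
    also have "\<dots> < 2 * d'" using p(3) by simp
    finally show ?thesis .
  qed
  define I where "I = (\<integral>\<xi>. ln (w \<xi>) \<partial>circle_m)"
  \<comment> \<open>On \<open>S\<close>, hence m-almost everywhere, \<open>h n\<close> is the
    negative of \<open>t n\<close>, so 2 Re p + ln w = (2 Re p - h) + (ln w - t), and each
    difference has L^1 norm below d.\<close>
  have p0: "- 2 * d \<le> 2 * Re (poly p 0) + I"
  proof -
    have "(\<integral>\<xi>. Re (poly p \<xi>) \<partial>circle_m) = Re (poly p 0)"
      using integral_circle_mean_value[of UNIV "poly p"]
      by (subst integral_Re)
         (simp_all add: holomorphic_intros integrable_circle_continuous circle_measure_circle_m continuous_intros)
    then have "2 * Re (poly p 0) + I = (\<integral>\<xi>. 2 * Re (poly p \<xi>) + ln (w \<xi>) \<partial>circle_m)"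
      using pi[OF circle_measure_circle_m] lwi by (simp add: I_def)
    also have "\<dots> \<ge> (\<integral>\<xi>. - (\<bar>h n \<xi> - 2 * Re (poly p \<xi>)\<bar> + \<bar>ln (w \<xi>) - t n \<xi>\<bar>) \<partial>circle_m)"
    proof (rule integral_mono_AE)
      have ti: "integrable circle_m (t n)"
        by (rule m.integrable_const_bound[of _ "real n"]) (auto simp: t_def)
      show "integrable circle_m (\<lambda>\<xi>. - (\<bar>h n \<xi> - 2 * Re (poly p \<xi>)\<bar> + \<bar>ln (w \<xi>) - t n \<xi>\<bar>))"
        using ti pi[OF circle_measure_circle_m] hi[OF circle_measure_circle_m] lwi by auto
      show "integrable circle_m (\<lambda>\<xi>. 2 * Re (poly p \<xi>) + ln (w \<xi>))"
        using pi[OF circle_measure_circle_m] lwi by auto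
      show "AE \<xi> in circle_m. - (\<bar>h n \<xi> - 2 * Re (poly p \<xi>)\<bar> + \<bar>ln (w \<xi>) - t n \<xi>\<bar>) \<le> 2 * Re (poly p \<xi>) + ln (w \<xi>)"
        using S1 by eventually_elim (auto simp: h_def)
    qed
    also (xtrans) have "(\<integral>\<xi>. - (\<bar>h n \<xi> - 2 * Re (poly p \<xi>)\<bar> + \<bar>ln (w \<xi>) - t n \<xi>\<bar>) \<partial>circle_m) =
        - ((\<integral>\<xi>. \<bar>h n \<xi> - 2 * Re (poly p \<xi>)\<bar> \<partial>circle_m) + (\<integral>\<xi>. \<bar>ln (w \<xi>) - t n \<xi>\<bar> \<partial>circle_m))"
    proof -
      have ti: "integrable circle_m (t n)"
        by (rule m.integrable_const_bound[of _ "real n"]) (auto simp: t_def)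
      show ?thesis
        using ti pi[OF circle_measure_circle_m] hi[OF circle_measure_circle_m] lwi by simp
    qed
    finally show ?thesis using close[OF sL(1) L(2)] n(2) d'(3) by simp
  qed
  have e2p: "(\<integral>\<xi>. exp (2 * Re (poly p \<xi>)) \<partial>\<mu>) \<le> 1 + 2 * d"
  proof -
    have eh: "integrable \<mu> (\<lambda>\<xi>. exp (h n \<xi>))"
      using hb[of n] by (intro lebesgue_decomp_integral(1)[OF \<mu> dec, of _ "exp (real n)"]) (auto simp: abs_le_iff)
    have "(\<integral>\<xi>. exp (2 * Re (poly p \<xi>)) \<partial>\<mu>) \<le> (\<integral>\<xi>. exp (h n \<xi>) + exp (real n + 2) * \<bar>h n \<xi> - 2 * Re (poly p \<xi>)\<bar> \<partial>\<mu>)"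
    proof (rule integral_mono)
      show "integrable \<mu> (\<lambda>\<xi>. exp (2 * Re (poly p \<xi>)))"
        by (intro integrable_circle_continuous \<mu> continuous_intros)
      show "integrable \<mu> (\<lambda>\<xi>. exp (h n \<xi>) + exp (real n + 2) * \<bar>h n \<xi> - 2 * Re (poly p \<xi>)\<bar>)"
        using eh hi[OF \<mu>] pi[OF \<mu>] by auto
      fix \<xi> assume "\<xi> \<in> space \<mu>"
      then have "h n \<xi> \<le> real n + 2" "2 * Re (poly p \<xi>) \<le> real n + 2"
        using hb[of n \<xi>] p(2)[of \<xi>] by (auto simp: abs_le_iff)
      from exp_Lipschitz[OF this] show "exp (2 * Re (poly p \<xi>)) \<le> exp (h n \<xi>) + exp (real n + 2) * \<bar>h n \<xi> - 2 * Re (poly p \<xi>)\<bar>"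
        by linarith
    qed
    also have "\<dots> = (\<integral>\<xi>. exp (h n \<xi>) \<partial>\<mu>) + exp (real n + 2) * (\<integral>\<xi>. \<bar>h n \<xi> - 2 * Re (poly p \<xi>)\<bar> \<partial>\<mu>)"
      using eh hi[OF \<mu>] pi[OF \<mu>] by simp
    also have "\<dots> \<le> (1 + d) + exp (real n + 2) * (2 * d')"
      using n(1) close[OF sL(2) L(3)] by (intro add_mono mult_left_mono) auto
    finally show ?thesis using d'(2) by simp
  qed
  define K where "K = exp (real n / 2 + 1)"
  have K: "0 < K" by (simp add: K_def)
  define V where "V = measure \<mu> (space \<mu>)"
  have V: "0 \<le> V" by (simp add: V_def)
  \<comment> \<open>\<open>y\<close> is the uniform error allowed for Q against exp(p). The bound 1
    linearizes the square of |exp(p)| + y; the other two alternatives keep the loss at 0, after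
    scaling by exp(I / 2), and the gain in the norm below d.\<close>
  define y where "y = min (min 1 (d * exp (- I / 2))) (d / ((2 * K + 1) * (V + 1)))"
  have y: "0 < y" "y \<le> 1" "y * exp (I / 2) \<le> d" "y * ((2 * K + 1) * V) \<le> d"
  proof -
    have pos: "0 < (2 * K + 1) * (V + 1)" using K V by (intro mult_pos_pos) auto
    then show "0 < y" using d by (auto simp: y_def)
    show "y \<le> 1" by (simp add: y_def)
    have "y \<le> d * exp (- I / 2)" by (simp add: y_def)
    then have "y * exp (I / 2) \<le> d * exp (- I / 2) * exp (I / 2)" by (rule mult_right_mono) simp
    also have "\<dots> = d" by (simp add: exp_minus field_simps)
    finally show "y * exp (I / 2) \<le> d" .
    have "y * ((2 * K + 1) * V) \<le> y * ((2 * K + 1) * (V + 1))"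
      using \<open>0 < y\<close> K by (intro mult_left_mono) auto
    also have "\<dots> \<le> d / ((2 * K + 1) * (V + 1)) * ((2 * K + 1) * (V + 1))"
      using pos by (intro mult_right_mono) (auto simp: y_def)
    also have "\<dots> = d" using pos by (metis less_irrefl nonzero_eq_divide_eq)
    finally show "y * ((2 * K + 1) * V) \<le> d" .
  qed
  obtain Q where Q: "\<And>z. z \<in> cball 0 1 \<Longrightarrow> cmod (exp (poly p z) - poly Q z) < y"
    using exp_poly_approx[OF y(1), of p] by blast
  have "(\<integral>\<xi>. (cmod (poly Q \<xi>))\<^sup>2 \<partial>\<mu>) \<le> (\<integral>\<xi>. exp (2 * Re (poly p \<xi>)) + y * (2 * K + 1) \<partial>\<mu>)"
  proof (rule integral_mono)
    show "integrable \<mu> (\<lambda>\<xi>. (cmod (poly Q \<xi>))\<^sup>2)"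
      by (intro integrable_circle_continuous \<mu> continuous_intros)
    show "integrable \<mu> (\<lambda>\<xi>. exp (2 * Re (poly p \<xi>)) + y * (2 * K + 1))"
      by (intro integrable_circle_continuous \<mu> continuous_intros)
    fix \<xi> assume "\<xi> \<in> space \<mu>"
    then have \<xi>: "\<xi> \<in> sphere 0 1" "\<xi> \<in> cball 0 1" by auto
    let ?a = "exp (Re (poly p \<xi>))"
    have a: "0 < ?a" "?a \<le> K" using p(2)[OF \<xi>(1)] by (auto simp: K_def)
    have "cmod (poly Q \<xi>) \<le> cmod (exp (poly p \<xi>)) + cmod (exp (poly p \<xi>) - poly Q \<xi>)"
      using norm_triangle_sub[of "poly Q \<xi>" "exp (poly p \<xi>)"] by (simp add: norm_minus_commute)
    also have "\<dots> \<le> ?a + y" using Q[OF \<xi>(2)] by simp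
    finally have "(cmod (poly Q \<xi>))\<^sup>2 \<le> (?a + y)\<^sup>2" by (rule power_mono) simp
    also have "\<dots> = ?a\<^sup>2 + y * (2 * ?a + y)" by (simp add: power2_eq_square algebra_simps)
    also have "\<dots> \<le> ?a\<^sup>2 + y * (2 * K + 1)"
      using a y by (intro add_left_mono mult_left_mono) auto
    finally show "(cmod (poly Q \<xi>))\<^sup>2 \<le> exp (2 * Re (poly p \<xi>)) + y * (2 * K + 1)"
      by (simp add: exp_double)
  qed
  also have "\<dots> = (\<integral>\<xi>. exp (2 * Re (poly p \<xi>)) \<partial>\<mu>) + V * (y * (2 * K + 1))"
    by (subst Bochner_Integration.integral_add) (auto simp: V_def intro!: integrable_circle_continuous \<mu> continuous_intros)
  also have "\<dots> \<le> 1 + 3 * d" using e2p y(4) by (simp add: mult_ac)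
  also have "\<dots> \<le> 1 + e" using e by (simp add: d_def)
  finally have 1: "(\<integral>\<xi>. (cmod (poly Q \<xi>))\<^sup>2 \<partial>\<mu>) \<le> 1 + e" .
  have "1 - e \<le> (1 - d) - d" using e by (simp add: d_def)
  also have "\<dots> \<le> exp (Re (poly p 0)) * exp (I / 2) - y * exp (I / 2)"
  proof -
    have "1 - d \<le> exp (- d)" using exp_ge_add_one_self[of "- d"] by simp
    also have "\<dots> \<le> exp (Re (poly p 0) + I / 2)" using p0 by simp
    finally show ?thesis using y(3) by (simp add: exp_add)
  qed
  also have "\<dots> = (exp (Re (poly p 0)) - y) * exp (I / 2)" by (simp add: algebra_simps)
  also have "\<dots> \<le> cmod (poly Q 0) * exp (I / 2)"
  proof (rule mult_right_mono)
    have "cmod (exp (poly p 0)) \<le> cmod (poly Q 0) + cmod (exp (poly p 0) - poly Q 0)"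
      by (rule norm_triangle_sub)
    then show "exp (Re (poly p 0)) - y \<le> cmod (poly Q 0)" using Q[of 0] by simp
  qed simp
  finally show ?thesis using 1 by (intro exI[of _ Q]) (simp add: I_def)
qed

section \<open>Rational approximation with prescribed poles\<close>

lemma coeff_star_poly: "coeff (star_poly n p) k = (if k \<le> n then cnj (coeff p (n - k)) else 0)"
  by (simp add: star_poly_def coeff_sum)

lemma degree_star_poly_le: "degree (star_poly n p) \<le> n"
  by (rule degree_le) (simp add: coeff_star_poly)

lemma poly_star_poly_0: "poly (star_poly n p) 0 = cnj (coeff p n)"
  by (simp add: poly_0_coeff_0 coeff_star_poly)

lemma poly_star_poly_circle:
  assumes "degree p \<le> n" "cmod \<xi> = 1"
  shows "poly (star_poly n p) \<xi> = \<xi> ^ n * cnj (poly p \<xi>)"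
proof -
  have "\<xi> \<noteq> 0" using assms(2) by auto
  have "\<xi> * cnj \<xi> = 1" using assms(2) by (simp add: complex_norm_square[symmetric])
  then have "1 / cnj \<xi> = \<xi>" using \<open>\<xi> \<noteq> 0\<close> by (simp add: field_simps)
  then show ?thesis using poly_star_poly[OF assms(1) \<open>\<xi> \<noteq> 0\<close>] by simp
qed

lemma cmod_star_poly_circle:
  assumes "degree p \<le> n" "cmod \<xi> = 1"
  shows "cmod (poly (star_poly n p) \<xi>) = cmod (poly p \<xi>)"
  using poly_star_poly_circle[OF assms] assms(2) by (simp add: norm_mult norm_power)

lemma has_fps_expansion_poly:
  fixes p :: "complex poly"
  shows "poly p has_fps_expansion fps_of_poly p"
proof (induction p)
  case (pCons a p)
  have "(\<lambda>x. a + poly p x * x) has_fps_expansion fps_const a + fps_of_poly p * fps_X"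
    by (intro fps_expansion_intros pCons.IH)
  moreover have "poly (pCons a p) = (\<lambda>x. a + poly p x * x)" by (auto simp: mult.commute)
  ultimately show ?case by (simp only: fps_of_poly_pCons)
qed simp

text \<open>|1 - cnj b z|^2 - |z - b|^2 = (1 - |z|^2)(1 - |b|^2), which is at least (3/4)(1 - |b|)
  for |z| <= 1/2. Since |1 - cnj b z|^2 <= 4, the relative decrease is at least (3/16)(1 - |b|), and
  1 + x <= exp(x).\<close>

lemma Blaschke_factor_le:
  fixes b z :: complex
  assumes b: "cmod b < 1" and z: "cmod z \<le> 1/2"
  shows "(cmod (z - b))\<^sup>2 \<le> (cmod (1 - cnj b * z))\<^sup>2 * exp (- (3/16) * (1 - cmod b))"
proof -
  have "(cmod (1 - cnj b * z))\<^sup>2 - (cmod (z - b))\<^sup>2 = (1 - (cmod z)\<^sup>2) * (1 - (cmod b)\<^sup>2)"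
    by (simp only: cmod_power2) (simp add: power2_eq_square algebra_simps)
  also have "\<dots> \<ge> 3/4 * (1 - cmod b)"
  proof (rule mult_mono)
    have "(cmod z)\<^sup>2 \<le> (1/2)\<^sup>2" using z by (intro power_mono) auto
    then show "3/4 \<le> 1 - (cmod z)\<^sup>2" by (simp add: power2_eq_square)
    have "(cmod b)\<^sup>2 \<le> cmod b" using b by (simp add: power2_eq_square mult_left_le)
    then show "1 - cmod b \<le> 1 - (cmod b)\<^sup>2" by simp
    show "0 \<le> 1 - (cmod z)\<^sup>2" using \<open>3/4 \<le> 1 - (cmod z)\<^sup>2\<close> by simp
  qed (use b in auto)
  finally have 1: "(cmod (z - b))\<^sup>2 \<le> (cmod (1 - cnj b * z))\<^sup>2 - 3/4 * (1 - cmod b)" by linarith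
  have "cmod (1 - cnj b * z) \<le> 1 + cmod b * cmod z"
    using norm_triangle_ineq4[of 1 "cnj b * z"] by (simp add: norm_mult)
  also have "cmod b * cmod z \<le> 1 * 1" using b z by (intro mult_mono) auto
  finally have "(cmod (1 - cnj b * z))\<^sup>2 \<le> 2\<^sup>2" by (intro power_mono) auto
  then have "3/16 * (1 - cmod b) * (cmod (1 - cnj b * z))\<^sup>2 \<le> 3/16 * (1 - cmod b) * 4"
    using b by (intro mult_left_mono) auto
  moreover have "(cmod (1 - cnj b * z))\<^sup>2 * (1 + - (3/16) * (1 - cmod b)) =
      (cmod (1 - cnj b * z))\<^sup>2 - 3/16 * (1 - cmod b) * (cmod (1 - cnj b * z))\<^sup>2"
    by algebra
  ultimately have "(cmod (z - b))\<^sup>2 \<le> (cmod (1 - cnj b * z))\<^sup>2 * (1 + - (3/16) * (1 - cmod b))"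
    using 1 by linarith
  also have "\<dots> \<le> (cmod (1 - cnj b * z))\<^sup>2 * exp (- (3/16) * (1 - cmod b))"
    by (intro mult_left_mono exp_ge_add_one_self) auto
  finally show ?thesis .
qed

context
  fixes b :: "nat \<Rightarrow> complex" and n :: nat and W :: "complex poly"
  assumes W_def: "W = (\<Prod>j=1..n. [:- b j, 1:])" and b: "\<And>j. j \<in> {1..n} \<Longrightarrow> cmod (b j) < 1"
begin

lemma degree_zeros_poly: "degree W = n"
  unfolding W_def by (subst degree_prod_eq_sum_degree) auto

lemma coeff_zeros_poly: "coeff W n = 1"
proof -
  have "lead_coeff W = 1" unfolding W_def by (simp add: lead_coeff_prod)
  then show ?thesis by (simp add: degree_zeros_poly)
qed

lemma poly_star_zeros_poly: "poly (star_poly n W) z = (\<Prod>j=1..n. 1 - cnj (b j) * z)"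
proof (cases "z = 0")
  case True
  then show ?thesis by (simp add: poly_star_poly_0 coeff_zeros_poly)
next
  case False
  have "poly (star_poly n W) z = z ^ n * (\<Prod>j=1..n. 1 / z - cnj (b j))"
    using poly_star_poly[of W n z] False degree_zeros_poly by (simp add: W_def poly_prod)
  also have "\<dots> = (\<Prod>j=1..n. z * (1 / z - cnj (b j)))"
    by (simp add: prod.distrib)
  also have "\<dots> = (\<Prod>j=1..n. 1 - cnj (b j) * z)"
    using False by (intro prod.cong) (auto simp: algebra_simps)
  finally show ?thesis .
qed

lemma star_zeros_poly_nonzero:
  assumes "cmod z \<le> 1" shows "poly (star_poly n W) z \<noteq> 0"
proof -
  have "1 - cnj (b j) * z \<noteq> 0" if "j \<in> {1..n}" for j
  proof
    assume "1 - cnj (b j) * z = 0"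
    then have "norm (cnj (b j) * z) = 1" by (metis eq_iff_diff_eq_0 norm_one)
    moreover have "cmod (b j) * cmod z \<le> cmod (b j) * 1" using assms by (intro mult_left_mono) auto
    ultimately show False using b[OF that] by (simp add: norm_mult)
  qed
  then show ?thesis by (simp add: poly_star_zeros_poly)
qed

lemma zeros_poly_nonzero_circle: "cmod \<xi> = 1 \<Longrightarrow> poly W \<xi> \<noteq> 0"
  using star_zeros_poly_nonzero[of \<xi>] cmod_star_poly_circle[of W n \<xi>] degree_zeros_poly by auto

lemma open_star_zeros_poly: "open {z. poly (star_poly n W) z \<noteq> 0}"
  by (intro open_Collect_neq continuous_intros)

text \<open>Multiply the bounds for the squared factors; the square root halves 3/16. Under
  \<open>D_T\<close> the right side tends to 0.\<close>

lemma Blaschke_le: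
  assumes z: "cmod z \<le> 1/2"
  shows "cmod (poly W z / poly (star_poly n W) z) \<le> exp (- (3/32) * (\<Sum>j=1..n. 1 - cmod (b j)))"
proof -
  have "(cmod (poly W z))\<^sup>2 = (\<Prod>j=1..n. (cmod (z - b j))\<^sup>2)"
    by (simp add: W_def poly_prod prod_norm[symmetric] prod_power_distrib)
  also have "\<dots> \<le> (\<Prod>j=1..n. (cmod (1 - cnj (b j) * z))\<^sup>2 * exp (- (3/16) * (1 - cmod (b j))))"
    using Blaschke_factor_le[OF b z] by (intro prod_mono) auto
  also have "\<dots> = (cmod (poly (star_poly n W) z))\<^sup>2 * exp (- (3/16) * (\<Sum>j=1..n. 1 - cmod (b j)))"
    by (simp add: poly_star_zeros_poly prod.distrib prod_norm[symmetric] prod_power_distrib sum_distrib_left exp_sum)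
  also have "\<dots> = (cmod (poly (star_poly n W) z) * exp (- (3/32) * (\<Sum>j=1..n. 1 - cmod (b j))))\<^sup>2"
    by (simp add: power_mult_distrib exp_double[symmetric])
  finally have "cmod (poly W z) \<le> cmod (poly (star_poly n W) z) * exp (- (3/32) * (\<Sum>j=1..n. 1 - cmod (b j)))"
    by (rule power2_le_imp_le) simp
  then show ?thesis
    using star_zeros_poly_nonzero[of z] z by (simp add: norm_divide field_simps)
qed

text \<open>Cauchy's estimate on the circle of radius 1/2, the source of the factor 2^k.\<close>

lemma tcoeff_Blaschke_le:
  "cmod (tcoeff (\<lambda>z. poly W z / poly (star_poly n W) z) k) \<le> exp (- (3/32) * (\<Sum>j=1..n. 1 - cmod (b j))) * 2 ^ k"
proof -
  let ?B = "\<lambda>z. poly W z / poly (star_poly n W) z"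
  have "cmod ((deriv ^^ k) ?B 0) \<le> fact k * exp (- (3/32) * (\<Sum>j=1..n. 1 - cmod (b j))) / (1/2) ^ k"
  proof (rule Cauchy_inequality)
    have nz: "poly (star_poly n W) z \<noteq> 0" if "z \<in> cball 0 (1/2)" for z
      using that by (intro star_zeros_poly_nonzero) simp
    have hol: "?B holomorphic_on cball 0 (1/2)"
      by (intro holomorphic_intros nz)
    then show "continuous_on (cball 0 (1/2)) ?B" by (rule holomorphic_on_imp_continuous_on)
    show "?B holomorphic_on ball 0 (1/2)" by (rule holomorphic_on_subset[OF hol ball_subset_cball])
    show "cmod (?B x) \<le> exp (- (3/32) * (\<Sum>j=1..n. 1 - cmod (b j)))" if "cmod (0 - x) = 1/2" for x
      using that by (intro Blaschke_le) simp
  qed auto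
  then have "cmod ((deriv ^^ k) ?B 0) / fact k \<le> fact k * exp (- (3/32) * (\<Sum>j=1..n. 1 - cmod (b j))) / (1/2) ^ k / fact k"
    by (rule divide_right_mono) simp
  also have "\<dots> = exp (- (3/32) * (\<Sum>j=1..n. 1 - cmod (b j))) * 2 ^ k"
    by (simp add: power_divide)
  finally show ?thesis by (simp add: tcoeff_def norm_divide)
qed

text \<open>The condition on the coefficients means \<open>degree P < n\<close>, but also makes sense for \<open>n = 0\<close>. With
  \<open>T\<close> the Taylor polynomial of order \<open>m\<close> of the Blaschke product \<open>W / W\<^sup>*\<close>, the polynomial \<open>W - W\<^sup>* T\<close>
  vanishes to order \<open>m + 1\<close> at 0, so its reversal \<open>P\<close> has low degree, and
  \<open>|\<xi>\<^sup>m - P(\<xi>) / W\<^sup>*(\<xi>)| = |T(\<xi>)|\<close> on the circle.\<close>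

lemma rational_approx_power:
  "\<exists>P. (\<forall>k\<ge>n. coeff P k = 0) \<and> (\<forall>\<xi>\<in>sphere 0 1. cmod (\<xi> ^ m - poly P \<xi> / poly (star_poly n W) \<xi>) \<le>
     (\<Sum>k\<le>m. cmod (tcoeff (\<lambda>z. poly W z / poly (star_poly n W) z) k)))"
proof -
  let ?Ws = "star_poly n W" let ?B = "\<lambda>z. poly W z / poly ?Ws z"
  define T where "T = (\<Sum>k\<le>m. monom (tcoeff ?B k) k)"
  define V where "V = W - ?Ws * T"
  have cT: "coeff T k = (if k \<le> m then tcoeff ?B k else 0)" for k
    by (simp add: T_def coeff_sum)
  have dT: "degree T \<le> m" by (rule degree_le) (simp add: cT)
  have dWT: "degree (?Ws * T) \<le> n + m"
    using degree_mult_le[of ?Ws T] dT degree_star_poly_le[of n W] by linarith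
  have dV: "degree V \<le> n + m"
    unfolding V_def using dWT degree_zeros_poly by (intro degree_diff_le) auto
  have "?B holomorphic_on {z. poly ?Ws z \<noteq> 0}" by (auto intro!: holomorphic_intros)
  then have Bexp: "?B has_fps_expansion fps_expansion ?B 0"
    using star_zeros_poly_nonzero[of 0] by (intro has_fps_expansion_fps_expansion[OF open_star_zeros_poly]) auto
  let ?F = "fps_expansion ?B 0"
  have polyexp: "poly q has_fps_expansion fps_of_poly q" for q :: "complex poly"
    by (rule has_fps_expansion_poly)
  have WF: "fps_of_poly W = fps_of_poly ?Ws * ?F"
  proof (rule fps_ext)
    fix k
    have "eventually (\<lambda>z. z \<in> {z. poly ?Ws z \<noteq> 0}) (nhds 0)"
      using star_zeros_poly_nonzero[of 0] by (intro eventually_nhds_in_open open_star_zeros_poly) auto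
    then have ev: "eventually (\<lambda>z. poly ?Ws z * ?B z = poly W z) (nhds 0)"
      by eventually_elim auto
    have "(\<lambda>z. poly ?Ws z * ?B z) has_fps_expansion fps_of_poly ?Ws * ?F"
      by (intro has_fps_expansion_mult polyexp Bexp)
    then have "poly W has_fps_expansion fps_of_poly ?Ws * ?F"
      using has_fps_expansion_cong[OF ev refl] by simp
    then show "fps_nth (fps_of_poly W) k = fps_nth (fps_of_poly ?Ws * ?F) k"
      using has_fps_expansion_tcoeff[OF polyexp[of W], of k] has_fps_expansion_tcoeff[of "poly W" _ k] by simp
  qed
  have cV: "coeff V k = 0" if k: "k \<le> m" for k
  proof -
    have "coeff V k = fps_nth (fps_of_poly V) k" by simp
    also have "fps_of_poly V = fps_of_poly ?Ws * (?F - fps_of_poly T)"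
      by (simp add: V_def fps_of_poly_diff fps_of_poly_mult WF algebra_simps)
    also have "fps_nth \<dots> k = 0"
      unfolding fps_mult_nth using k
      by (intro sum.neutral ballI) (auto simp: cT fps_expansion_def tcoeff_def)
    finally show ?thesis .
  qed
  define P where "P = star_poly (n + m) V"
  \<comment> \<open>Reversal of order n + m sends index k to n + m - k, so k >= n meets exactly the
    coefficients of \<open>V\<close> of index at most m, which vanish.\<close>
  have "coeff P k = 0" if "k \<ge> n" for k
    using that by (auto simp: P_def coeff_star_poly intro!: cV)
  moreover have "cmod (\<xi> ^ m - poly P \<xi> / poly ?Ws \<xi>) \<le> (\<Sum>k\<le>m. cmod (tcoeff ?B k))" if "\<xi> \<in> sphere 0 1" for \<xi>
  proof -
    have \<xi>: "cmod \<xi> = 1" using that by simp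
    have nz: "poly ?Ws \<xi> \<noteq> 0" using star_zeros_poly_nonzero \<xi> by simp
    have "poly P \<xi> = \<xi> ^ (n + m) * cnj (poly V \<xi>)"
      unfolding P_def by (rule poly_star_poly_circle[OF dV \<xi>])
    also have "\<dots> = \<xi> ^ m * (\<xi> ^ n * cnj (poly W \<xi>)) - \<xi> ^ (n + m) * cnj (poly ?Ws \<xi>) * cnj (poly T \<xi>)"
      by (simp add: V_def power_add algebra_simps)
    also have "\<xi> ^ n * cnj (poly W \<xi>) = poly ?Ws \<xi>"
      using poly_star_poly_circle[of W n \<xi>] \<xi> degree_zeros_poly by simp
    finally have "\<xi> ^ m - poly P \<xi> / poly ?Ws \<xi> = \<xi> ^ (n + m) * cnj (poly ?Ws \<xi>) * cnj (poly T \<xi>) / poly ?Ws \<xi>"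
      using nz by (simp add: field_simps)
    then have "cmod (\<xi> ^ m - poly P \<xi> / poly ?Ws \<xi>) = cmod (poly T \<xi>)"
      using nz \<xi> by (simp add: norm_mult norm_divide norm_power)
    also have "poly T \<xi> = (\<Sum>k\<le>m. tcoeff ?B k * \<xi> ^ k)"
      by (simp add: T_def poly_sum poly_monom)
    also have "cmod \<dots> \<le> (\<Sum>k\<le>m. cmod (tcoeff ?B k))"
      using \<xi> by (intro order_trans[OF norm_sum] sum_mono) (simp add: norm_mult norm_power)
    finally show ?thesis .
  qed
  ultimately show ?thesis by blast
qed

text \<open>Linear combination of the approximants to powers. The factor in front of the exponential
  depends on \<open>Q\<close> alone, so with \<open>Q\<close> fixed the error tends to 0 under
  \<open>D_T\<close>.\<close>

lemma rational_approx_poly: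
  fixes Q :: "complex poly"
  shows "\<exists>P. (\<forall>k\<ge>n. coeff P k = 0) \<and> (\<forall>\<xi>\<in>sphere 0 1. cmod (poly Q \<xi> - poly P \<xi> / poly (star_poly n W) \<xi>) \<le>
     (\<Sum>m\<le>degree Q. cmod (coeff Q m) * (\<Sum>k\<le>m. 2 ^ k)) * exp (- (3/32) * (\<Sum>j=1..n. 1 - cmod (b j))))"
proof -
  let ?Ws = "star_poly n W" let ?B = "\<lambda>z. poly W z / poly ?Ws z"
  have "\<forall>m. \<exists>P. (\<forall>k\<ge>n. coeff P k = 0) \<and> (\<forall>\<xi>\<in>sphere 0 1. cmod (\<xi> ^ m - poly P \<xi> / poly ?Ws \<xi>) \<le> (\<Sum>k\<le>m. cmod (tcoeff ?B k)))"
    using rational_approx_power by blast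
  from choice[OF this] obtain P where P: "\<And>m k. k \<ge> n \<Longrightarrow> coeff (P m) k = 0"
    "\<And>m \<xi>. \<xi> \<in> sphere 0 1 \<Longrightarrow> cmod (\<xi> ^ m - poly (P m) \<xi> / poly ?Ws \<xi>) \<le> (\<Sum>k\<le>m. cmod (tcoeff ?B k))"
    by blast
  let ?E = "exp (- (3/32) * (\<Sum>j=1..n. 1 - cmod (b j)))"
  define R where "R = (\<Sum>m\<le>degree Q. smult (coeff Q m) (P m))"
  have "coeff R k = 0" if "k \<ge> n" for k
    using P(1)[OF that] by (simp add: R_def coeff_sum)
  moreover have "cmod (poly Q \<xi> - poly R \<xi> / poly ?Ws \<xi>) \<le> (\<Sum>m\<le>degree Q. cmod (coeff Q m) * (\<Sum>k\<le>m. 2 ^ k)) * ?E"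
    if \<xi>: "\<xi> \<in> sphere 0 1" for \<xi>
  proof -
    have "poly Q \<xi> - poly R \<xi> / poly ?Ws \<xi> = (\<Sum>m\<le>degree Q. coeff Q m * (\<xi> ^ m - poly (P m) \<xi> / poly ?Ws \<xi>))"
      by (simp add: R_def poly_sum poly_altdef[of Q] sum_subtractf right_diff_distrib sum_divide_distrib)
    also have "cmod \<dots> \<le> (\<Sum>m\<le>degree Q. cmod (coeff Q m) * (\<Sum>k\<le>m. 2 ^ k * ?E))"
    proof (intro order_trans[OF norm_sum] sum_mono)
      fix m
      have "cmod (\<xi> ^ m - poly (P m) \<xi> / poly ?Ws \<xi>) \<le> (\<Sum>k\<le>m. cmod (tcoeff ?B k))" by (rule P(2)[OF \<xi>])
      also have "\<dots> \<le> (\<Sum>k\<le>m. 2 ^ k * ?E)"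
        by (intro sum_mono) (use tcoeff_Blaschke_le in \<open>simp add: mult.commute\<close>)
      finally show "cmod (coeff Q m * (\<xi> ^ m - poly (P m) \<xi> / poly ?Ws \<xi>)) \<le> cmod (coeff Q m) * (\<Sum>k\<le>m. 2 ^ k * ?E)"
        by (simp add: norm_mult mult_left_mono)
    qed
    also have "\<dots> = (\<Sum>m\<le>degree Q. cmod (coeff Q m) * (\<Sum>k\<le>m. 2 ^ k)) * ?E"
      by (simp add: sum_distrib_right sum_distrib_left mult_ac)
    finally show ?thesis .
  qed
  ultimately show ?thesis by blast
qed

end

section \<open>Orthonormal polynomials with rational weights\<close>

lemma tcoeff_sums:
  assumes "f holomorphic_on ball 0 1" "cmod z < 1"
  shows "(\<lambda>k. tcoeff f k * z ^ k) sums f z"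
  using holomorphic_power_series[OF assms(1), of z] assms(2) by (simp add: tcoeff_def)

text \<open>Converts coefficient bounds into bounds on |z| <= r: with M = 1 for the reversed
  polynomial, where only the constant term is large, and with general M for phi.\<close>

lemma power_series_tail_le:
  assumes f: "f holomorphic_on ball 0 1" and c: "\<And>k. M \<le> k \<Longrightarrow> cmod (tcoeff f k) \<le> c"
    and z: "cmod z \<le> r" "r < 1"
  shows "cmod (f z - (\<Sum>k<M. tcoeff f k * z ^ k)) \<le> c * r ^ M / (1 - r)"
proof -
  have r: "0 \<le> r" "cmod z < 1" using z norm_ge_zero[of z] by linarith+
  have c0: "0 \<le> c" using c[of M] norm_ge_zero[of "tcoeff f M"] by linarith
  have "(\<lambda>k. tcoeff f (k + M) * z ^ (k + M)) sums (f z - (\<Sum>k<M. tcoeff f k * z ^ k))"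
    using tcoeff_sums[OF f r(2)] by (rule sums_split_initial_segment)
  moreover have "(\<lambda>k. c * r ^ M * r ^ k) sums (c * r ^ M * (1 / (1 - r)))"
    using r z by (intro sums_mult geometric_sums) auto
  moreover have "cmod (tcoeff f (k + M) * z ^ (k + M)) \<le> c * r ^ M * r ^ k" for k
  proof -
    have "cmod (tcoeff f (k + M) * z ^ (k + M)) = cmod (tcoeff f (k + M)) * cmod z ^ (k + M)"
      by (simp add: norm_mult norm_power)
    also have "\<dots> \<le> c * r ^ (k + M)"
      using c[of "k + M"] z c0 by (intro mult_mono power_mono) auto
    finally show ?thesis by (simp add: power_add mult_ac)
  qed
  ultimately show ?thesis
    using norm_suminf_le[of "\<lambda>k. tcoeff f (k + M) * z ^ (k + M)" "\<lambda>k. c * r ^ M * r ^ k"]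
    by (auto simp: sums_iff)
qed

lemma integral_exp_measure:
  fixes f :: "complex \<Rightarrow> 'b::{second_countable_topology,banach}"
  assumes "sets \<mu> = sets circle_borel" "continuous_on (sphere 0 1) g" "continuous_on (sphere 0 1) f"
  shows "(\<integral>\<xi>. f \<xi> \<partial>exp_measure g \<mu>) = (\<integral>\<xi>. exp (g \<xi>) *\<^sub>R f \<xi> \<partial>\<mu>)"
proof -
  have "g \<in> borel_measurable \<mu>" "f \<in> borel_measurable \<mu>"
    using assms by (auto intro: borel_measurable_circle_continuous)
  then show ?thesis unfolding exp_measure_def by (intro integral_density) auto
qed

lemma szego_exp_measure:
  assumes \<mu>: "circle_measure \<mu>" "lebesgue_decomp \<mu> w \<mu>s" and g: "continuous_on (sphere 0 1) g"
  shows "szego (exp_measure g \<mu>) = outer_fun (\<lambda>\<xi>. exp (g \<xi>) * w \<xi>)"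
proof
  fix z
  from szego_eq[OF lebesgue_decomp_exp_measure[OF \<mu> g]]
  show "szego (exp_measure g \<mu>) z = outer_fun (\<lambda>\<xi>. exp (g \<xi>) * w \<xi>) z"
    by (simp add: outer_fun_def herglotz_def)
qed

lemma outer_fun_0:
  assumes "integrable circle_m (\<lambda>\<xi>. ln (w \<xi>))"
  shows "outer_fun w 0 = of_real (exp (1/2 * (\<integral>\<xi>. ln (w \<xi>) \<partial>circle_m)))"
proof -
  have "herglotz (\<lambda>\<xi>. ln (w \<xi>)) 0 = (\<integral>\<xi>. complex_of_real (ln (w \<xi>)) \<partial>circle_m)"
    unfolding herglotz_def by (intro Bochner_Integration.integral_cong) auto
  then show ?thesis by (simp add: outer_fun_def exp_of_real[symmetric])
qed

locale rational_weight =
  fixes \<sigma> \<sigma>s :: "complex measure" and \<upsilon> :: "complex \<Rightarrow> real" and b :: "nat \<Rightarrow> complex"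
    and n :: nat and W :: "complex poly" and g :: "complex \<Rightarrow> real"
  assumes \<sigma>: "circle_measure \<sigma>" and dec: "lebesgue_decomp \<sigma> \<upsilon> \<sigma>s" and log: "log_integrable \<upsilon>"
    and W_def: "W = (\<Prod>j=1..n. [:- b j, 1:])" and b: "\<And>j. j \<in> {1..n} \<Longrightarrow> cmod (b j) < 1"
    and g: "continuous_on (sphere 0 1) g"
begin

abbreviation "Ws \<equiv> star_poly n W"
abbreviation "D \<equiv> outer_fun (\<lambda>\<xi>. exp (g \<xi>) * \<upsilon> \<xi>)"
abbreviation "\<mu> \<equiv> weighted_measure g W \<sigma>"

definition ell :: "nat \<Rightarrow> complex poly \<Rightarrow> complex" where
  "ell k P = tcoeff (\<lambda>z. poly P z / poly Ws z * D z) k"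

lemma Ws_nonzero: "cmod z \<le> 1 \<Longrightarrow> poly Ws z \<noteq> 0"
  by (rule star_zeros_poly_nonzero[OF W_def]) (auto intro: b)

lemma W_nonzero: "cmod \<xi> = 1 \<Longrightarrow> poly W \<xi> \<noteq> 0"
  by (rule zeros_poly_nonzero_circle[OF W_def]) (auto intro: b)

lemma degree_W: "degree W = n"
  by (rule degree_zeros_poly[OF W_def]) (auto intro: b)

lemma sets_sigma: "sets \<sigma> = sets circle_borel"
  using \<sigma> by (simp add: circle_measure_def)

text \<open>\<open>W\<close> has no zeros on the circle, so |W|^(-2) is itself the exponential of a
  continuous function and \<open>\<mu>\<close> falls under the results on
  \<open>exp_measure\<close>.\<close>

lemma mu_eq: "\<mu> = exp_measure (\<lambda>\<xi>. g \<xi> - ln ((cmod (poly W \<xi>))\<^sup>2)) \<sigma>"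
proof -
  have [measurable]: "g \<in> borel_measurable \<sigma>" "poly W \<in> borel_measurable \<sigma>"
    by (auto intro!: borel_measurable_circle_continuous sets_sigma g continuous_intros)
  show ?thesis
    unfolding weighted_measure_def exp_measure_def
  proof (intro density_cong AE_I2)
    fix \<xi> assume "\<xi> \<in> space \<sigma>"
    then have "poly W \<xi> \<noteq> 0" using W_nonzero[of \<xi>] space_circle_measure[OF sets_sigma] by simp
    then show "ennreal (exp (g \<xi>) / (cmod (poly W \<xi>))\<^sup>2) = ennreal (exp (g \<xi> - ln ((cmod (poly W \<xi>))\<^sup>2)))"
      by (simp add: exp_diff)
  qed measurable
qed

lemma cont_weight: "continuous_on (sphere 0 1) (\<lambda>\<xi>. g \<xi> - ln ((cmod (poly W \<xi>))\<^sup>2))"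
  using W_nonzero by (intro continuous_intros g) auto

lemma circle_measure_mu: "circle_measure \<mu>"
  unfolding mu_eq by (rule circle_measure_exp_measure[OF \<sigma> cont_weight])

lemma integral_mu:
  fixes f :: "complex \<Rightarrow> 'b::{second_countable_topology,banach}"
  assumes "continuous_on (sphere 0 1) f"
  shows "(\<integral>\<xi>. f \<xi> \<partial>\<mu>) = (\<integral>\<xi>. (exp (g \<xi>) / (cmod (poly W \<xi>))\<^sup>2) *\<^sub>R f \<xi> \<partial>\<sigma>)"
proof -
  have "(\<integral>\<xi>. f \<xi> \<partial>\<mu>) = (\<integral>\<xi>. exp (g \<xi> - ln ((cmod (poly W \<xi>))\<^sup>2)) *\<^sub>R f \<xi> \<partial>\<sigma>)"
    unfolding mu_eq by (rule integral_exp_measure[OF sets_sigma cont_weight assms])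
  also have "\<dots> = (\<integral>\<xi>. (exp (g \<xi>) / (cmod (poly W \<xi>))\<^sup>2) *\<^sub>R f \<xi> \<partial>\<sigma>)"
    using W_nonzero space_circle_measure[OF sets_sigma]
    by (intro Bochner_Integration.integral_cong) (auto simp: exp_diff)
  finally show ?thesis .
qed

text \<open>Since |W| = |Ws| on the circle, the varying factor moves from the measure to the
  function. The quotient by \<open>Ws\<close> is holomorphic on the closed disk, which a quotient by
  \<open>W\<close> need not be.\<close>

lemma sq_norm_mu:
  "(\<integral>\<xi>. (cmod (poly P \<xi>))\<^sup>2 \<partial>\<mu>) = (\<integral>\<xi>. (cmod (poly P \<xi> / poly Ws \<xi>))\<^sup>2 * exp (g \<xi>) \<partial>\<sigma>)"
proof -
  have "(\<integral>\<xi>. (cmod (poly P \<xi>))\<^sup>2 \<partial>\<mu>) = (\<integral>\<xi>. (exp (g \<xi>) / (cmod (poly W \<xi>))\<^sup>2) *\<^sub>R (cmod (poly P \<xi>))\<^sup>2 \<partial>\<sigma>)"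
    by (intro integral_mu continuous_intros)
  also have "\<dots> = (\<integral>\<xi>. (cmod (poly P \<xi> / poly Ws \<xi>))\<^sup>2 * exp (g \<xi>) \<partial>\<sigma>)"
    using space_circle_measure[OF sets_sigma] cmod_star_poly_circle[of W n] degree_W
    by (intro Bochner_Integration.integral_cong) (auto simp: norm_divide power_divide)
  finally show ?thesis .
qed

lemma weight_props:
  "circle_measure (exp_measure g \<sigma>)" "lebesgue_decomp (exp_measure g \<sigma>) (\<lambda>\<xi>. exp (g \<xi>) * \<upsilon> \<xi>) (exp_measure g \<sigma>s)"
  "integrable circle_m (\<lambda>\<xi>. exp (g \<xi>) * \<upsilon> \<xi>)" "log_integrable (\<lambda>\<xi>. exp (g \<xi>) * \<upsilon> \<xi>)"
proof -
  show 1: "circle_measure (exp_measure g \<sigma>)" by (rule circle_measure_exp_measure[OF \<sigma> g])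
  show 2: "lebesgue_decomp (exp_measure g \<sigma>) (\<lambda>\<xi>. exp (g \<xi>) * \<upsilon> \<xi>) (exp_measure g \<sigma>s)"
    by (rule lebesgue_decomp_exp_measure[OF \<sigma> dec g])
  show "integrable circle_m (\<lambda>\<xi>. exp (g \<xi>) * \<upsilon> \<xi>)" by (rule lebesgue_decomp_integrable[OF 1 2])
  show "log_integrable (\<lambda>\<xi>. exp (g \<xi>) * \<upsilon> \<xi>)"
    by (rule log_integrable_exp_mult(1)[OF g log lebesgue_decomp_sets(4)[OF \<sigma> dec]])
qed

lemma D_holomorphic: "D holomorphic_on ball 0 1"
  by (rule outer_fun_holomorphic[OF weight_props(3,4)])

lemma ratio_holomorphic: "(\<lambda>z. poly P z / poly Ws z * D z) holomorphic_on ball 0 1"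
  using Ws_nonzero by (intro holomorphic_intros D_holomorphic) (auto simp: less_imp_le)

text \<open>Bessel's inequality bounds the sum by the integral over the absolutely continuous part,
  and the singular part only adds to the right side.\<close>

lemma ell_le:
  assumes "finite A"
  shows "(\<Sum>k\<in>A. (cmod (ell k P))\<^sup>2) \<le> (\<integral>\<xi>. (cmod (poly P \<xi>))\<^sup>2 \<partial>\<mu>)"
proof -
  let ?R = "\<lambda>z. poly P z / poly Ws z"
  have Rc: "continuous_on (sphere 0 1) ?R" using Ws_nonzero by (intro continuous_intros) auto
  have "(\<Sum>k\<in>A. (cmod (ell k P))\<^sup>2) \<le> (\<integral>\<xi>. (cmod (?R \<xi>))\<^sup>2 * (exp (g \<xi>) * \<upsilon> \<xi>) \<partial>circle_m)"
    unfolding ell_def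
  proof (rule tcoeff_outer_fun_le[OF weight_props(3,4)])
    show "open {z. poly Ws z \<noteq> 0}" by (intro open_Collect_neq continuous_intros)
    show "cball 0 1 \<subseteq> {z. poly Ws z \<noteq> 0}" using Ws_nonzero by auto
    show "?R holomorphic_on {z. poly Ws z \<noteq> 0}" by (auto intro!: holomorphic_intros)
  qed fact
  also have "\<dots> \<le> (\<integral>\<xi>. (cmod (?R \<xi>))\<^sup>2 \<partial>exp_measure g \<sigma>)"
  proof -
    let ?f = "\<lambda>\<xi>. (cmod (?R \<xi>))\<^sup>2"
    have fc: "continuous_on (sphere 0 1) ?f" by (intro continuous_intros Rc)
    have "compact (?f ` sphere 0 1)" using fc by (intro compact_continuous_image) auto
    then obtain B where "\<forall>x\<in>?f ` sphere 0 1. norm x \<le> B" using compact_imp_bounded bounded_iff by blast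
    then have B: "\<And>\<xi>. \<xi> \<in> sphere 0 1 \<Longrightarrow> ?f \<xi> \<le> B" by auto
    have "?f \<in> borel_measurable circle_borel" using fc by (intro borel_measurable_circle_continuous) auto
    from lebesgue_decomp_integral(4)[OF weight_props(1,2) this _ B] show ?thesis
      by (simp add: integral_nonneg_AE)
  qed
  also have "\<dots> = (\<integral>\<xi>. (cmod (poly P \<xi>))\<^sup>2 \<partial>\<mu>)"
    unfolding sq_norm_mu by (subst integral_exp_measure[OF sets_sigma g])
      (auto intro!: continuous_intros Rc simp: mult.commute)
  finally show ?thesis .
qed

lemma ell_add_smult: "ell k (P + smult c R) = ell k P + c * ell k R"
proof -
  have "ell k (P + smult c R) = tcoeff (\<lambda>z. poly P z / poly Ws z * D z + c * (poly R z / poly Ws z * D z)) k"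
    unfolding ell_def by (intro arg_cong2[where f = tcoeff] ext) (auto simp: algebra_simps add_divide_distrib)
  also have "\<dots> = ell k P + tcoeff (\<lambda>z. c * (poly R z / poly Ws z * D z)) k"
    unfolding ell_def
    by (intro tcoeff_add[of "ball 0 1"] ratio_holomorphic holomorphic_on_mult[OF holomorphic_on_const]) simp_all
  also have "tcoeff (\<lambda>z. c * (poly R z / poly Ws z * D z)) k = c * ell k R"
    unfolding ell_def by (intro tcoeff_cmult[of "ball 0 1"] ratio_holomorphic) simp_all
  finally show ?thesis .
qed

lemma ell_0: "ell 0 P = poly P 0 / poly Ws 0 * D 0"
  by (simp add: ell_def tcoeff_0)

lemma Ws_0: "poly Ws 0 = 1"
  unfolding poly_star_poly_0 by (subst coeff_zeros_poly[OF W_def]) (auto intro: b)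

lemma D_0: "D 0 = of_real (exp (1/2 * ((\<integral>\<xi>. g \<xi> \<partial>circle_m) + (\<integral>\<xi>. ln (\<upsilon> \<xi>) \<partial>circle_m))))"
  using outer_fun_0[of "\<lambda>\<xi>. exp (g \<xi>) * \<upsilon> \<xi>"] weight_props(4)
    log_integrable_exp_mult(2)[OF g log lebesgue_decomp_sets(4)[OF \<sigma> dec]]
  by (simp add: log_integrable_def)

lemma int_mu: "continuous_on (sphere 0 1) f \<Longrightarrow> integrable \<mu> f"
  for f :: "complex \<Rightarrow> 'b::{second_countable_topology,banach}"
  by (rule integrable_circle_continuous[OF circle_measure_mu])

lemma sq_norm_star:
  assumes "degree P \<le> n"
  shows "(\<integral>\<xi>. (cmod (poly (star_poly n P) \<xi>))\<^sup>2 \<partial>\<mu>) = (\<integral>\<xi>. (cmod (poly P \<xi>))\<^sup>2 \<partial>\<mu>)"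
  using circle_measure_mu cmod_star_poly_circle[OF assms]
  by (intro Bochner_Integration.integral_cong) (auto simp: circle_measure_def space_circle_measure)

context
  fixes \<phi> :: "complex poly"
  assumes \<phi>: "orthonormal_poly \<mu> n \<phi>"
begin

lemma phi_props: "degree \<phi> \<le> n" "coeff \<phi> n = of_real (Re (coeff \<phi> n))" "0 < Re (coeff \<phi> n)"
  "(\<integral>\<xi>. (cmod (poly \<phi> \<xi>))\<^sup>2 \<partial>\<mu>) = 1"
  using \<phi> by (auto simp: orthonormal_poly_def complex_is_Real_iff complex_eq_iff)

lemma phi_orthogonal:
  assumes "\<And>k. n \<le> k \<Longrightarrow> coeff P k = 0"
  shows "(\<integral>\<xi>. poly \<phi> \<xi> * cnj (poly P \<xi>) \<partial>\<mu>) = 0"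
proof -
  have "poly P \<xi> = (\<Sum>m<n. coeff P m * \<xi> ^ m)" for \<xi>
  proof -
    have "poly P \<xi> = (\<Sum>m\<le>degree P. coeff P m * \<xi> ^ m)" by (rule poly_altdef)
    also have "\<dots> = (\<Sum>m<n. coeff P m * \<xi> ^ m)"
      by (rule sum.mono_neutral_cong) (auto simp: assms coeff_eq_0)
    finally show ?thesis .
  qed
  then have "(\<integral>\<xi>. poly \<phi> \<xi> * cnj (poly P \<xi>) \<partial>\<mu>) = (\<integral>\<xi>. (\<Sum>m<n. cnj (coeff P m) * (poly \<phi> \<xi> * cnj (\<xi> ^ m))) \<partial>\<mu>)"
    by (simp add: sum_distrib_left mult_ac)
  also have "\<dots> = (\<Sum>m<n. cnj (coeff P m) * (\<integral>\<xi>. poly \<phi> \<xi> * cnj (\<xi> ^ m) \<partial>\<mu>))"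
    by (subst Bochner_Integration.integral_sum) (auto intro!: int_mu continuous_intros)
  also have "\<dots> = 0" using \<phi> by (simp add: orthonormal_poly_def)
  finally show ?thesis .
qed

lemma sq_norm_add_phi:
  assumes "\<And>k. n \<le> k \<Longrightarrow> coeff P k = 0"
  shows "(\<integral>\<xi>. (cmod (poly (P + smult t \<phi>) \<xi>))\<^sup>2 \<partial>\<mu>) = (\<integral>\<xi>. (cmod (poly P \<xi>))\<^sup>2 \<partial>\<mu>) + (cmod t)\<^sup>2"
proof -
  have "(\<integral>\<xi>. (cmod (poly (P + smult t \<phi>) \<xi>))\<^sup>2 \<partial>\<mu>) =
     (\<integral>\<xi>. (cmod (poly P \<xi>))\<^sup>2 + (cmod t)\<^sup>2 * (cmod (poly \<phi> \<xi>))\<^sup>2 + Re (2 * t * (poly \<phi> \<xi> * cnj (poly P \<xi>))) \<partial>\<mu>)"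
  proof (intro Bochner_Integration.integral_cong refl)
    fix \<xi>
    show "(cmod (poly (P + smult t \<phi>) \<xi>))\<^sup>2 = (cmod (poly P \<xi>))\<^sup>2 + (cmod t)\<^sup>2 * (cmod (poly \<phi> \<xi>))\<^sup>2 + Re (2 * t * (poly \<phi> \<xi> * cnj (poly P \<xi>)))"
      by (simp only: cmod_power2 poly_add poly_smult plus_complex.simps times_complex.simps complex_cnj
          complex_Re_numeral complex_Im_numeral) (simp add: power2_eq_square algebra_simps)
  qed
  also have "\<dots> = (\<integral>\<xi>. (cmod (poly P \<xi>))\<^sup>2 \<partial>\<mu>) + (cmod t)\<^sup>2 * (\<integral>\<xi>. (cmod (poly \<phi> \<xi>))\<^sup>2 \<partial>\<mu>)
      + (\<integral>\<xi>. Re (2 * t * (poly \<phi> \<xi> * cnj (poly P \<xi>))) \<partial>\<mu>)"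
    by (subst Bochner_Integration.integral_add | (intro int_mu continuous_intros; fail) | simp)+
  also have "(\<integral>\<xi>. Re (2 * t * (poly \<phi> \<xi> * cnj (poly P \<xi>))) \<partial>\<mu>) = Re (2 * t * (\<integral>\<xi>. poly \<phi> \<xi> * cnj (poly P \<xi>) \<partial>\<mu>))"
    by (subst integral_Re) (auto intro!: int_mu continuous_intros)
  finally show ?thesis by (simp add: phi_orthogonal[OF assms] phi_props(4))
qed

text \<open>Testing the norm bound for \<open>ell k\<close> on P + t phi with the best t gives
  |ell(P)|^2 + N |ell(phi)|^2 <= N, where N is the squared norm of P. Near extremality of P leaves
  little room for the second term.\<close>

lemma ell_phi_le:
  assumes P: "\<And>j. n \<le> j \<Longrightarrow> coeff P j = 0" and e: "0 < e" "e < 1"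
    and N: "(\<integral>\<xi>. (cmod (poly P \<xi>))\<^sup>2 \<partial>\<mu>) \<le> 1 + e" and l: "1 - e \<le> cmod (ell k P)"
  shows "(cmod (ell k \<phi>))\<^sup>2 \<le> 3 * e"
proof -
  define N where "N = (\<integral>\<xi>. (cmod (poly P \<xi>))\<^sup>2 \<partial>\<mu>)"
  define p where "p = ell k P" define q where "q = ell k \<phi>"
  have p: "1 - e \<le> cmod p" "p \<noteq> 0" using l e by (auto simp: p_def)
  have one: "(cmod (ell k R))\<^sup>2 \<le> (\<integral>\<xi>. (cmod (poly R \<xi>))\<^sup>2 \<partial>\<mu>)" for R
    using ell_le[of "{k}" R] by simp
  \<comment> \<open>\<open>t\<close> is the coefficient for which \<open>P + t \<phi>\<close> is extremal for \<open>ell k\<close> on the span of \<open>P\<close> and \<open>\<phi>\<close>.\<close>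
  define t where "t = cnj q * of_real N / cnj p"
  define x where "x = N * (cmod q)\<^sup>2 / (cmod p)\<^sup>2"
  have N0: "0 < N"
  proof -
    have "0 < (cmod p)\<^sup>2" using p by simp
    also have "\<dots> \<le> N" using one[of P] by (simp add: p_def N_def)
    finally show ?thesis .
  qed
  have "(cmod (p + t * q))\<^sup>2 \<le> N + (cmod t)\<^sup>2"
    using one[of "P + smult t \<phi>"] sq_norm_add_phi[OF P, of t] by (simp add: ell_add_smult p_def q_def N_def)
  moreover have "p + t * q = p * of_real (1 + x)"
  proof -
    have "t * q = of_real (N * (cmod q)\<^sup>2) / cnj p"
      unfolding of_real_mult of_real_power complex_norm_square t_def by (simp add: field_simps complex_norm_square[symmetric])
    moreover have "p * of_real x = of_real (N * (cmod q)\<^sup>2) / cnj p"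
      unfolding x_def of_real_divide of_real_mult of_real_power complex_norm_square[of p]
      using p by (simp add: field_simps complex_norm_square[symmetric])
    ultimately show ?thesis by (simp add: algebra_simps)
  qed
  moreover have "(cmod t)\<^sup>2 = N * x"
    using N0 by (simp add: t_def x_def norm_mult norm_divide power_mult_distrib power_divide power2_eq_square)
  ultimately have "(cmod p)\<^sup>2 * (1 + x)\<^sup>2 \<le> N * (1 + x)"
    by (simp add: norm_mult power_mult_distrib distrib_left del: of_real_add)
  moreover have x0: "0 \<le> x" using N0 by (simp add: x_def)
  ultimately have "(cmod p)\<^sup>2 * (1 + x) \<le> N"
    by (simp add: power2_eq_square[of "1 + x"] mult.assoc[symmetric])
  moreover have "(cmod p)\<^sup>2 * x = N * (cmod q)\<^sup>2" using p by (simp add: x_def)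
  ultimately have le: "(cmod p)\<^sup>2 + N * (cmod q)\<^sup>2 \<le> N" by (simp add: distrib_left)
  have "(1 - e)\<^sup>2 \<le> (cmod p)\<^sup>2" using p e by (intro power_mono) auto
  \<comment> \<open>The constant 3 comes from (1 - 3e)(1 + e) <= (1 - e)^2; for 3e >= 1 the left
    side is not positive.\<close>
  have "(1 - 3 * e) * N \<le> (1 - e)\<^sup>2"
  proof (cases "1 - 3 * e \<le> 0")
    case True
    then have "(1 - 3 * e) * N \<le> 0" using N0 by (intro mult_nonpos_nonneg) auto
    also have "0 \<le> (1 - e)\<^sup>2" by simp
    finally show ?thesis .
  next
    case False
    then have "(1 - 3 * e) * N \<le> (1 - 3 * e) * (1 + e)" using N by (intro mult_left_mono) (auto simp: N_def)
    also have "\<dots> \<le> (1 - e)\<^sup>2" using zero_le_power2[of e] by (simp add: power2_eq_square algebra_simps)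
    finally show ?thesis .
  qed
  then have "N * (cmod q)\<^sup>2 \<le> N * (3 * e)"
    using le \<open>(1 - e)\<^sup>2 \<le> (cmod p)\<^sup>2\<close> by (simp add: algebra_simps)
  then show ?thesis using N0 by (simp add: q_def)
qed

text \<open>The reversal of \<open>P\<close> has the same norm and leading coefficient cnj(P(0)).
  Subtracting the multiple of phi with that leading coefficient leaves a polynomial orthogonal to
  phi, so by Pythagoras the norm is at least that of the multiple.\<close>

lemma leading_coeff_extremal:
  assumes P: "\<And>j. n < j \<Longrightarrow> coeff P j = 0"
  shows "(cmod (poly P 0))\<^sup>2 \<le> (Re (coeff \<phi> n))\<^sup>2 * (\<integral>\<xi>. (cmod (poly P \<xi>))\<^sup>2 \<partial>\<mu>)"
proof -
  define a where "a = Re (coeff \<phi> n)"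
  have a: "0 < a" "coeff \<phi> n = of_real a" using phi_props by (auto simp: a_def)
  have dP: "degree P \<le> n" by (rule degree_le) (use P in auto)
  define S where "S = star_poly n P"
  define c where "c = coeff S n / of_real a"
  have low: "coeff (S - smult c \<phi>) k = 0" if "n \<le> k" for k
  proof (cases "k = n")
    case True
    then show ?thesis using a by (simp add: c_def)
  next
    case False
    then have "n < k" using that by simp
    then show ?thesis using phi_props(1) by (simp add: S_def coeff_star_poly coeff_eq_0)
  qed
  have "(\<integral>\<xi>. (cmod (poly P \<xi>))\<^sup>2 \<partial>\<mu>) = (\<integral>\<xi>. (cmod (poly (S - smult c \<phi> + smult c \<phi>) \<xi>))\<^sup>2 \<partial>\<mu>)"
    using sq_norm_star[OF dP] by (simp add: S_def)
  also have "\<dots> = (\<integral>\<xi>. (cmod (poly (S - smult c \<phi>) \<xi>))\<^sup>2 \<partial>\<mu>) + (cmod c)\<^sup>2"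
    by (rule sq_norm_add_phi[OF low])
  also have "\<dots> \<ge> (cmod c)\<^sup>2" by simp
  finally have "(cmod c)\<^sup>2 \<le> (\<integral>\<xi>. (cmod (poly P \<xi>))\<^sup>2 \<partial>\<mu>)" .
  moreover have "cmod c = cmod (poly P 0) / a"
    using a by (simp add: c_def S_def coeff_star_poly norm_divide poly_0_coeff_0)
  ultimately have "(cmod (poly P 0))\<^sup>2 / a\<^sup>2 \<le> (\<integral>\<xi>. (cmod (poly P \<xi>))\<^sup>2 \<partial>\<mu>)"
    by (simp add: power_divide)
  then show ?thesis using a by (simp add: a_def[symmetric] field_simps)
qed

end

end

context rational_weight
begin

text \<open>The quantitative core for a single n. The polynomial for k = 0 and
  \<open>leading_coeff_extremal\<close> give (a d)^2 >= 1 - 3e for a d, the coefficient of index 0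
  of the reversed polynomial; Bessel on {0, k} then makes its other coefficients at most sqrt(3e).
  For phi, \<open>ell_phi_le\<close> treats the indices below \<open>M\<close>.\<close>

lemma ratio_bounds:
  assumes \<phi>: "orthonormal_poly \<mu> n \<phi>" and e: "0 < e" "e < 1" and M: "0 < M"
    and P: "\<And>k. k < M \<Longrightarrow> \<exists>P. (\<forall>j\<ge>n. coeff P j = 0) \<and> (\<integral>\<xi>. (cmod (poly P \<xi>))\<^sup>2 \<partial>\<mu>) \<le> 1 + e \<and>
       1 - e \<le> cmod (ell k P)"
    and z: "cmod z \<le> r" "r < 1"
  shows "cmod (poly (star_poly n \<phi>) z / poly Ws z * D z - 1) \<le> 3 * e + sqrt (3 * e) / (1 - r)"
    and "cmod (poly \<phi> z / poly Ws z * D z) \<le> sqrt (3 * e) / (1 - r) + r ^ M / (1 - r)"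
proof -
  have r: "0 \<le> r" "cmod z < 1" using z norm_ge_zero[of z] by linarith+
  let ?S = "star_poly n \<phi>"
  define a where "a = Re (coeff \<phi> n)"
  have a: "0 < a" "coeff \<phi> n = of_real a" using phi_props[OF \<phi>] by (auto simp: a_def)
  have NS: "(\<integral>\<xi>. (cmod (poly ?S \<xi>))\<^sup>2 \<partial>\<mu>) = 1"
    using sq_norm_star[OF phi_props(1)[OF \<phi>]] phi_props(4)[OF \<phi>] by simp
  obtain P0 where P0: "\<And>j. n \<le> j \<Longrightarrow> coeff P0 j = 0" "(\<integral>\<xi>. (cmod (poly P0 \<xi>))\<^sup>2 \<partial>\<mu>) \<le> 1 + e" "1 - e \<le> cmod (ell 0 P0)"
    using P[OF M] by blast
  define d where "d = exp (1/2 * ((\<integral>\<xi>. g \<xi> \<partial>circle_m) + (\<integral>\<xi>. ln (\<upsilon> \<xi>) \<partial>circle_m)))"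
  have d: "0 < d" "D 0 = of_real d" using D_0 by (auto simp: d_def)
  have S0: "ell 0 ?S = of_real (a * d)"
    by (simp only: ell_0 Ws_0 poly_star_poly_0[of n \<phi>] a(2) d(2)) simp
  have "(1 - e)\<^sup>2 \<le> (cmod (ell 0 P0))\<^sup>2" using P0(3) e by (intro power_mono) auto
  also have "\<dots> = (cmod (poly P0 0))\<^sup>2 * d\<^sup>2"
    unfolding ell_0 Ws_0 using d by (simp add: norm_mult power_mult_distrib)
  also have "\<dots> \<le> (a\<^sup>2 * (\<integral>\<xi>. (cmod (poly P0 \<xi>))\<^sup>2 \<partial>\<mu>)) * d\<^sup>2"
    using leading_coeff_extremal[OF \<phi>, of P0] P0(1) by (intro mult_right_mono) (auto simp: a_def)
  also have "\<dots> \<le> (a\<^sup>2 * (1 + e)) * d\<^sup>2"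
    using P0(2) by (intro mult_right_mono mult_left_mono) auto
  finally have lower: "(1 - e)\<^sup>2 \<le> (a * d)\<^sup>2 * (1 + e)" by (simp add: power_mult_distrib mult_ac)
  have "(1 - 3 * e) * (1 + e) \<le> (1 - e)\<^sup>2" using zero_le_power2[of e] by (simp add: power2_eq_square algebra_simps)
  then have "(1 - 3 * e) * (1 + e) \<le> (a * d)\<^sup>2 * (1 + e)" using lower by linarith
  then have ad: "1 - 3 * e \<le> (a * d)\<^sup>2" using e by simp
  have two: "(a * d)\<^sup>2 + (cmod (ell k ?S))\<^sup>2 \<le> 1" if "0 < k" for k
    using ell_le[of "{0, k}" ?S] that a d by (simp add: NS S0 power_mult_distrib norm_mult)
  have kS: "cmod (ell k ?S) \<le> sqrt (3 * e)" if "1 \<le> k" for k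
    using two[of k] that ad by (intro real_le_rsqrt) auto
  have "(a * d)\<^sup>2 \<le> 1" using two[of 1] zero_le_power2[of "cmod (ell 1 ?S)"] by linarith
  then have "a * d \<le> 1" using power2_le_imp_le[of "a * d" 1] by simp
  \<comment> \<open>For a number in [0, 1] the lower bound 1 - 3e on its square passes to the number
    itself.\<close>
  then have "(a * d)\<^sup>2 \<le> a * d" using a d by (simp add: power2_eq_square mult_left_le)
  then have ad1: "\<bar>a * d - 1\<bar> \<le> 3 * e" using ad \<open>a * d \<le> 1\<close> by linarith
  show "cmod (poly ?S z / poly Ws z * D z - 1) \<le> 3 * e + sqrt (3 * e) / (1 - r)"
  proof -
    let ?f = "\<lambda>z. poly ?S z / poly Ws z * D z"
    have "cmod (?f z - (\<Sum>k<1. tcoeff ?f k * z ^ k)) \<le> sqrt (3 * e) * r ^ 1 / (1 - r)"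
      by (rule power_series_tail_le[OF ratio_holomorphic _ z]) (use kS in \<open>auto simp: ell_def\<close>)
    also have "\<dots> \<le> sqrt (3 * e) / (1 - r)"
      using r z e by (intro divide_right_mono) (auto intro: mult_left_le)
    finally have 1: "cmod (?f z - of_real (a * d)) \<le> sqrt (3 * e) / (1 - r)"
      using S0 by (simp add: ell_def)
    have "?f z - 1 = (?f z - of_real (a * d)) + of_real (a * d - 1)" by simp
    also have "cmod \<dots> \<le> cmod (?f z - of_real (a * d)) + cmod (of_real (a * d - 1))" by (rule norm_triangle_ineq)
    also have "cmod (of_real (a * d - 1)) = \<bar>a * d - 1\<bar>" by (rule norm_of_real)
    finally show ?thesis using 1 ad1 by linarith
  qed
  show "cmod (poly \<phi> z / poly Ws z * D z) \<le> sqrt (3 * e) / (1 - r) + r ^ M / (1 - r)"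
  proof -
    let ?f = "\<lambda>z. poly \<phi> z / poly Ws z * D z"
    \<comment> \<open>This crude bound serves the indices from \<open>M\<close> on, where the
      smallness comes from r^M.\<close>
    have k1: "cmod (tcoeff ?f k) \<le> 1" for k
    proof -
      have "(cmod (tcoeff ?f k))\<^sup>2 \<le> 1\<^sup>2" using ell_le[of "{k}" \<phi>] phi_props(4)[OF \<phi>] by (simp add: ell_def)
      then show ?thesis by (rule power2_le_imp_le) simp
    qed
    have kM: "cmod (tcoeff ?f k) \<le> sqrt (3 * e)" if "k < M" for k
    proof (rule real_le_rsqrt)
      show "(cmod (tcoeff ?f k))\<^sup>2 \<le> 3 * e"
        using P[OF that] ell_phi_le[OF \<phi> _ e, of _ k] unfolding ell_def by blast
    qed
    have "cmod (?f z - (\<Sum>k<M. tcoeff ?f k * z ^ k)) \<le> 1 * r ^ M / (1 - r)"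
      by (rule power_series_tail_le[OF ratio_holomorphic k1 z])
    moreover have "cmod (\<Sum>k<M. tcoeff ?f k * z ^ k) \<le> (\<Sum>k<M. sqrt (3 * e) * r ^ k)"
    proof (intro order_trans[OF norm_sum] sum_mono)
      fix k assume "k \<in> {..<M}"
      then show "cmod (tcoeff ?f k * z ^ k) \<le> sqrt (3 * e) * r ^ k"
        using kM[of k] z e unfolding norm_mult norm_power by (intro mult_mono power_mono) auto
    qed
    moreover have "(\<Sum>k<M. sqrt (3 * e) * r ^ k) \<le> sqrt (3 * e) / (1 - r)"
    proof -
      have "(\<Sum>k<M. r ^ k) \<le> 1 / (1 - r)"
        using r z sum_le_suminf[of "\<lambda>k. r ^ k" "{..<M}"] by (simp add: summable_geometric suminf_geometric)
      then have "sqrt (3 * e) * (\<Sum>k<M. r ^ k) \<le> sqrt (3 * e) * (1 / (1 - r))"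
        using e by (intro mult_left_mono) auto
      then show ?thesis by (simp add: sum_distrib_left)
    qed
    moreover have "cmod (?f z) \<le> cmod (\<Sum>k<M. tcoeff ?f k * z ^ k) + cmod (?f z - (\<Sum>k<M. tcoeff ?f k * z ^ k))"
      by (rule norm_triangle_sub)
    ultimately show ?thesis by simp
  qed
qed

end

section \<open>Varying weights\<close>

lemma continuous_circle_bound:
  fixes f :: "complex \<Rightarrow> 'b::real_normed_vector"
  assumes "continuous_on (sphere 0 1) f"
  obtains B where "0 \<le> B" "\<And>\<xi>. \<xi> \<in> sphere 0 1 \<Longrightarrow> norm (f \<xi>) \<le> B"
proof -
  have "compact (f ` sphere 0 1)" using assms by (intro compact_continuous_image) auto
  then have "bounded (f ` sphere 0 1)" by (rule compact_imp_bounded)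
  then obtain B where "0 < B" "\<forall>x\<in>f ` sphere 0 1. norm x \<le> B" unfolding bounded_pos by blast
  then show thesis by (intro that[of B]) auto
qed

locale varying_weights =
  fixes \<sigma> \<sigma>s :: "nat \<Rightarrow> complex measure" and \<upsilon> :: "nat \<Rightarrow> complex \<Rightarrow> real"
    and \<tau> \<tau>s :: "complex measure" and \<omega> :: "complex \<Rightarrow> real"
    and W :: "nat \<Rightarrow> complex poly" and b :: "nat \<Rightarrow> nat \<Rightarrow> complex"
  assumes \<sigma>: "\<And>n. circle_measure (\<sigma> n)" "\<And>n. lebesgue_decomp (\<sigma> n) (\<upsilon> n) (\<sigma>s n)"
    and W: "\<And>n. W n = (\<Prod>j=1..n. [:- b n j, 1:])" "\<And>n j. j \<in> {1..n} \<Longrightarrow> cmod (b n j) < 1"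
    and \<tau>: "circle_measure \<tau>" "lebesgue_decomp \<tau> \<omega> \<tau>s"
    and A_T: "\<And>f. continuous_on (sphere 0 1) f \<Longrightarrow> (\<forall>\<xi>\<in>sphere 0 1. 0 \<le> f \<xi>) \<Longrightarrow>
        limsup (\<lambda>n. ereal (\<integral>\<xi>. f \<xi> \<partial>\<sigma> n)) \<le> ereal (\<integral>\<xi>. f \<xi> \<partial>\<tau>)"
    and B_T: "\<And>n. log_integrable (\<upsilon> n)" "log_integrable \<omega>"
        "(\<lambda>n. \<integral>\<xi>. \<bar>ln (\<upsilon> n \<xi>) - ln (\<omega> \<xi>)\<bar> \<partial>circle_m) \<longlonglongrightarrow> 0"
    and D_T: "filterlim (\<lambda>n. \<Sum>j=1..n. 1 - cmod (b n j)) at_top sequentially"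
begin

text \<open>The hypothesis of \<open>ratio_bounds\<close> as a predicate of the weight exponent, so
  that it can be made uniform over a compact family before any phi is considered.\<close>

definition near_optimal :: "nat \<Rightarrow> (complex \<Rightarrow> real) \<Rightarrow> real \<Rightarrow> nat \<Rightarrow> bool" where
  "near_optimal n g e k \<longleftrightarrow> (\<exists>P. (\<forall>j\<ge>n. coeff P j = 0) \<and>
     (\<integral>\<xi>. (cmod (poly P \<xi>))\<^sup>2 \<partial>weighted_measure g (W n) (\<sigma> n)) \<le> 1 + e \<and>
     1 - e \<le> cmod (rational_weight.ell (\<upsilon> n) n (W n) g k P))"

lemma weight: "continuous_on (sphere 0 1) g \<Longrightarrow> rational_weight (\<sigma> n) (\<sigma>s n) (\<upsilon> n) (b n) n (W n) g"
  using \<sigma> B_T(1) W by unfold_locales auto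

text \<open>The form in which \<open>A_T\<close> is used: eventual upper bounds for one fixed
  function at a time.\<close>

lemma eventually_integral_less:
  fixes f :: "complex \<Rightarrow> real"
  assumes "continuous_on (sphere 0 1) f" "\<And>\<xi>. \<xi> \<in> sphere 0 1 \<Longrightarrow> 0 \<le> f \<xi>" "0 < e"
  shows "\<forall>\<^sub>F n in sequentially. (\<integral>\<xi>. f \<xi> \<partial>\<sigma> n) < (\<integral>\<xi>. f \<xi> \<partial>\<tau>) + e"
proof -
  have "limsup (\<lambda>n. ereal (\<integral>\<xi>. f \<xi> \<partial>\<sigma> n)) < ereal ((\<integral>\<xi>. f \<xi> \<partial>\<tau>) + e)"
    using A_T[OF assms(1)] assms(2,3) by (auto intro: le_less_trans)
  then have "\<forall>\<^sub>F n in sequentially. ereal (\<integral>\<xi>. f \<xi> \<partial>\<sigma> n) < ereal ((\<integral>\<xi>. f \<xi> \<partial>\<tau>) + e)"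
    by (rule Limsup_lessD)
  then show ?thesis by simp
qed

text \<open>P comes from approximating z^k Q, where Q is near-extremal for the limit measure with
  weight exp(g0). The norm of P is compared with a fixed majorant through \<open>A_T\<close>. For
  the lower bound, \<open>ell k\<close> of z^k Q Ws equals Q(0) D(0), the error of approximation is
  absorbed by the norm bound on \<open>ell k\<close>, and \<open>B_T\<close> compares D(0) with its
  limit.\<close>

lemma eventually_near_optimal:
  assumes g0: "continuous_on (sphere 0 1) g0" and e: "0 < e" "e < 1"
  shows "\<exists>\<delta>>0. \<forall>\<^sub>F n in sequentially. \<forall>g. continuous_on (sphere 0 1) g \<longrightarrow>
     (\<forall>\<xi>\<in>sphere 0 1. \<bar>g \<xi> - g0 \<xi>\<bar> < \<delta>) \<longrightarrow> near_optimal n g e k"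
proof -
  \<comment> \<open>The norm ends at 1 + 5c + 6c^2 and the functional at 1 - 3c, both within e;
    \<open>c\<close> also serves as the radius around \<open>g0\<close>.\<close>
  define c where "c = e / 8"
  have c: "0 < c" "c < 1/8" using e by (auto simp: c_def)
  have wm: "\<omega> \<in> borel_measurable circle_m" by (rule lebesgue_decomp_sets(4)[OF \<tau>])
  note log = log_integrable_exp_mult[OF g0 B_T(2) wm]
  obtain Q where Q: "(\<integral>\<xi>. (cmod (poly Q \<xi>))\<^sup>2 \<partial>exp_measure g0 \<tau>) \<le> 1 + c"
    "1 - c \<le> cmod (poly Q 0) * exp (1/2 * (\<integral>\<xi>. ln (exp (g0 \<xi>) * \<omega> \<xi>) \<partial>circle_m))"
    using szego_minimum[OF circle_measure_exp_measure[OF \<tau>(1) g0] lebesgue_decomp_exp_measure[OF \<tau> g0] log(1), of c] c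
    by auto
  define I where "I = (\<integral>\<xi>. g0 \<xi> \<partial>circle_m) + (\<integral>\<xi>. ln (\<omega> \<xi>) \<partial>circle_m)"
  have st: "sets \<tau> = sets circle_borel" using \<tau>(1) by (simp add: circle_measure_def)
  have Q1: "(\<integral>\<xi>. (cmod (poly Q \<xi>))\<^sup>2 * exp (g0 \<xi>) \<partial>\<tau>) \<le> 1 + c"
    using Q(1) by (subst (asm) integral_exp_measure[OF st g0]) (auto intro!: continuous_intros simp: mult.commute)
  have Q2: "1 - c \<le> cmod (poly Q 0) * exp (I / 2)"
    using Q(2) log(2) by (simp add: I_def)
  have "continuous_on (sphere 0 1) (poly Q)" by (intro continuous_intros)
  then obtain K where K: "0 \<le> K" "\<And>\<xi>. \<xi> \<in> sphere 0 1 \<Longrightarrow> cmod (poly Q \<xi>) \<le> K"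
    using continuous_circle_bound by blast
  obtain G where G: "0 \<le> G" "\<And>\<xi>. \<xi> \<in> sphere 0 1 \<Longrightarrow> \<bar>g0 \<xi>\<bar> \<le> G"
    using continuous_circle_bound[OF g0] by (metis real_norm_def)
  define V where "V = measure \<tau> (space \<tau>)"
  define X where "X = exp (G + 1) * (V + 1)"
  have V: "0 \<le> V" by (simp add: V_def)
  have "1 * 1 \<le> X" unfolding X_def using G V by (intro mult_mono) auto
  then have X: "1 \<le> X" by simp
  \<comment> \<open>\<open>y\<close> is the uniform error of the rational approximation. It must
    raise the integral of the majorant by at most c and keep y^2 \<open>X\<close>, the bound for the
    squared norm of the remainder, below c^2.\<close>
  define y where "y = min 1 (c / ((2 * K + 1) * X))"
  have y: "0 < y" "y \<le> 1" "y * ((2 * K + 1) * X) \<le> c" "y\<^sup>2 * X \<le> c\<^sup>2"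
  proof -
    have pos: "0 < (2 * K + 1) * X" using K X by (intro mult_pos_pos) auto
    then show y0: "0 < y" using c by (simp add: y_def)
    show "y \<le> 1" by (simp add: y_def)
    have "y \<le> c / ((2 * K + 1) * X)" by (simp add: y_def)
    then show 1: "y * ((2 * K + 1) * X) \<le> c" by (rule pos_le_divide_eq[OF pos, THEN iffD1])
    have "y * (1 * X) \<le> y * ((2 * K + 1) * X)" using y0 K X by (intro mult_left_mono mult_right_mono) auto
    then have yX: "y * X \<le> c" using 1 by simp
    have "y * 1 \<le> y * X" using X y0 by (intro mult_left_mono) auto
    then have "y \<le> c" using yX by simp
    then have "y * (y * X) \<le> c * c" using yX y0 X c by (intro mult_mono) auto
    then show "y\<^sup>2 * X \<le> c\<^sup>2" by (simp add: power2_eq_square mult.assoc)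
  qed
  \<comment> \<open>Up to the factor exp(c) this majorizes |P / Ws|^2 exp(g) for every large n and
    every g near \<open>g0\<close>. It involves neither n nor g, which is what lets
    \<open>A_T\<close> apply.\<close>
  let ?f = "\<lambda>\<xi>. (cmod (poly Q \<xi>) + y)\<^sup>2 * exp (g0 \<xi>)"
  have fc: "continuous_on (sphere 0 1) ?f" by (intro continuous_intros g0)
  have f\<tau>: "(\<integral>\<xi>. ?f \<xi> \<partial>\<tau>) \<le> 1 + 2 * c"
  proof -
    have "(\<integral>\<xi>. ?f \<xi> \<partial>\<tau>) \<le> (\<integral>\<xi>. (cmod (poly Q \<xi>))\<^sup>2 * exp (g0 \<xi>) + y * ((2 * K + 1) * exp (G + 1)) \<partial>\<tau>)"
    proof (rule integral_mono)
      show "integrable \<tau> ?f" by (rule integrable_circle_continuous[OF \<tau>(1) fc])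
      show "integrable \<tau> (\<lambda>\<xi>. (cmod (poly Q \<xi>))\<^sup>2 * exp (g0 \<xi>) + y * ((2 * K + 1) * exp (G + 1)))"
        by (intro integrable_circle_continuous \<tau> continuous_intros g0)
      fix \<xi> assume "\<xi> \<in> space \<tau>"
      then have \<xi>: "\<xi> \<in> sphere 0 1" by (simp add: space_circle_measure[OF st])
      have "?f \<xi> = (cmod (poly Q \<xi>))\<^sup>2 * exp (g0 \<xi>) + y * ((2 * cmod (poly Q \<xi>) + y) * exp (g0 \<xi>))"
        by (simp add: power2_eq_square algebra_simps)
      also have "y * ((2 * cmod (poly Q \<xi>) + y) * exp (g0 \<xi>)) \<le> y * ((2 * K + 1) * exp (G + 1))"
        using K(2)[OF \<xi>] G(2)[OF \<xi>] y(1,2) K(1) by (intro mult_left_mono mult_mono add_mono) auto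
      finally show "?f \<xi> \<le> (cmod (poly Q \<xi>))\<^sup>2 * exp (g0 \<xi>) + y * ((2 * K + 1) * exp (G + 1))" by simp
    qed
    also have "\<dots> = (\<integral>\<xi>. (cmod (poly Q \<xi>))\<^sup>2 * exp (g0 \<xi>) \<partial>\<tau>) + V * (y * ((2 * K + 1) * exp (G + 1)))"
      unfolding V_def
      by (subst Bochner_Integration.integral_add) (auto intro!: integrable_circle_continuous \<tau> continuous_intros g0)
    also have "V * (y * ((2 * K + 1) * exp (G + 1))) \<le> (V + 1) * (y * ((2 * K + 1) * exp (G + 1)))"
      using y(1) K(1) by (intro mult_right_mono) auto
    also have "\<dots> = y * ((2 * K + 1) * X)" by (simp add: X_def mult_ac)
    finally show ?thesis using Q1 y(3) by linarith
  qed
  define Q' where "Q' = monom 1 k * Q"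
  have pQ': "poly Q' z = z ^ k * poly Q z" for z by (simp add: Q'_def poly_monom)
  have ev1: "\<forall>\<^sub>F n in sequentially. (\<integral>\<xi>. ?f \<xi> \<partial>\<sigma> n) < (\<integral>\<xi>. ?f \<xi> \<partial>\<tau>) + c"
    using c by (intro eventually_integral_less fc) auto
  have ev2: "\<forall>\<^sub>F n in sequentially. (\<integral>\<xi>. 1 \<partial>\<sigma> n) < (\<integral>\<xi>. 1 \<partial>\<tau>) + (1::real)"
    by (intro eventually_integral_less) auto
  have ev3: "\<forall>\<^sub>F n in sequentially. (\<integral>\<xi>. \<bar>ln (\<upsilon> n \<xi>) - ln (\<omega> \<xi>)\<bar> \<partial>circle_m) < c"
    using B_T(3) c by (intro order_tendstoD) auto
  define C where "C = (\<Sum>m\<le>degree Q'. cmod (coeff Q' m) * (\<Sum>k\<le>m. 2 ^ k))"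
  have ev4: "\<forall>\<^sub>F n in sequentially. C * exp (- (3/32) * (\<Sum>j=1..n. 1 - cmod (b n j))) < y"
  proof -
    have "filterlim (\<lambda>n. - ((3/32) * (\<Sum>j=1..n. 1 - cmod (b n j)))) at_bot sequentially"
      by (intro filterlim_compose[OF filterlim_uminus_at_bot_at_top] filterlim_tendsto_pos_mult_at_top[OF tendsto_const _ D_T]) auto
    then have "(\<lambda>n. exp (- ((3/32) * (\<Sum>j=1..n. 1 - cmod (b n j))))) \<longlonglongrightarrow> 0"
      by (rule filterlim_compose[OF exp_at_bot])
    then have "(\<lambda>n. C * exp (- ((3/32) * (\<Sum>j=1..n. 1 - cmod (b n j))))) \<longlonglongrightarrow> C * 0"
      by (intro tendsto_intros)
    then show ?thesis using y(1) by (intro order_tendstoD) auto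
  qed
  show ?thesis
  proof (intro exI conjI)
    show "0 < c" by fact
    show "\<forall>\<^sub>F n in sequentially. \<forall>g. continuous_on (sphere 0 1) g \<longrightarrow> (\<forall>\<xi>\<in>sphere 0 1. \<bar>g \<xi> - g0 \<xi>\<bar> < c) \<longrightarrow> near_optimal n g e k"
      using ev1 ev2 ev3 ev4
    proof eventually_elim
      case (elim n)
      show ?case
      proof (intro allI impI)
        fix g assume g: "continuous_on (sphere 0 1) g" and gg: "\<forall>\<xi>\<in>sphere 0 1. \<bar>g \<xi> - g0 \<xi>\<bar> < c"
        interpret rational_weight "\<sigma> n" "\<sigma>s n" "\<upsilon> n" "b n" n "W n" g by (rule weight[OF g])
        obtain P where P: "\<And>j. n \<le> j \<Longrightarrow> coeff P j = 0"
          "\<And>\<xi>. \<xi> \<in> sphere 0 1 \<Longrightarrow> cmod (poly Q' \<xi> - poly P \<xi> / poly Ws \<xi>) \<le> C * exp (- (3/32) * (\<Sum>j=1..n. 1 - cmod (b n j)))"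
          using rational_approx_poly[OF W(1)[of n] W(2)[of _ n], of Q'] unfolding C_def by blast
        have Py: "cmod (poly Q' \<xi> - poly P \<xi> / poly Ws \<xi>) \<le> y" if "\<xi> \<in> sphere 0 1" for \<xi>
          using P(2)[OF that] elim by linarith
        have sp: "space (\<sigma> n) = sphere 0 1" using \<sigma> by (simp add: circle_measure_def space_circle_measure)
        have Wnz: "\<And>\<xi>. \<xi> \<in> sphere 0 1 \<Longrightarrow> poly Ws \<xi> \<noteq> 0" using Ws_nonzero by simp
        note int\<sigma> = integrable_circle_continuous[OF \<sigma>]
        have N: "(\<integral>\<xi>. (cmod (poly P \<xi>))\<^sup>2 \<partial>\<mu>) \<le> 1 + e"
        proof -
          have "(\<integral>\<xi>. (cmod (poly P \<xi>))\<^sup>2 \<partial>\<mu>) \<le> (\<integral>\<xi>. exp c * ?f \<xi> \<partial>\<sigma> n)"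
            unfolding sq_norm_mu
          proof (rule integral_mono)
            show "integrable (\<sigma> n) (\<lambda>\<xi>. (cmod (poly P \<xi> / poly Ws \<xi>))\<^sup>2 * exp (g \<xi>))"
              using Wnz by (intro int\<sigma> continuous_intros g) auto
            show "integrable (\<sigma> n) (\<lambda>\<xi>. exp c * ?f \<xi>)" by (intro int\<sigma> continuous_intros g0)
            fix \<xi> assume "\<xi> \<in> space (\<sigma> n)"
            then have \<xi>: "\<xi> \<in> sphere 0 1" by (simp add: sp)
            have "cmod (poly P \<xi> / poly Ws \<xi>) \<le> cmod (poly Q' \<xi>) + cmod (poly Q' \<xi> - poly P \<xi> / poly Ws \<xi>)"
              using norm_triangle_sub[of "poly P \<xi> / poly Ws \<xi>" "poly Q' \<xi>"] by (simp add: norm_minus_commute)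
            also have "\<dots> \<le> cmod (poly Q \<xi>) + y"
              using Py[OF \<xi>] \<xi> by (simp add: pQ' norm_mult norm_power)
            finally have "(cmod (poly P \<xi> / poly Ws \<xi>))\<^sup>2 \<le> (cmod (poly Q \<xi>) + y)\<^sup>2" by (rule power_mono) simp
            moreover have "exp (g \<xi>) \<le> exp c * exp (g0 \<xi>)"
              using bspec[OF gg \<xi>] by (simp add: exp_add[symmetric])
            ultimately have "(cmod (poly P \<xi> / poly Ws \<xi>))\<^sup>2 * exp (g \<xi>) \<le> (cmod (poly Q \<xi>) + y)\<^sup>2 * (exp c * exp (g0 \<xi>))"
              by (rule mult_mono) auto
            then show "(cmod (poly P \<xi> / poly Ws \<xi>))\<^sup>2 * exp (g \<xi>) \<le> exp c * ?f \<xi>" by (simp add: mult_ac)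
          qed
          also have "\<dots> = exp c * (\<integral>\<xi>. ?f \<xi> \<partial>\<sigma> n)" by simp
          also have "\<dots> \<le> exp c * (1 + 3 * c)"
            using elim(1) f\<tau> by (intro mult_left_mono) auto
          also have "\<dots> \<le> (1 + 2 * c) * (1 + 3 * c)"
          proof (rule mult_right_mono)
            have "exp c \<le> 1 + c + c\<^sup>2" using c by (intro exp_bound) auto
            also have "c\<^sup>2 \<le> c" using c by (simp add: power2_eq_square mult_left_le)
            finally show "exp c \<le> 1 + 2 * c" by simp
          qed (use c in simp)
          also have "\<dots> = 1 + 5 * c + 6 * c * c" by (simp add: algebra_simps)
          also have "6 * c * c \<le> 6 * c * (1/8)" using c by (intro mult_left_mono) auto
          finally show ?thesis using c by (simp add: c_def)
        qed
        \<comment> \<open>R / Ws is the approximation error, at most \<open>y\<close> on the circle,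
          so the norm of R and hence \<open>ell k R\<close> is at most c.\<close>
        define R where "R = Q' * Ws - P"
        have "(cmod (ell k R))\<^sup>2 \<le> (\<integral>\<xi>. (cmod (poly R \<xi>))\<^sup>2 \<partial>\<mu>)" using ell_le[of "{k}" R] by simp
        also have "\<dots> \<le> (\<integral>\<xi>. y\<^sup>2 * exp (G + 1) \<partial>\<sigma> n)"
          unfolding sq_norm_mu
        proof (rule integral_mono)
          show "integrable (\<sigma> n) (\<lambda>\<xi>. (cmod (poly R \<xi> / poly Ws \<xi>))\<^sup>2 * exp (g \<xi>))"
            using Wnz by (intro int\<sigma> continuous_intros g) auto
          show "integrable (\<sigma> n) (\<lambda>\<xi>. y\<^sup>2 * exp (G + 1))" by (intro int\<sigma> continuous_intros)
          fix \<xi> assume "\<xi> \<in> space (\<sigma> n)"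
          then have \<xi>: "\<xi> \<in> sphere 0 1" by (simp add: sp)
          have "poly R \<xi> / poly Ws \<xi> = poly Q' \<xi> - poly P \<xi> / poly Ws \<xi>"
            using Wnz[OF \<xi>] by (simp add: R_def field_simps)
          then have "(cmod (poly R \<xi> / poly Ws \<xi>))\<^sup>2 \<le> y\<^sup>2"
            using Py[OF \<xi>] by (simp add: power_mono)
          moreover have "g \<xi> \<le> G + 1"
            using bspec[OF gg \<xi>] G(2)[OF \<xi>] c by (simp add: abs_le_iff abs_less_iff)
          then have "exp (g \<xi>) \<le> exp (G + 1)" by simp
          ultimately show "(cmod (poly R \<xi> / poly Ws \<xi>))\<^sup>2 * exp (g \<xi>) \<le> y\<^sup>2 * exp (G + 1)"
            by (rule mult_mono) auto
        qed
        also have "\<dots> = y\<^sup>2 * exp (G + 1) * (\<integral>\<xi>. 1 \<partial>\<sigma> n)" by simp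
        also have "\<dots> \<le> y\<^sup>2 * exp (G + 1) * (V + 1)"
          using elim(2) by (intro mult_left_mono) (auto simp: V_def)
        also have "\<dots> \<le> c\<^sup>2" using y(4) by (simp add: X_def mult_ac)
        finally have lR: "cmod (ell k R) \<le> c" by (rule power2_le_imp_le) (use c in simp)
        \<comment> \<open>\<open>Ws\<close> cancels on the disk, and the factor z^k shifts the
          coefficient of index k back to the value at 0.\<close>
        have main: "ell k (Q' * Ws) = poly Q 0 * D 0"
        proof -
          have "ell k (Q' * Ws) = tcoeff (\<lambda>z. z ^ k * (poly Q z * D z)) k"
            unfolding ell_def tcoeff_def
          proof (rule arg_cong2[where f = "(/)"], rule higher_deriv_cong_ev)
            have "\<forall>\<^sub>F z in nhds 0. z \<in> ball (0::complex) 1" by (intro eventually_nhds_in_open) auto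
            then show "\<forall>\<^sub>F z in nhds 0. poly (Q' * Ws) z / poly Ws z * D z = z ^ k * (poly Q z * D z)"
              by eventually_elim (use Ws_nonzero in \<open>auto simp: pQ' less_imp_le\<close>)
          qed auto
          also have "\<dots> = poly Q 0 * D 0"
            by (rule tcoeff_power_mult[of "ball 0 1"]) (auto intro!: holomorphic_intros D_holomorphic)
          finally show ?thesis .
        qed
        have "ell k P = ell k (Q' * Ws + smult (-1) R)" by (simp add: R_def)
        also have "\<dots> = poly Q 0 * D 0 - ell k R" by (simp only: ell_add_smult main) simp
        finally have eP: "ell k P = poly Q 0 * D 0 - ell k R" .
        define J where "J = (\<integral>\<xi>. g \<xi> \<partial>circle_m) + (\<integral>\<xi>. ln (\<upsilon> n \<xi>) \<partial>circle_m)"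
        \<comment> \<open>One c is lost in passing from \<open>g0\<close> to \<open>g\<close>, the
          other in passing from the limit density to that of \<open>\<sigma> n\<close>.\<close>
        have IJ: "I - 2 * c \<le> J"
        proof -
          note intm = integrable_circle_continuous[OF circle_measure_circle_m]
          have li: "integrable circle_m (\<lambda>\<xi>. ln (\<upsilon> n \<xi>))" "integrable circle_m (\<lambda>\<xi>. ln (\<omega> \<xi>))"
            using B_T by (auto simp: log_integrable_def)
          have 1: "(\<integral>\<xi>. g0 \<xi> - c \<partial>circle_m) \<le> (\<integral>\<xi>. g \<xi> \<partial>circle_m)"
          proof (rule integral_mono)
            fix \<xi> assume "\<xi> \<in> space circle_m"
            then show "g0 \<xi> - c \<le> g \<xi>" using bspec[OF gg, of \<xi>] by (simp add: abs_less_iff)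
          qed (intro intm continuous_intros g g0)+
          have 2: "(\<integral>\<xi>. g0 \<xi> - c \<partial>circle_m) = (\<integral>\<xi>. g0 \<xi> \<partial>circle_m) - c"
            using intm[OF g0] prob_space.prob_space[OF prob_space_circle_m] by (subst Bochner_Integration.integral_diff) (auto intro: intm)
          have "(\<integral>\<xi>. ln (\<omega> \<xi>) - ln (\<upsilon> n \<xi>) \<partial>circle_m) \<le> (\<integral>\<xi>. \<bar>ln (\<upsilon> n \<xi>) - ln (\<omega> \<xi>)\<bar> \<partial>circle_m)"
            using li by (intro integral_mono) auto
          then have "(\<integral>\<xi>. ln (\<omega> \<xi>) \<partial>circle_m) - (\<integral>\<xi>. ln (\<upsilon> n \<xi>) \<partial>circle_m) < c"
            using li elim(3) by simp
          then show ?thesis using 1 2 by (simp add: I_def J_def)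
        qed
        have "1 - 2 * c \<le> (1 - c) * (1 - c)" using zero_le_power2[of c] by (simp add: power2_eq_square algebra_simps)
        also have "\<dots> \<le> (1 - c) * exp (- c)"
          using c exp_ge_add_one_self[of "- c"] by (intro mult_left_mono) auto
        also have "\<dots> \<le> cmod (poly Q 0) * exp (I / 2) * exp (- c)"
          using Q2 by (intro mult_right_mono) auto
        also have "\<dots> = cmod (poly Q 0) * exp (I / 2 - c)" by (simp only: mult.assoc exp_add[symmetric]) simp
        also have "\<dots> \<le> cmod (poly Q 0) * exp (J / 2)"
          using IJ by (intro mult_left_mono) auto
        also have "\<dots> = cmod (poly Q 0 * D 0)"
          unfolding D_0 by (simp only: norm_mult norm_of_real J_def) simp
        also have "\<dots> \<le> cmod (ell k P) + cmod (ell k R)"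
          unfolding eP using norm_triangle_ineq[of "poly Q 0 * D 0 - ell k R" "ell k R"] by simp
        finally have "1 - e \<le> cmod (ell k P)" using lR c by (simp add: c_def)
        with N P(1) show "near_optimal n g e k" unfolding near_optimal_def by blast
      qed
    qed
  qed
qed

end

section \<open>Uniformity over the compact set of weights\<close>

lemma circle_C_continuous:
  assumes "f \<in> mspace circle_C"
  shows "continuous_on (sphere 0 1) f"
  using assms by (simp add: circle_C_def mspace_cfunspace)

lemma circle_C_less:
  assumes "f \<in> mspace circle_C" "g \<in> mspace circle_C" "mdist circle_C f g < e" "\<xi> \<in> sphere 0 1"
  shows "\<bar>f \<xi> - g \<xi>\<bar> < e"
proof -
  have "compactin (top_of_set (sphere 0 1)) (topspace (top_of_set (sphere (0::complex) 1)))"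
    by (simp add: compactin_subtopology)
  from cfunspace_mdist_lt[OF this assms(1-3)[unfolded circle_C_def], of \<xi>]
  have "mdist euclidean_metric (f \<xi>) (g \<xi>) < e"
    using assms(4) by simp
  then show ?thesis by (simp add: dist_real_def)
qed

context varying_weights
begin

context
  fixes E :: "(complex \<Rightarrow> real) set"
  assumes E: "compactin (mtopology_of circle_C) E"
begin

lemma E_subset: "E \<subseteq> mspace circle_C"
  using compactin_subset_topspace[OF E] by simp

text \<open>Each \<open>g0\<close> has its own radius and its own threshold in n. Finitely many such
  balls cover \<open>E\<close>, and the largest of their thresholds serves all of
  \<open>E\<close>.\<close>

lemma eventually_near_optimal_compact:
  assumes e: "0 < e" "e < 1"
  shows "\<forall>\<^sub>F n in sequentially. \<forall>g\<in>E. near_optimal n g e k"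
proof -
  have "\<forall>g0\<in>E. \<exists>\<delta>>0. \<forall>\<^sub>F n in sequentially. \<forall>g. continuous_on (sphere 0 1) g \<longrightarrow>
     (\<forall>\<xi>\<in>sphere 0 1. \<bar>g \<xi> - g0 \<xi>\<bar> < \<delta>) \<longrightarrow> near_optimal n g e k"
    using eventually_near_optimal[OF circle_C_continuous e] E_subset by blast
  then obtain \<delta> where \<delta>: "\<And>g0. g0 \<in> E \<Longrightarrow> 0 < \<delta> g0"
    "\<And>g0. g0 \<in> E \<Longrightarrow> \<forall>\<^sub>F n in sequentially. \<forall>g. continuous_on (sphere 0 1) g \<longrightarrow>
     (\<forall>\<xi>\<in>sphere 0 1. \<bar>g \<xi> - g0 \<xi>\<bar> < \<delta> g0) \<longrightarrow> near_optimal n g e k"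
    by (auto dest!: bchoice)
  define B where "B g0 = mball_of circle_C g0 (\<delta> g0)" for g0
  interpret C: Metric_space "mspace circle_C" "mdist circle_C" by (rule Metric_space_mspace_mdist)
  have "\<And>U. U \<in> B ` E \<Longrightarrow> openin (mtopology_of circle_C) U"
    by (auto simp: B_def mball_of_def mtopology_of_def)
  moreover have "E \<subseteq> \<Union>(B ` E)"
  proof
    fix g assume "g \<in> E"
    then have "g \<in> B g" using \<delta>(1)[of g] E_subset by (auto simp: B_def)
    then show "g \<in> \<Union>(B ` E)" using \<open>g \<in> E\<close> by blast
  qed
  ultimately obtain F where F: "finite F" "F \<subseteq> B ` E" "E \<subseteq> \<Union>F"
    using compactinD[OF E, of "B ` E"] by blast
  then obtain E' where E': "E' \<subseteq> E" "finite E'" "F = B ` E'"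
    by (meson finite_subset_image)
  have "\<forall>\<^sub>F n in sequentially. \<forall>g0\<in>E'. \<forall>g. continuous_on (sphere 0 1) g \<longrightarrow>
     (\<forall>\<xi>\<in>sphere 0 1. \<bar>g \<xi> - g0 \<xi>\<bar> < \<delta> g0) \<longrightarrow> near_optimal n g e k"
    using E' \<delta>(2) by (intro eventually_ball_finite) auto
  then show ?thesis
  proof eventually_elim
    case (elim n)
    show ?case
    proof
      fix g assume "g \<in> E"
      then obtain g0 where g0: "g0 \<in> E'" "g \<in> B g0" using F E' by blast
      have "g \<in> mspace circle_C" "g0 \<in> mspace circle_C" "mdist circle_C g g0 < \<delta> g0"
        using g0(2) by (auto simp: B_def C.commute)
      then show "near_optimal n g e k"
        using elim g0(1) circle_C_continuous circle_C_less by blast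
    qed
  qed
qed

text \<open>Order of choices: first \<open>h\<close> from \<eta>, then \<open>e\<close> and
  \<open>M\<close> from \<open>h\<close> and \<open>r\<close>, and only then n, large enough for the
  finitely many indices below \<open>M\<close>.\<close>

lemma admissible_bounds:
  assumes \<eta>: "0 < \<eta>" and r: "0 \<le> r" "r < 1"
  shows "\<forall>\<^sub>F n in sequentially. \<forall>(g, \<phi>)\<in>admissible E \<sigma> W. \<forall>z. cmod z \<le> r \<longrightarrow>
     cmod (poly (star_poly n (\<phi> n)) z / poly (star_poly n (W n)) z * szego (exp_measure (g n) (\<sigma> n)) z - 1) < \<eta> \<and>
     cmod (poly (\<phi> n) z / poly (star_poly n (\<phi> n)) z) < \<eta>"
proof -
  \<comment> \<open>|F - 1| < h <= 1/2 gives |F| >= 1/2, and |G| < 2h then gives |G / F| < 4h <=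
    \<eta>. The common factor D / Ws of \<open>F\<close> and \<open>G\<close> cancels in the
    quotient.\<close>
  define h where "h = min (1/2) (\<eta> / 4)"
  have h: "0 < h" "h \<le> 1/2" "h \<le> \<eta> / 4" using \<eta> by (auto simp: h_def)
  have "((\<lambda>e. 3 * e + sqrt (3 * e) / (1 - r)) \<longlongrightarrow> 3 * 0 + sqrt (3 * 0) / (1 - r)) (at_right 0)"
    using r by (intro tendsto_intros) auto
  then have "\<forall>\<^sub>F e in at_right 0. 3 * e + sqrt (3 * e) / (1 - r) < h"
    using h(1) by (intro order_tendstoD) auto
  moreover have "\<forall>\<^sub>F e in at_right 0. e \<in> {0<..<(1::real)}" by (rule eventually_at_right_real) simp
  ultimately have "\<forall>\<^sub>F e in at_right 0. 3 * e + sqrt (3 * e) / (1 - r) < h \<and> e \<in> {0<..<(1::real)}"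
    by (rule eventually_conj)
  then obtain e where e: "3 * e + sqrt (3 * e) / (1 - r) < h" "0 < e" "e < 1"
    using eventually_happens[of _ "at_right (0::real)"] by force
  have "(\<lambda>M. r ^ M / (1 - r)) \<longlonglongrightarrow> 0 / (1 - r)"
    using r by (intro tendsto_intros LIMSEQ_realpow_zero) auto
  then have "\<forall>\<^sub>F M in sequentially. r ^ M / (1 - r) < h"
    using h(1) by (intro order_tendstoD) auto
  then have "\<forall>\<^sub>F M in sequentially. r ^ M / (1 - r) < h \<and> 0 < M"
    using eventually_gt_at_top[of "0::nat"] by (rule eventually_conj)
  then obtain M where M: "r ^ M / (1 - r) < h" "0 < M"
    by (auto simp: eventually_sequentially)
  have "\<forall>\<^sub>F n in sequentially. \<forall>k\<in>{..<M}. \<forall>g\<in>E. near_optimal n g e k"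
    using eventually_near_optimal_compact[OF e(2,3)] by (intro eventually_ball_finite) auto
  then show ?thesis
  proof eventually_elim
    case (elim n)
    show ?case
    proof (rule ballI, rule case_prodI2, intro allI impI)
      fix x g \<phi> z assume "x \<in> admissible E \<sigma> W" "x = (g, \<phi>)" and z: "cmod z \<le> r"
      then have adm: "(g, \<phi>) \<in> admissible E \<sigma> W" by simp
      have gE: "g n \<in> E" and orth: "orthonormal_poly (weighted_measure (g n) (W n) (\<sigma> n)) n (\<phi> n)"
        using adm by (auto simp: admissible_def)
      have gc: "continuous_on (sphere 0 1) (g n)" using gE E_subset circle_C_continuous by blast
      have sz: "szego (exp_measure (g n) (\<sigma> n)) = outer_fun (\<lambda>\<xi>. exp (g n \<xi>) * \<upsilon> n \<xi>)"
        by (rule szego_exp_measure[OF \<sigma>(1,2) gc])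
      interpret R: rational_weight "\<sigma> n" "\<sigma>s n" "\<upsilon> n" "b n" n "W n" "g n" by (rule weight[OF gc])
      have opt: "\<exists>P. (\<forall>j\<ge>n. coeff P j = 0) \<and> (\<integral>\<xi>. (cmod (poly P \<xi>))\<^sup>2 \<partial>R.\<mu>) \<le> 1 + e \<and> 1 - e \<le> cmod (R.ell k P)"
        if "k < M" for k
        using elim that gE by (auto simp: near_optimal_def)
      note bnd = R.ratio_bounds[OF orth e(2,3) M(2) opt z r(2)]
      define F where "F = poly (star_poly n (\<phi> n)) z / poly R.Ws z * R.D z"
      define G where "G = poly (\<phi> n) z / poly R.Ws z * R.D z"
      have Fsz: "poly (star_poly n (\<phi> n)) z / poly (star_poly n (W n)) z * szego (exp_measure (g n) (\<sigma> n)) z = F"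
        by (simp only: F_def sz)
      have F: "cmod (F - 1) < h" using bnd(1) e(1) by (simp add: F_def)
      have G: "cmod G < 2 * h" using bnd(2) e M(1) by (simp add: G_def)
      have Wnz: "poly R.Ws z \<noteq> 0" using z r by (intro R.Ws_nonzero) linarith
      have Dnz: "R.D z \<noteq> 0" by (simp add: outer_fun_def)
      have ratio: "poly (\<phi> n) z / poly (star_poly n (\<phi> n)) z = G / F"
        using Wnz Dnz by (simp add: F_def G_def)
      have "1/2 \<le> cmod F" using F h(2) norm_triangle_ineq2[of 1 "1 - F"] by (simp add: norm_minus_commute)
      then have "cmod (G / F) \<le> cmod G / (1/2)" unfolding norm_divide by (intro divide_left_mono) auto
      also have "\<dots> < \<eta>" using G h(3) by simp
      finally show "cmod (poly (star_poly n (\<phi> n)) z / poly (star_poly n (W n)) z * szego (exp_measure (g n) (\<sigma> n)) z - 1) < \<eta> \<and>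
         cmod (poly (\<phi> n) z / poly (star_poly n (\<phi> n)) z) < \<eta>"
        using F h \<eta> unfolding Fsz ratio by simp
    qed
  qed
qed

end

end

text \<open>At index n the estimates involve a sequence only through its n-th members, so the
  threshold from \<open>admissible_bounds\<close> is common to all of
  \<open>admissible E \<sigma> W\<close>. A compact subset of the open disk lies in a closed disk of
  radius r < 1, on which those bounds hold.\<close>

theorem theorem5p1:
  fixes \<sigma> \<sigma>s :: "nat \<Rightarrow> complex measure" and \<upsilon> :: "nat \<Rightarrow> complex \<Rightarrow> real"
    and \<tau> \<tau>s :: "complex measure" and \<omega> :: "complex \<Rightarrow> real"
    and W :: "nat \<Rightarrow> complex poly" and b :: "nat \<Rightarrow> nat \<Rightarrow> complex"
    and E :: "(complex \<Rightarrow> real) set"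
  assumes \<sigma>: "\<And>n. circle_measure (\<sigma> n)" "\<And>n. lebesgue_decomp (\<sigma> n) (\<upsilon> n) (\<sigma>s n)"
    and W: "\<And>n. W n = (\<Prod>j=1..n. [:- b n j, 1:])" "\<And>n j. j \<in> {1..n} \<Longrightarrow> cmod (b n j) < 1"
    and \<tau>: "circle_measure \<tau>" "lebesgue_decomp \<tau> \<omega> \<tau>s"
    and A_T: "\<And>f. continuous_on (sphere 0 1) f \<Longrightarrow> (\<forall>\<xi>\<in>sphere 0 1. 0 \<le> f \<xi>) \<Longrightarrow>
        limsup (\<lambda>n. ereal (\<integral>\<xi>. f \<xi> \<partial>\<sigma> n)) \<le> ereal (\<integral>\<xi>. f \<xi> \<partial>\<tau>)"
    and B_T: "\<And>n. log_integrable (\<upsilon> n)" "log_integrable \<omega>"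
        "(\<lambda>n. \<integral>\<xi>. \<bar>ln (\<upsilon> n \<xi>) - ln (\<omega> \<xi>)\<bar> \<partial>circle_m) \<longlonglongrightarrow> 0"
    and C_T: "compactin (mtopology_of circle_C) E"
    and D_T: "filterlim (\<lambda>n. \<Sum>j=1..n. 1 - cmod (b n j)) at_top sequentially"
  shows "(\<forall>K. compact K \<and> K \<subseteq> ball 0 1 \<longrightarrow>
        uniform_limit (admissible E \<sigma> W \<times> K)
          (\<lambda>n ((g, \<phi>), z). poly (star_poly n (\<phi> n)) z / poly (star_poly n (W n)) z
                              * szego (exp_measure (g n) (\<sigma> n)) z)
          (\<lambda>_. 1) sequentially \<and>
        uniform_limit (admissible E \<sigma> W \<times> K)
          (\<lambda>n ((g, \<phi>), z). poly (\<phi> n) z / poly (star_poly n (\<phi> n)) z)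
          (\<lambda>_. 0) sequentially) \<and>
      uniform_limit (admissible E \<sigma> W)
        (\<lambda>n (g, \<phi>). coeff (\<phi> n) n * szego (exp_measure (g n) (\<sigma> n)) 0)
        (\<lambda>_. 1) sequentially"
proof -
  interpret V: varying_weights \<sigma> \<sigma>s \<upsilon> \<tau> \<tau>s \<omega> W b
    by unfold_locales (fact \<sigma> W \<tau> A_T B_T D_T)+
  note bounds = V.admissible_bounds[OF C_T]
  let ?F = "\<lambda>n g \<phi> z. poly (star_poly n (\<phi> n)) z / poly (star_poly n (W n)) z
                              * szego (exp_measure (g n) (\<sigma> n)) z"
  have radius: "\<exists>r. 0 \<le> r \<and> r < 1 \<and> (\<forall>z\<in>K. cmod z \<le> r)" if K: "compact K" "K \<subseteq> ball 0 1" for K :: "complex set"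
  proof (cases "K = {}")
    case False
    have "continuous_on K (cmod)" by (intro continuous_intros)
    then obtain x where "x \<in> K" "\<forall>y\<in>K. cmod y \<le> cmod x"
      using continuous_attains_sup[OF K(1) False] by blast
    then show ?thesis using K(2) by (intro exI[of _ "cmod x"]) auto
  qed (intro exI[of _ 0], simp)
  have locally: "uniform_limit (admissible E \<sigma> W \<times> K) (\<lambda>n ((g, \<phi>), z). ?F n g \<phi> z) (\<lambda>_. 1) sequentially"
    "uniform_limit (admissible E \<sigma> W \<times> K)
      (\<lambda>n ((g, \<phi>), z). poly (\<phi> n) z / poly (star_poly n (\<phi> n)) z) (\<lambda>_. 0) sequentially"
    if K: "compact K" "K \<subseteq> ball 0 1" for K
  proof -
    obtain r where r: "0 \<le> r" "r < 1" "\<And>z. z \<in> K \<Longrightarrow> cmod z \<le> r" using radius[OF K] by blast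
    show "uniform_limit (admissible E \<sigma> W \<times> K) (\<lambda>n ((g, \<phi>), z). ?F n g \<phi> z) (\<lambda>_. 1) sequentially"
    proof (rule uniform_limitI)
      fix e :: real assume "0 < e"
      from bounds[OF this r(1,2)]
      show "\<forall>\<^sub>F n in sequentially. \<forall>x\<in>admissible E \<sigma> W \<times> K. dist ((\<lambda>((g, \<phi>), z). ?F n g \<phi> z) x) 1 < e"
      proof eventually_elim
        case (elim n)
        show ?case
        proof
          fix x assume "x \<in> admissible E \<sigma> W \<times> K"
          then obtain g \<phi> z where x: "x = ((g, \<phi>), z)" "(g, \<phi>) \<in> admissible E \<sigma> W" "z \<in> K"
            by (cases x) auto
          show "dist ((\<lambda>((g, \<phi>), z). ?F n g \<phi> z) x) 1 < e"
            using bspec[OF elim x(2)] r(3)[OF x(3)] by (simp add: x(1) dist_norm)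
        qed
      qed
    qed
    show "uniform_limit (admissible E \<sigma> W \<times> K)
      (\<lambda>n ((g, \<phi>), z). poly (\<phi> n) z / poly (star_poly n (\<phi> n)) z) (\<lambda>_. 0) sequentially"
    proof (rule uniform_limitI)
      fix e :: real assume "0 < e"
      from bounds[OF this r(1,2)]
      show "\<forall>\<^sub>F n in sequentially. \<forall>x\<in>admissible E \<sigma> W \<times> K.
          dist ((\<lambda>((g, \<phi>), z). poly (\<phi> n) z / poly (star_poly n (\<phi> n)) z) x) 0 < e"
      proof eventually_elim
        case (elim n)
        show ?case
        proof
          fix x assume "x \<in> admissible E \<sigma> W \<times> K"
          then obtain g \<phi> z where x: "x = ((g, \<phi>), z)" "(g, \<phi>) \<in> admissible E \<sigma> W" "z \<in> K"
            by (cases x) auto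
          show "dist ((\<lambda>((g, \<phi>), z). poly (\<phi> n) z / poly (star_poly n (\<phi> n)) z) x) 0 < e"
            using bspec[OF elim x(2)] r(3)[OF x(3)] by (simp add: x(1) dist_norm)
        qed
      qed
    qed
  qed
  have leading: "uniform_limit (admissible E \<sigma> W) (\<lambda>n (g, \<phi>). coeff (\<phi> n) n * szego (exp_measure (g n) (\<sigma> n)) 0)
      (\<lambda>_. 1) sequentially"
  proof (rule uniform_limitI)
    fix e :: real assume "0 < e"
    \<comment> \<open>Radius 0 suffices: at the origin the reversed polynomials take the conjugate
      leading coefficients, which are the real number \<open>coeff (\<phi> n) n\<close> and
      1.\<close>
    from bounds[OF this, of 0]
    have "\<forall>\<^sub>F n in sequentially. \<forall>(g, \<phi>)\<in>admissible E \<sigma> W. cmod (?F n g \<phi> 0 - 1) < e"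
      by (auto elim!: eventually_mono)
    then show "\<forall>\<^sub>F n in sequentially. \<forall>x\<in>admissible E \<sigma> W.
        dist (case x of (g, \<phi>) \<Rightarrow> coeff (\<phi> n) n * szego (exp_measure (g n) (\<sigma> n)) 0) 1 < e"
    proof eventually_elim
      case (elim n)
      have W1: "coeff (W n) n = 1" by (rule coeff_zeros_poly[OF W])
      show ?case
      proof clarify
        fix g \<phi> assume adm: "(g, \<phi>) \<in> admissible E \<sigma> W"
        then have "coeff (\<phi> n) n \<in> \<real>" by (auto simp: admissible_def orthonormal_poly_def)
        then have "cnj (coeff (\<phi> n) n) = coeff (\<phi> n) n" by (simp add: Reals_cnj_iff)
        then have "?F n g \<phi> 0 = coeff (\<phi> n) n * szego (exp_measure (g n) (\<sigma> n)) 0"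
          by (simp only: poly_star_poly_0 W1) simp
        then show "dist (coeff (\<phi> n) n * szego (exp_measure (g n) (\<sigma> n)) 0) 1 < e"
          using elim adm by (auto simp: dist_norm)
      qed
    qed
  qed
  show ?thesis
  proof (rule conjI[OF _ leading], intro allI impI)
    fix K :: "complex set" assume "compact K \<and> K \<subseteq> ball 0 1"
    then have K: "compact K" "K \<subseteq> ball 0 1" by auto
    show "uniform_limit (admissible E \<sigma> W \<times> K) (\<lambda>n ((g, \<phi>), z). ?F n g \<phi> z) (\<lambda>_. 1) sequentially \<and>
      uniform_limit (admissible E \<sigma> W \<times> K)
        (\<lambda>n ((g, \<phi>), z). poly (\<phi> n) z / poly (star_poly n (\<phi> n)) z) (\<lambda>_. 0) sequentially"
      by (rule conjI[OF locally[OF K]])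
  qed
qed

end
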